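(* Let $s,t$ be real numbers and let $\Gamma$ be a connected nonregular graph whose adjacency matrix has precisely the three distinct eigenvalues $s>1>-t$, such that $\Gamma$ is not a cone and $\Gamma$ is not biregular. Then $t\leqslant 29$.
   Context: A graph on $n$ vertices is a cone if it has a vertex of degree $n-1$. A graph is biregular if it has precisely two distinct vertex valencies. *)

theory Defs
  imports "Graph_Theory.Graph_Theory" "Jordan_Normal_Form.Spectral_Radius"
begin

text \<open>
  A finite simple graph is a digraph satisfying \<open>graph\<close> of Graph_Theory: finite, without loops
  and parallel arcs, and with a symmetric arc relation. Each edge is thus a pair of opposite arcs,
  so the degree (valency) of a vertex is its out-degree, \<^emph>\<open>not\<close> the sum of its in- and out-degree.
\<close>

text \<open>
  The adjacency matrix with respect to a listing \<open>vs\<close> of the vertices, meant for distinct \<open>vs\<close>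
  with \<open>set vs = verts G\<close>; different listings give permutation-similar matrices.
\<close>

definition adjacency_matrix :: "('a, 'b) pre_digraph \<Rightarrow> 'a list \<Rightarrow> real mat" where
  "adjacency_matrix G vs =
     mat (length vs) (length vs) (\<lambda>(i, j). if vs ! i \<rightarrow>\<^bsub>G\<^esub> vs ! j then 1 else 0)"

definition valencies :: "('a, 'b) pre_digraph \<Rightarrow> nat set" where
  "valencies G = out_degree G ` verts G"

definition regular :: "('a, 'b) pre_digraph \<Rightarrow> bool" where
  "regular G \<longleftrightarrow> (\<exists>k. \<forall>v \<in> verts G. out_degree G v = k)"

definition biregular :: "('a, 'b) pre_digraph \<Rightarrow> bool" where
  "biregular G \<longleftrightarrow> card (valencies G) = 2"

definition cone :: "('a, 'b) pre_digraph \<Rightarrow> bool" where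
  "cone G \<longleftrightarrow> (\<exists>v \<in> verts G. out_degree G v = card (verts G) - 1)"

end

theory Submission
  imports Defs
begin

text \<open>
  Scaling a Perron vector gives \<open>\<alpha> > 0\<close> with \<open>(A - I) (A + t I) = \<alpha> \<alpha>\<^sup>T\<close>. So the valency of
  \<open>v\<close> is \<open>\<alpha>\<^sub>v\<^sup>2 + t\<close>, the number of common neighbours of two vertices is a function of their levels
  \<open>\<alpha>\<close> and of their adjacency, and \<open>I - A\<close> is a Lorentzian form, so that it
  satisfies the Cauchy--Schwarz inequality on the complement of a timelike vector. Applied to sums of
  vectors \<open>e\<^sub>y + e\<^sub>q\<close> with \<open>q\<close> adjacent to \<open>y\<close>, this inequality controls the graph induced on the
  two sides of the symmetric difference of the neighbourhoods of non-adjacent \<open>x\<close> and \<open>y\<close>.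

  Let \<open>t \<ge> 30\<close> and suppose that non-adjacent vertices of different levels exist. Among such pairs
  take one with minimal lower level \<open>\<mu>\<close> and then with maximal upper level. Comparing the second
  moments of the levels over the two neighbourhoods bounds \<open>\<mu>\<^sup>2\<close> by \<open>3 t\<close>, star arguments bound it
  by \<open>7\<close>, then again moments force \<open>\<mu> = 1\<close> and upper level \<open>t\<close>, where counting gives a contradiction.
  Hence non-adjacent vertices have the same level. With adjacent \<open>x\<close>, \<open>y\<close> of different levels every
  vertex is then adjacent to one of them, so the number of vertices is
  \<open>\<alpha>\<^sub>x\<^sup>2 + \<alpha>\<^sub>y\<^sup>2 - \<alpha>\<^sub>x \<alpha>\<^sub>y + 3 t - 1\<close>. Since there are at least three levels, comparing this count for the
  pairs among \<open>\<alpha>\<^sub>x, \<alpha>\<^sub>y, \<alpha>\<^sub>z\<close> gives \<open>\<alpha>\<^sub>x = \<alpha>\<^sub>y + \<alpha>\<^sub>z\<close> and \<open>\<alpha>\<^sub>y = \<alpha>\<^sub>x + \<alpha>\<^sub>z\<close>, so \<open>\<alpha>\<^sub>z = 0\<close>.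
\<close>

section \<open>The Lorentzian form\<close>

text \<open>With \<open>L = I - A\<close> the rank-one relation reads
  \<open>L^2 = (1 + t) L + \<alpha> \<alpha>^T\<close>. Hence \<open>|L f|^2 = (1 + t) B f f\<close>
  for \<open>f\<close> orthogonal to \<alpha>, which is why the form is nonnegative there. The
  vectors in play have products that depend only on adjacency, so a configuration in the graph is a
  small Gram matrix to which Cauchy--Schwarz applies.

  The obstacle is that levels may be irrational, while the available information consists of counts.
  Two devices connect them. Comparing common neighbours expresses
  \<open>(\<alpha> q - \<alpha> x) * (\<alpha> y - \<alpha> x)\<close> by counts. In the second
  moment of the levels over a neighbourhood, the unknown \<open>s\<close> and the unknown sum of all
  levels carry the same factor \<open>\<alpha> v\<close>, so two vertices suffice to eliminate both.
  For \<alpha> x < \<alpha> y the form leaves at most 8 vertices in \<open>N x - N y\<close>, so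
  \<open>\<alpha> x * (\<alpha> y - \<alpha> x)\<close> equals \<open>t\<close> up to 8; the
  estimates for extremal pairs start from this rigidity.\<close>

locale nb_graph =
  fixes V :: "'a set" and N :: "'a \<Rightarrow> 'a set"
  assumes finV: "finite V"
    and nbV: "w \<in> N v \<Longrightarrow> v \<in> V \<and> w \<in> V"
    and nb_sym: "w \<in> N v \<Longrightarrow> v \<in> N w"
    and nb_irr: "v \<notin> N v"
begin

lemma nb_iff: "w \<in> N v \<longleftrightarrow> v \<in> N w"
  using nb_sym by blast

lemma finN [simp]: "finite (N v)"
  by (rule finite_subset[OF _ finV]) (use nbV in blast)

lemma NV: "N v \<subseteq> V"
  using nbV by blast

lemma sum_N_eq: "v \<in> V \<Longrightarrow> (\<Sum>w\<in>N v. f w) = (\<Sum>w\<in>V. if w \<in> N v then f w else (0::real))"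
  using NV[of v] by (simp add: sum.inter_restrict[symmetric, OF finV] Int_absorb1)

lemma sum_nb_swap:
  fixes f g :: "'a \<Rightarrow> real"
  shows "(\<Sum>v\<in>V. f v * (\<Sum>w\<in>N v. g w)) = (\<Sum>v\<in>V. g v * (\<Sum>w\<in>N v. f w))"
proof -
  have *: "(\<Sum>v\<in>V. f v * (\<Sum>w\<in>N v. g w)) = (\<Sum>v\<in>V. \<Sum>w\<in>V. if w \<in> N v then f v * g w else 0)" for f g :: "'a \<Rightarrow> real"
  proof (rule sum.cong[OF refl])
    fix v assume v: "v \<in> V"
    have "f v * (\<Sum>w\<in>N v. g w) = (\<Sum>w\<in>V. f v * (if w \<in> N v then g w else 0))"
      unfolding sum_N_eq[OF v] by (rule sum_distrib_left)
    also have "\<dots> = (\<Sum>w\<in>V. if w \<in> N v then f v * g w else 0)"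
      by (rule sum.cong) auto
    finally show "f v * (\<Sum>w\<in>N v. g w) = \<dots>" .
  qed
  show ?thesis
    unfolding * by (subst sum.swap) (auto intro!: sum.cong simp: nb_iff)
qed

end

locale three_ev = nb_graph +
  fixes \<alpha> :: "'a \<Rightarrow> real" and s t :: real
  assumes pos: "v \<in> V \<Longrightarrow> 0 < \<alpha> v"
    and deg: "v \<in> V \<Longrightarrow> real (card (N v)) = (\<alpha> v)\<^sup>2 + t"
    and common_adj: "w \<in> N v \<Longrightarrow> real (card (N v \<inter> N w)) = \<alpha> v * \<alpha> w + 1 - t"
    and common_nonadj: "v \<in> V \<Longrightarrow> w \<in> V \<Longrightarrow> v \<noteq> w \<Longrightarrow> w \<notin> N v \<Longrightarrow>
      real (card (N v \<inter> N w)) = \<alpha> v * \<alpha> w"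
    and eig: "v \<in> V \<Longrightarrow> (\<Sum>w\<in>N v. \<alpha> w) = s * \<alpha> v"
begin

text \<open>\<open>I - A\<close>, not the usual graph Laplacian.\<close>

definition lap :: "('a \<Rightarrow> real) \<Rightarrow> 'a \<Rightarrow> real" where
  "lap f v = f v - (\<Sum>w\<in>N v. f w)"

definition B :: "('a \<Rightarrow> real) \<Rightarrow> ('a \<Rightarrow> real) \<Rightarrow> real" where
  "B f g = (\<Sum>v\<in>V. f v * lap g v)"

definition wt :: "('a \<Rightarrow> real) \<Rightarrow> real" where
  "wt f = (\<Sum>v\<in>V. \<alpha> v * f v)"

definition scl :: "real \<Rightarrow> ('a \<Rightarrow> real) \<Rightarrow> 'a \<Rightarrow> real" where
  "scl c f = (\<lambda>v. c * f v)"

definition add :: "('a \<Rightarrow> real) \<Rightarrow> ('a \<Rightarrow> real) \<Rightarrow> 'a \<Rightarrow> real"  (infixl \<open>\<boxplus>\<close> 65) where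
  "f \<boxplus> g = (\<lambda>v. f v + g v)"

definition fsum :: "('i \<Rightarrow> 'a \<Rightarrow> real) \<Rightarrow> 'i set \<Rightarrow> 'a \<Rightarrow> real" where
  "fsum F I = (\<lambda>v. \<Sum>i\<in>I. F i v)"

definition e :: "'a \<Rightarrow> 'a \<Rightarrow> real" where
  "e x = (\<lambda>v. if v = x then 1 else 0)"

lemma B_sym: "B f g = B g f"
  using sum_nb_swap[of f g]
  by (simp add: B_def lap_def right_diff_distrib sum_subtractf mult.commute)

lemma lap_add: "lap (f \<boxplus> g) v = lap f v + lap g v"
  by (simp add: lap_def add_def sum.distrib)

lemma lap_scl: "lap (scl c f) v = c * lap f v"
  by (simp add: lap_def scl_def sum_distrib_left right_diff_distrib)

lemma B_add_right: "B f (g \<boxplus> h) = B f g + B f h"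
  by (simp add: B_def lap_add distrib_left sum.distrib)

lemma B_add_left: "B (g \<boxplus> h) f = B g f + B h f"
  by (simp add: B_sym[of _ f] B_add_right)

lemma B_scl_right: "B f (scl c g) = c * B f g"
  by (simp add: B_def lap_scl sum_distrib_left algebra_simps)

lemma B_scl_left: "B (scl c g) f = c * B g f"
  by (simp add: B_sym[of _ f] B_scl_right)

lemma B_sum_left: "B (fsum F I) g = (\<Sum>i\<in>I. B (F i) g)"
  by (simp add: B_def fsum_def sum_distrib_right sum.swap[of _ I])

lemma B_sum_right: "B g (fsum F I) = (\<Sum>i\<in>I. B g (F i))"
  by (simp add: B_sym[of g] B_sum_left)

lemmas B_lin = B_add_left B_add_right B_scl_left B_scl_right B_sum_left B_sum_right

lemma wt_add: "wt (f \<boxplus> g) = wt f + wt g"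
  by (simp add: wt_def add_def distrib_left sum.distrib)

lemma wt_scl: "wt (scl c f) = c * wt f"
  by (simp add: wt_def scl_def sum_distrib_left algebra_simps)

lemma wt_e: "x \<in> V \<Longrightarrow> wt (e x) = \<alpha> x"
  using finV by (simp add: wt_def e_def if_distrib sum.delta cong: if_cong)

lemma B_e: "x \<in> V \<Longrightarrow> y \<in> V \<Longrightarrow> B (e x) (e y) = (if x = y then 1 else if y \<in> N x then -1 else 0)"
proof -
  assume "x \<in> V" "y \<in> V"
  have "B (e x) (e y) = (\<Sum>v\<in>V. if v = x then lap (e y) v else 0)"
    unfolding B_def by (intro sum.cong) (auto simp: e_def)
  also have "\<dots> = lap (e y) x"
    using finV \<open>x \<in> V\<close> by simp
  also have "\<dots> = (if x = y then 1 else if y \<in> N x then -1 else 0)"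
    using nb_irr by (auto simp: lap_def e_def)
  finally show ?thesis .
qed

lemma common_alt:
  assumes "v \<in> V" "w \<in> V"
  shows "real (card (N v \<inter> N w)) = \<alpha> v * \<alpha> w + (if w \<in> N v then 1 - t else 0) + (if w = v then t else 0)"
  using assms deg[of v] common_adj[of w v] common_nonadj[of v w] nb_irr
  by (auto simp: power2_eq_square)

text \<open>Walks of length two are counted by common neighbours, and \<open>common_alt\<close>
  writes that count as a combination of \<open>A\<close>, \<open>I\<close> and the rank-one
  term.\<close>

lemma lap_lap:
  assumes "v \<in> V"
  shows "lap (lap f) v = (1 + t) * lap f v + \<alpha> v * wt f"
proof -
  have "(\<Sum>w\<in>N v. \<Sum>u\<in>N w. f u) = (\<Sum>w\<in>V. \<Sum>u\<in>V. if w \<in> N v \<and> w \<in> N u then f u else 0)"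
    using assms by (subst sum_N_eq[OF assms], intro sum.cong refl) (auto simp: sum_N_eq nb_iff intro!: sum.cong sum.neutral[symmetric])
  also have "\<dots> = (\<Sum>u\<in>V. \<Sum>w\<in>V. if w \<in> N v \<inter> N u then f u else 0)"
    by (subst sum.swap) (intro sum.cong refl, auto)
  also have "\<dots> = (\<Sum>u\<in>V. real (card (N v \<inter> N u)) * f u)"
  proof (intro sum.cong refl)
    fix u assume "u \<in> V"
    have "N v \<inter> N u \<subseteq> V" using NV by blast
    then have "(\<Sum>w\<in>V. if w \<in> N v \<inter> N u then f u else 0) = (\<Sum>w\<in>N v \<inter> N u. f u)"
      by (subst sum.inter_restrict[symmetric, OF finV]) (simp add: Int_absorb1)
    then show "(\<Sum>w\<in>V. if w \<in> N v \<inter> N u then f u else 0) = real (card (N v \<inter> N u)) * f u"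
      by simp
  qed
  also have "\<dots> = (\<Sum>u\<in>V. \<alpha> v * (\<alpha> u * f u) + (1 - t) * (if u \<in> N v then f u else 0) + (if u = v then t * f u else 0))"
    using assms by (intro sum.cong refl) (auto simp: common_alt algebra_simps)
  also have "\<dots> = \<alpha> v * wt f + (1 - t) * (\<Sum>u\<in>N v. f u) + t * f v"
    using assms finV by (simp add: sum.distrib sum_distrib_left[symmetric] wt_def sum_N_eq)
  finally have "(\<Sum>w\<in>N v. \<Sum>u\<in>N w. f u) = \<alpha> v * wt f + (1 - t) * (\<Sum>u\<in>N v. f u) + t * f v" .
  then show ?thesis
    by (simp add: lap_def sum_subtractf algebra_simps)
qed

lemma sum_lap_square: "(\<Sum>v\<in>V. (lap f v)\<^sup>2) = (1 + t) * B f f + (wt f)\<^sup>2"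
proof -
  have "(\<Sum>v\<in>V. (lap f v)\<^sup>2) = B (lap f) f"
    by (simp add: B_def power2_eq_square)
  also have "\<dots> = B f (lap f)" by (rule B_sym)
  also have "\<dots> = (\<Sum>v\<in>V. f v * ((1 + t) * lap f v + \<alpha> v * wt f))"
    unfolding B_def by (intro sum.cong refl) (simp add: lap_lap)
  also have "\<dots> = (1 + t) * B f f + (wt f)\<^sup>2"
    by (simp add: B_def distrib_left sum.distrib sum_distrib_left wt_def power2_eq_square sum_distrib_right algebra_simps)
  finally show ?thesis .
qed

end

section \<open>Cauchy--Schwarz inequalities for the Lorentzian form\<close>

locale three_ev_pos = three_ev +
  assumes t_pos: "t > 0"
begin

lemma B_nonneg: "wt f = 0 \<Longrightarrow> B f f \<ge> 0"
  using sum_lap_square[of f] sum_nonneg[of V "\<lambda>v. (lap f v)\<^sup>2"] t_pos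
  by (simp add: zero_le_mult_iff)

text \<open>By \<open>sum_lap_square\<close> such an \<open>f\<close> is annihilated by
  \<open>I - A\<close> on \<open>V\<close>: an isotropic vector of weight 0 lies in the radical of
  the form.\<close>

lemma B_null:
  assumes "wt f = 0" "B f f = 0" shows "B g f = 0"
proof -
  have "(\<Sum>v\<in>V. (lap f v)\<^sup>2) = 0" using assms sum_lap_square[of f] by simp
  then have "\<forall>v\<in>V. lap f v = 0" using finV by (simp add: sum_nonneg_eq_0_iff)
  then show ?thesis by (simp add: B_def)
qed

text \<open>A timelike \<open>a\<close> has nonzero weight, so \<open>b\<close> can be corrected by
  a multiple of \<open>a\<close> to weight 0, where the form is nonnegative. The correction leaves
  the Gram determinant of the pair unchanged.\<close>

lemma reverse_cs:
  assumes "B a a < 0" shows "B a a * B b b \<le> (B a b)\<^sup>2"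
proof -
  have "wt a \<noteq> 0" using assms B_nonneg[of a] by auto
  define c where "c = wt b / wt a"
  have "wt (b \<boxplus> scl (-c) a) = 0" using \<open>wt a \<noteq> 0\<close> by (simp add: wt_add wt_scl c_def)
  then have "0 \<le> B (b \<boxplus> scl (-c) a) (b \<boxplus> scl (-c) a)" by (rule B_nonneg)
  also have "\<dots> = B b b - 2 * c * B a b + c\<^sup>2 * B a a"
    by (simp add: B_lin B_sym[of b a] power2_eq_square algebra_simps)
  finally have "B a a * (B b b - 2 * c * B a b + c\<^sup>2 * B a a) \<le> 0"
    using assms by (simp add: mult_nonpos_nonneg)
  then have "B a a * B b b - (B a b)\<^sup>2 + (B a b - c * B a a)\<^sup>2 \<le> 0"
    by (simp add: power2_eq_square algebra_simps)
  then show ?thesis by (smt (verit) zero_le_power2)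
qed

text \<open>The projections of \<open>b\<close> and \<open>c\<close> along the timelike \<open>a\<close> satisfy the Cauchy--Schwarz inequality.\<close>

lemma lorentz_cs:
  assumes "B a a < 0"
  shows "(B a a * B b c - B a b * B a c)\<^sup>2
    \<le> (B a a * B b b - (B a b)\<^sup>2) * (B a a * B c c - (B a c)\<^sup>2)"
proof -
  define p q r where "p = (B a b)\<^sup>2 - B a a * B b b" "q = B a b * B a c - B a a * B b c" "r = (B a c)\<^sup>2 - B a a * B c c"
  \<comment> \<open>The reverse inequality for \<open>b\<close> plus \<open>l\<close> times
    \<open>c\<close>, read as a quadratic in \<open>l\<close> that is nowhere negative; the claim is
    its discriminant condition.\<close>
  have quad: "0 \<le> p + 2 * l * q + l\<^sup>2 * r" for l
    using reverse_cs[OF assms, of "b \<boxplus> scl l c"]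
    by (simp add: p_q_r_def B_lin B_sym[of c b] power2_eq_square algebra_simps)
  have r0: "0 \<le> r" using reverse_cs[OF assms, of c] by (simp add: p_q_r_def)
  have "q\<^sup>2 \<le> p * r"
  proof (cases "r = 0")
    case True
    have "q = 0"
    proof (rule ccontr)
      assume "q \<noteq> 0"
      then show False using quad[of "- (p + 1) / (2 * q)"] True by (simp add: field_simps)
    qed
    then show ?thesis using True by simp
  next
    case False
    then have "0 < r" using r0 by simp
    then show ?thesis using quad[of "- q / r"]
      by (simp add: field_simps power2_eq_square)
  qed
  then show ?thesis
    by (simp add: p_q_r_def power2_eq_square algebra_simps)
qed

end

section \<open>Neighbourhoods of non-adjacent vertices\<close>

lemma card_split:
  assumes "finite A" shows "real (card A) = real (card (A \<inter> S)) + real (card (A - S))"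
proof -
  have "card A = card (A \<inter> S) + card (A - S)"
    using card_Int_Diff[OF assms, of S] by simp
  then show ?thesis by simp
qed

context three_ev
begin

lemma card_diff:
  assumes "x \<in> V" "y \<in> V" "x \<noteq> y" "y \<notin> N x"
  shows "real (card (N x - N y)) = t - \<alpha> x * (\<alpha> y - \<alpha> x)"
  using card_split[OF finN, of x "N y"] deg[OF assms(1)] common_nonadj[OF assms]
  by (simp add: power2_eq_square algebra_simps)

text \<open>Write P, Q, C for \<open>N x - N y\<close>, \<open>N y - N x\<close>,
  \<open>N x \<inter> N y\<close>. Subtracting the common neighbours of \<open>q\<close> with
  \<open>x\<close> from those with \<open>y\<close> cancels the part in C. Neighbours in Q and
  non-neighbours in P remain, which ties real levels to integers.\<close>

lemma level_formula:
  assumes "x \<in> V" "y \<in> V" "x \<noteq> y" "y \<notin> N x" "q \<in> N y - N x"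
  shows "(\<alpha> q - \<alpha> x) * (\<alpha> y - \<alpha> x)
    = real (card ((N y - N x) \<inter> N q)) + real (card ((N x - N y) - N q)) - 1"
proof -
  have q: "q \<in> N y" "q \<in> V" "q \<noteq> x" "x \<notin> N q"
    using assms nbV[of q y] nb_iff[of q y] nb_iff[of x y] nb_iff[of x q] by auto
  have 1: "real (card (N y \<inter> N q)) = real (card ((N x \<inter> N y) \<inter> N q)) + real (card ((N y - N x) \<inter> N q))"
  proof -
    have "(N y \<inter> N q) \<inter> N x = (N x \<inter> N y) \<inter> N q" "(N y \<inter> N q) - N x = (N y - N x) \<inter> N q" by auto
    then show ?thesis using card_split[of "N y \<inter> N q" "N x"] by simp
  qed
  have 2: "real (card (N q \<inter> N x)) = real (card ((N x \<inter> N y) \<inter> N q)) + real (card ((N x - N y) \<inter> N q))"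
  proof -
    have "(N q \<inter> N x) \<inter> N y = (N x \<inter> N y) \<inter> N q" "(N q \<inter> N x) - N y = (N x - N y) \<inter> N q" by auto
    then show ?thesis using card_split[of "N q \<inter> N x" "N y"] by simp
  qed
  have 3: "real (card (N x - N y)) = real (card ((N x - N y) \<inter> N q)) + real (card ((N x - N y) - N q))"
    by (rule card_split) simp
  show ?thesis
    using 1 2 3 common_adj[OF q(1)] common_nonadj[OF q(2) assms(1) q(3,4)] card_diff[OF assms(1-4)]
    by (simp add: algebra_simps)
qed

text \<open>A vertex of Q whose level is at most that of \<open>x\<close> misses at least
  \<open>t - 1\<close> common neighbours of \<open>x\<close> and \<open>y\<close>. The star lemmas
  allow far fewer on average, and this conflict excludes large cocliques of low vertices.\<close>

lemma missing_formula:
  assumes "x \<in> V" "y \<in> V" "x \<noteq> y" "y \<notin> N x" "q \<in> N y - N x"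
  shows "real (card ((N x \<inter> N y) - N q))
    = t - 1 + real (card ((N y - N x) \<inter> N q)) + (\<alpha> x - \<alpha> q) * \<alpha> y"
proof -
  have 1: "real (card (N y \<inter> N q)) = real (card ((N x \<inter> N y) \<inter> N q)) + real (card ((N y - N x) \<inter> N q))"
  proof -
    have "(N y \<inter> N q) \<inter> N x = (N x \<inter> N y) \<inter> N q" "(N y \<inter> N q) - N x = (N y - N x) \<inter> N q" by auto
    then show ?thesis using card_split[of "N y \<inter> N q" "N x"] by simp
  qed
  show ?thesis
    using 1 card_split[of "N x \<inter> N y" "N q"] common_adj[of q y] common_nonadj[OF assms(1-4)] assms(5)
    by (simp add: algebra_simps)
qed

text \<open>A spoke at \<open>y\<close>: for \<open>q\<close> in \<open>N y\<close> it is isotropic,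
  since \<open>1 + 1 - 2 = 0\<close>.\<close>

definition u :: "'a \<Rightarrow> 'a \<Rightarrow> 'a \<Rightarrow> real" where
  "u y q = e q \<boxplus> e y"

lemma wt_u: "q \<in> N y \<Longrightarrow> wt (u y q) = \<alpha> q + \<alpha> y"
  using nbV[of q y] by (simp add: u_def wt_add wt_e)

lemma B_u:
  assumes "q \<in> N y" "q' \<in> N y"
  shows "B (u y q) (u y q') = (if q = q' then 0 else if q' \<in> N q then -2 else -1)"
  using assms nbV[of q y] nbV[of q' y] nb_irr[of y] nb_iff[of q y] nb_iff[of q' y]
  by (auto simp: u_def B_lin B_e)

lemma B_u_cross:
  assumes "x \<in> V" "y \<in> V" "x \<noteq> y" "y \<notin> N x" "p \<in> N x - N y" "q \<in> N y - N x"
  shows "B (u x p) (u y q) = (if q \<in> N p then -1 else 0)"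
proof -
  have "p \<in> V" "q \<in> V" "p \<noteq> y" "q \<noteq> x" "p \<noteq> q" "y \<notin> N p" "q \<notin> N x"
    using assms nbV nb_iff by blast+
  then show ?thesis using assms by (simp add: u_def B_lin B_e)
qed

end

context three_ev_pos
begin

text \<open>A non-adjacent pair \<open>p\<close>, \<open>q\<close> gives two orthogonal isotropic vectors, which are therefore parallel.\<close>

lemma matching:
  assumes xy: "x \<in> V" "y \<in> V" "x \<noteq> y" "y \<notin> N x"
    and pq: "p \<in> N x - N y" "q \<in> N y - N x" "q \<notin> N p"
    and p': "p' \<in> N x - N y" "p' \<noteq> p" and q': "q' \<in> N y - N x" "q' \<noteq> q"
  shows "q \<in> N p'" "q' \<in> N p" "p' \<notin> N p" "q' \<notin> N q" "\<alpha> p + \<alpha> x = \<alpha> q + \<alpha> y"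
proof -
  have pos': "0 < \<alpha> p + \<alpha> x" "0 < \<alpha> q + \<alpha> y"
    using pos[of p] pos[of q] pos[OF xy(1)] pos[OF xy(2)] nbV[of p x] nbV[of q y] pq by auto
  define c where "c = (\<alpha> p + \<alpha> x) / (\<alpha> q + \<alpha> y)"
  define z where "z = u x p \<boxplus> scl (-c) (u y q)"
  have c0: "c > 0" unfolding c_def using pos' by simp
  have wz: "wt z = 0"
    using pos' pq by (simp add: z_def wt_add wt_scl wt_u c_def)
  have cr: "B (u x a) (u y b) = (if b \<in> N a then -1 else 0)" "B (u y b) (u x a) = (if b \<in> N a then -1 else 0)"
    if "a \<in> N x - N y" "b \<in> N y - N x" for a b
    using B_u_cross[OF xy that] B_sym by auto
  have "B z z = 0"
    using pq by (simp add: z_def B_lin B_u cr)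
  from B_null[OF wz this] have null: "B g z = 0" for g .
  \<comment> \<open>The radical vector \<open>z\<close> is tested against another spoke at
    \<open>x\<close> and another at \<open>y\<close>. The first test leaves \<open>c\<close> in {1,
    2}, the second \<open>c\<close> in {1/2, 1}, so only \<open>c = 1\<close> survives.\<close>
  have 1: "(if p' \<in> N p then -2 else -1) = c * (if q \<in> N p' then -1 else 0)"
    using null[of "u x p'"] pq p' nb_iff[of p p'] by (simp add: z_def B_lin B_u cr split: if_splits)
  have 2: "(if q' \<in> N p then -1 else 0) = c * (if q' \<in> N q then -2 else -1)"
    using null[of "u y q'"] pq q' nb_iff[of q q'] by (simp add: z_def B_lin B_u cr split: if_splits)
  show "q \<in> N p'" "q' \<in> N p" using 1 2 c0 by (auto split: if_splits)
  with 1 2 have c: "c \<ge> 1" "c \<le> 1" by (auto split: if_splits)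
  show "p' \<notin> N p" "q' \<notin> N q" using 1 2 c \<open>q \<in> N p'\<close> \<open>q' \<in> N p\<close> by (auto split: if_splits)
  show "\<alpha> p + \<alpha> x = \<alpha> q + \<alpha> y" using c pos' by (simp add: c_def)
qed

text \<open>Test vectors: \<open>u x p + u x p'\<close>, \<open>u y q\<close> and \<open>u y q1 + u y q2\<close>.\<close>

lemma edge_degree:
  assumes xy: "x \<in> V" "y \<in> V" "x \<noteq> y" "y \<notin> N x"
    and p: "p \<in> N x - N y" "p' \<in> N x - N y" "p' \<in> N p"
    and q: "q \<in> N y - N x" "q1 \<in> N y - N x" "q2 \<in> N y - N x" "q1 \<noteq> q2" "q1 \<in> N q" "q2 \<in> N q"
    and full: "\<And>r. r \<in> {q, q1, q2} \<Longrightarrow> r \<in> N p \<and> r \<in> N p'"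
  shows False
proof -
  have cr: "B (u x a) (u y b) = (if b \<in> N a then -1 else 0)" "B (u y b) (u x a) = (if b \<in> N a then -1 else 0)"
    if "a \<in> N x - N y" "b \<in> N y - N x" for a b
    using B_u_cross[OF xy that] B_sym by auto
  define a where "a = u x p \<boxplus> u x p'"
  define c where "c = u y q1 \<boxplus> u y q2"
  have ne: "p \<noteq> p'" "q \<noteq> q1" "q \<noteq> q2" "p \<in> N p'" using p q nb_irr nb_iff by blast+
  have aa: "B a a = -4" using p ne by (simp add: a_def B_lin B_u)
  have ab: "B a (u y q) = -2" using p q full by (simp add: a_def B_lin cr)
  have ac: "B a c = -4" using p q full by (simp add: a_def c_def B_lin cr)
  have bb: "B (u y q) (u y q) = 0" using q by (simp add: B_u)
  have bc: "B (u y q) c = -4" using q ne by (simp add: c_def B_lin B_u)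
  have cc: "B c c \<le> -2" using q nb_iff[of q1 q2] by (simp add: c_def B_lin B_u)
  \<comment> \<open>The inequality reads \<open>64 <= 64 + 16 * B c c\<close>, contrary to
    \<open>cc\<close>.\<close>
  show False
    using lorentz_cs[of a "u y q" c] cc by (simp add: aa ab ac bb bc)
qed

text \<open>Test vectors: the sum of the spokes over \<open>P\<close>, timelike as soon as there are
  two of them, the spoke at \<open>q\<close>, and the sum over \<open>R\<close>. Edges inside
  \<open>R\<close> only lower \<open>B c c\<close>, so the worst case is a coclique
  \<open>R\<close>.\<close>

lemma coclique_degree:
  assumes xy: "x \<in> V" "y \<in> V" "x \<noteq> y" "y \<notin> N x"
    and P: "P \<subseteq> N x - N y" "card P \<ge> 2" "\<And>p p'. p \<in> P \<Longrightarrow> p' \<in> P \<Longrightarrow> p' \<notin> N p"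
    and q: "q \<in> N y - N x" "R \<subseteq> (N y - N x) \<inter> N q" "card R \<ge> 1"
    and full: "\<And>p r. p \<in> P \<Longrightarrow> r \<in> insert q R \<Longrightarrow> r \<in> N p"
  shows "card P * (card R - 1) \<le> 4 * card R"
proof -
  define j k where "j = real (card P)" and "k = real (card R)"
  have cr: "B (u x a) (u y b) = (if b \<in> N a then -1 else 0)" "B (u y b) (u x a) = (if b \<in> N a then -1 else 0)"
    if "a \<in> N x - N y" "b \<in> N y - N x" for a b
    using B_u_cross[OF xy that] B_sym by auto
  have fin: "finite P" "finite R" using P(1) q(2) finite_subset[of P "N x"] finite_subset[of R "N y"] by auto
  have q_notin: "q \<notin> R" using q nb_irr by blast
  define a where "a = fsum (u x) P"
  define c where "c = fsum (u y) R"
  have aa: "B a a = - j * (j - 1)"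
  proof -
    have "B a a = (\<Sum>p\<in>P. \<Sum>p'\<in>P. if p = p' then 0 else -1)"
      unfolding a_def B_lin using P by (intro sum.cong refl) (auto simp: B_u subset_iff)
    also have "\<dots> = (\<Sum>p\<in>P. - (j - 1))"
    proof (rule sum.cong[OF refl])
      fix p assume p: "p \<in> P"
      have "(\<Sum>p'\<in>P. if p = p' then 0 else -1) = (\<Sum>p'\<in>P - {p}. -1 :: real)"
        using fin p by (intro sum.mono_neutral_cong_right) auto
      also have "\<dots> = - (j - 1)" using fin p P(2) by (simp add: j_def)
      finally show "(\<Sum>p'\<in>P. if p = p' then 0 else -1) = - (j - 1)" .
    qed
    finally show ?thesis by (simp add: j_def algebra_simps)
  qed
  have ab: "B a (u y q) = - j"
  proof -
    have "B a (u y q) = (\<Sum>p\<in>P. -1)"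
      unfolding a_def B_lin using P q full by (intro sum.cong refl) (auto simp: cr subset_iff)
    then show ?thesis by (simp add: j_def)
  qed
  have ac: "B a c = - j * k"
  proof -
    have "B a c = (\<Sum>r\<in>R. \<Sum>p\<in>P. -1)"
      unfolding a_def c_def B_lin using P q full by (intro sum.cong refl) (auto simp: cr subset_iff)
    then show ?thesis by (simp add: j_def k_def)
  qed
  have bb: "B (u y q) (u y q) = 0" using q by (simp add: B_u)
  have bc: "B (u y q) c = - 2 * k"
  proof -
    have "B (u y q) c = (\<Sum>r\<in>R. -2)"
      unfolding c_def B_lin using q q_notin by (intro sum.cong refl) (auto simp: B_u subset_iff)
    then show ?thesis by (simp add: k_def)
  qed
  have cc: "B c c \<le> - k * (k - 1)"
  proof -
    have "B c c = (\<Sum>r\<in>R. \<Sum>r'\<in>R. if r = r' then 0 else if r' \<in> N r then -2 else -1)"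
      unfolding c_def B_lin using q by (intro sum.cong refl) (auto simp: B_u subset_iff dest: nb_sym)
    also have "\<dots> \<le> (\<Sum>r\<in>R. \<Sum>r'\<in>R. if r = r' then 0 else -1)"
      by (intro sum_mono) auto
    also have "\<dots> = (\<Sum>r\<in>R. - (k - 1))"
    proof (rule sum.cong[OF refl])
      fix p assume p: "p \<in> R"
      have "(\<Sum>p'\<in>R. if p = p' then 0 else -1) = (\<Sum>p'\<in>R - {p}. -1 :: real)"
        using fin p by (intro sum.mono_neutral_cong_right) auto
      also have "\<dots> = - (k - 1)" using fin p q(3) by (simp add: k_def)
      finally show "(\<Sum>p'\<in>R. if p = p' then 0 else -1) = - (k - 1)" .
    qed
    finally show ?thesis by (simp add: k_def algebra_simps)
  qed
  have j2: "j \<ge> 2" "k \<ge> 1" using P(2) q(3) by (auto simp: j_def k_def)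
  have "B a a < 0" using j2 by (simp add: aa)
  from lorentz_cs[OF this, of "u y q" c]
  have "(j * k * (j - 2))\<^sup>2 \<le> j\<^sup>2 * (j * (j - 1) * B c c + j\<^sup>2 * k\<^sup>2)"
    by (simp add: aa ab ac bb bc power2_eq_square algebra_simps)
  then have "j\<^sup>2 * (k\<^sup>2 * (j - 2)\<^sup>2) \<le> j\<^sup>2 * (j * (j - 1) * B c c + j\<^sup>2 * k\<^sup>2)"
    by (simp only: power_mult_distrib mult.assoc)
  then have "k\<^sup>2 * (j - 2)\<^sup>2 \<le> j * (j - 1) * B c c + j\<^sup>2 * k\<^sup>2"
    using j2 by simp
  also have "\<dots> \<le> j * (j - 1) * (- k * (k - 1)) + j\<^sup>2 * k\<^sup>2"
    using cc j2 by (intro add_right_mono mult_left_mono) auto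
  finally have "(k * (j - 1)) * (j * (k - 1)) \<le> (k * (j - 1)) * (4 * k)"
    by (simp add: power2_eq_square algebra_simps)
  then have "j * (k - 1) \<le> 4 * k"
    using j2 by simp
  then have "real (card P * (card R - 1)) \<le> real (4 * card R)"
    using q(3) by (simp add: j_def k_def of_nat_diff)
  then show ?thesis by linarith
qed

end

section \<open>Stars and common neighbours\<close>

lemma card_Diff_sum: "finite A \<Longrightarrow> card (A - S) = (\<Sum>c\<in>A. if c \<in> S then 0 else 1)"
  by (induction A rule: finite_induct) (auto simp: insert_Diff_if)

context three_ev
begin

definition coclique :: "'a set \<Rightarrow> bool" where
  "coclique K \<longleftrightarrow> (\<forall>a\<in>K. \<forall>b\<in>K. b \<notin> N a)"

lemma coclique_subset: "coclique K \<Longrightarrow> S \<subseteq> K \<Longrightarrow> coclique S"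
  by (auto simp: coclique_def)

text \<open>A coclique of maximal size contains a neighbour of every other vertex, and degrees at
  most 1 make the choice of such a neighbour injective.\<close>

lemma coclique_half:
  assumes "finite S" "\<And>v. v \<in> S \<Longrightarrow> card (S \<inter> N v) \<le> 1"
  obtains K where "K \<subseteq> S" "coclique K" "card S \<le> 2 * card K"
proof -
  define F where "F = {K. K \<subseteq> S \<and> coclique K}"
  have "finite F" unfolding F_def using assms(1) by simp
  moreover have "{} \<in> F" by (simp add: F_def coclique_def)
  ultimately have "Max (card ` F) \<in> card ` F" by (intro Max_in) auto
  then obtain K where K: "K \<in> F" "card K = Max (card ` F)" by auto
  have K_max: "card K' \<le> card K" if "K' \<in> F" for K'
    using that K(2) \<open>finite F\<close> by simp
  have KS: "K \<subseteq> S" "coclique K" "finite K"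
    using K(1) assms(1) finite_subset by (auto simp: F_def)
  have ex: "\<exists>k\<in>K. k \<in> N v" if "v \<in> S - K" for v
  proof (rule ccontr)
    assume *: "\<not> ?thesis"
    have "insert v K \<in> F"
      unfolding F_def coclique_def mem_Collect_eq
    proof (intro conjI ballI)
      show "insert v K \<subseteq> S" using that KS(1) by blast
    next
      fix a b assume "a \<in> insert v K" "b \<in> insert v K"
      then consider "a = v" "b = v" | "a = v" "b \<in> K" | "a \<in> K" "b = v" | "a \<in> K" "b \<in> K" by blast
      then show "b \<notin> N a"
      proof cases
        case 1 then show ?thesis using nb_irr by simp
      next
        case 2 then show ?thesis using * by blast
      next
        case 3 then show ?thesis using * nb_sym by blast
      next
        case 4 then show ?thesis using KS(2) by (simp add: coclique_def)
      qed
    qed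
    from K_max[OF this] show False using that KS by simp
  qed
  define f where "f v = (SOME k. k \<in> K \<and> k \<in> N v)" for v
  have f: "f v \<in> K" "f v \<in> N v" if "v \<in> S - K" for v
    using someI_ex[of "\<lambda>k. k \<in> K \<and> k \<in> N v"] ex[OF that] by (auto simp: f_def)
  have "inj_on f (S - K)"
  proof (rule inj_onI)
    fix v w assume vw: "v \<in> S - K" "w \<in> S - K" "f v = f w"
    have "{v, w} \<subseteq> S \<inter> N (f v)"
      using f(2)[OF vw(1)] f(2)[OF vw(2)] vw nb_iff[of "f v"] by simp
    then have "card {v, w} \<le> 1"
      using assms(2)[of "f v"] f(1)[OF vw(1)] KS(1) assms(1) card_mono[of "S \<inter> N (f v)" "{v, w}"]
      by (meson finite_Int le_trans subsetD)
    then show "v = w" by (rule_tac ccontr) simp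
  qed
  then have "card (S - K) \<le> card K"
    using f KS(3) by (intro card_inj_on_le[of f]) auto
  moreover have "card S = card K + card (S - K)"
    using KS card_Diff_subset[of K S] card_mono[OF assms(1) KS(1)] by linarith
  ultimately show ?thesis using that KS by auto
qed

text \<open>The spokes over a coclique have Gram matrix \<open>I - J\<close>, with \<open>J\<close>
  the all-one matrix.\<close>

lemma B_fsum_u:
  assumes "K \<subseteq> N y" "coclique K" "S \<subseteq> K" "T \<subseteq> K"
  shows "B (fsum (u y) S) (fsum (u y) T) = real (card (S \<inter> T)) - real (card S) * real (card T)"
proof -
  have fin: "finite K" "finite S" "finite T"
    using assms finite_subset[OF _ finN] finite_subset by metis+
  have "B (fsum (u y) S) (fsum (u y) T) = (\<Sum>b\<in>T. \<Sum>a\<in>S. (if a = b then 1 else 0) - 1)"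
    unfolding B_lin using assms by (intro sum.cong refl) (auto simp: B_u coclique_def subset_iff)
  also have "\<dots> = (\<Sum>b\<in>T. (if b \<in> S then 1 else 0) - real (card S))"
    using fin by (intro sum.cong refl) (simp add: sum_subtractf)
  also have "\<dots> = real (card (S \<inter> T)) - real (card S) * real (card T)"
    using fin by (simp add: sum_subtractf sum.inter_restrict[symmetric] Int_commute flip: sum.inter_restrict)
  finally show ?thesis .
qed

text \<open>The path from \<open>x\<close> through \<open>c\<close> to \<open>y\<close>: for
  non-adjacent \<open>x\<close> and \<open>y\<close> the form takes the value
  \<open>3 - 4 = -1\<close> on it, so it is timelike.\<close>

definition \<tau> :: "'a \<Rightarrow> 'a \<Rightarrow> 'a \<Rightarrow> 'a \<Rightarrow> real" where
  "\<tau> x y c = e c \<boxplus> e x \<boxplus> e y"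

lemma B_tau:
  assumes "x \<in> V" "y \<in> V" "x \<noteq> y" "y \<notin> N x" "c \<in> N x \<inter> N y" "c' \<in> N x \<inter> N y"
  shows "B (\<tau> x y c) (\<tau> x y c') = (if c = c' then -1 else if c' \<in> N c then -3 else -2)"
proof -
  have "c \<in> V" "c' \<in> V" "c \<noteq> x" "c \<noteq> y" "c' \<noteq> x" "c' \<noteq> y" "x \<in> N c" "y \<in> N c" "x \<in> N c'" "y \<in> N c'" "x \<notin> N y"
    using assms nbV nb_iff nb_irr by blast+
  then show ?thesis using assms nb_irr by (auto simp: \<tau>_def B_lin B_e)
qed

lemma B_tau_u:
  assumes "x \<in> V" "y \<in> V" "x \<noteq> y" "y \<notin> N x" "c \<in> N x \<inter> N y" "q \<in> N y - N x"
  shows "B (\<tau> x y c) (u y q) = (if q \<in> N c then -2 else -1)"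
proof -
  have "c \<in> V" "q \<in> V" "c \<noteq> x" "c \<noteq> y" "q \<noteq> x" "q \<noteq> y" "c \<noteq> q" "y \<in> N c" "q \<in> N y" "q \<notin> N x"
    using assms nbV nb_iff nb_irr by blast+
  then show ?thesis using assms nb_irr by (auto simp: \<tau>_def u_def B_lin B_e)
qed

lemma B_tau_fsum_u:
  assumes "x \<in> V" "y \<in> V" "x \<noteq> y" "y \<notin> N x" "c \<in> N x \<inter> N y" "S \<subseteq> N y - N x"
  shows "B (\<tau> x y c) (fsum (u y) S) = - real (card S) - real (card (S \<inter> N c))"
proof -
  have fin: "finite S" using assms(6) finite_subset[of S "N y"] by auto
  have "B (\<tau> x y c) (fsum (u y) S) = (\<Sum>q\<in>S. - 1 - (if q \<in> N c then 1 else 0))"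
    unfolding B_lin using assms by (intro sum.cong refl) (auto simp: B_tau_u subset_iff)
  also have "\<dots> = - real (card S) - real (card (S \<inter> N c))"
    using fin by (simp add: sum_subtractf flip: sum.inter_restrict)
  finally show ?thesis .
qed

end

context three_ev_pos
begin

text \<open>A path that avoids both ends of the edge gives equality in the reverse inequality with
  the timelike \<open>a\<close>, so its vector is \<open>a / 2\<close> modulo the radical. Two of
  them would have product -1, whereas distinct paths have product -2 or -3.\<close>

lemma neither_unique:
  assumes xy: "x \<in> V" "y \<in> V" "x \<noteq> y" "y \<notin> N x"
    and q: "q \<in> N y - N x" "q' \<in> N y - N x" "q' \<in> N q"
    and c: "c \<in> N x \<inter> N y" "c' \<in> N x \<inter> N y" "q \<notin> N c" "q' \<notin> N c" "q \<notin> N c'" "q' \<notin> N c'"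
  shows "c = c'"
proof (rule ccontr)
  assume ne: "c \<noteq> c'"
  define a where "a = u y q \<boxplus> u y q'"
  have qq: "q \<noteq> q'" "q \<in> N q'" using q nb_irr nb_sym by blast+
  have aa: "B a a = -4" using q qq by (simp add: a_def B_lin B_u)
  have ab: "B a (\<tau> x y c) = -2" "B a (\<tau> x y c') = -2"
    using q c by (simp_all add: a_def B_lin B_sym[of "u y _"] B_tau_u[OF xy])
  have bb: "B (\<tau> x y c) (\<tau> x y c) = -1" "B (\<tau> x y c') (\<tau> x y c') = -1"
    using c by (simp_all add: B_tau[OF xy])
  have bc: "B (\<tau> x y c) (\<tau> x y c') \<le> -2" using c ne by (simp add: B_tau[OF xy])
  have "(- 4 * B (\<tau> x y c) (\<tau> x y c') - 4)\<^sup>2 \<le> 0"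
    using lorentz_cs[of a "\<tau> x y c" "\<tau> x y c'"] by (simp add: aa ab bb)
  then show False using bc by simp
qed

text \<open>Bessel's inequality for the component of \<open>\<tau> x y c\<close> orthogonal to \<open>u y q + u y q'\<close>.\<close>

lemma not_exactly_one:
  assumes xy: "x \<in> V" "y \<in> V" "x \<noteq> y" "y \<notin> N x"
    and q: "q \<in> N y - N x" "q' \<in> N y - N x" "q' \<in> N q"
    and c: "c \<in> N x \<inter> N y" "q \<in> N c" "q' \<notin> N c"
    and K: "K \<subseteq> N y - N x" "coclique K" "card K = 6" "K \<inter> N q = {}" "K \<inter> N q' = {}"
  shows False
proof -
  define a where "a = u y q \<boxplus> u y q'"
  \<comment> \<open>Orthogonally to \<open>a\<close> the six spokes become orthonormal, while
    \<open>\<tau> x y c\<close> has square 5/4 and product 1/2 or -1/2 with each of them. Six is the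
    least number of spokes whose squared products, here 6/4, exceed 5/4. The signs collect the
    products in the single vector \<open>b\<close>.\<close>
  define \<epsilon> :: "'a \<Rightarrow> real" where "\<epsilon> k = (if k \<in> N c then -1 else 1)" for k
  define b where "b = fsum (\<lambda>k. scl (\<epsilon> k) (u y k)) K"
  define E where "E = (\<Sum>k\<in>K. \<epsilon> k)"
  have qq: "q \<noteq> q'" "q \<in> N q'" using q nb_irr nb_sym by blast+
  have qK: "q \<notin> K" "q' \<notin> K" using K q qq by blast+
  have finK: "finite K" using K(3) by (metis card.infinite zero_neq_numeral)
  have aa: "B a a = -4" using q qq by (simp add: a_def B_lin B_u)
  have ac: "B a (\<tau> x y c) = -3"
    using q c by (simp add: a_def B_lin B_sym[of "u y _"] B_tau_u[OF xy])
  have cc: "B (\<tau> x y c) (\<tau> x y c) = -1" using c by (simp add: B_tau[OF xy])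
  have ab: "B a b = -2 * E"
  proof -
    have "B a b = (\<Sum>k\<in>K. \<epsilon> k * (-2))"
      unfolding b_def B_sum_right B_scl_right a_def B_add_left
      using K q qK by (intro sum.cong refl) (auto simp: B_u subset_iff)
    then show ?thesis by (simp add: E_def sum_negf sum_distrib_right[symmetric])
  qed
  have bb: "B b b = 6 - E\<^sup>2"
  proof -
    have "B b b = (\<Sum>k\<in>K. \<Sum>l\<in>K. \<epsilon> k * \<epsilon> l * ((if k = l then 1 else 0) - 1))"
      unfolding b_def B_sum_left B_sum_right B_scl_right B_scl_left sum_distrib_left
      using K by (intro sum.cong refl) (auto simp: B_u subset_iff coclique_def)
    also have "\<dots> = (\<Sum>k\<in>K. \<Sum>l\<in>K. (if k = l then \<epsilon> k * \<epsilon> l else 0) - \<epsilon> k * \<epsilon> l)"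
      by (intro sum.cong refl) (auto simp: algebra_simps)
    also have "\<dots> = (\<Sum>k\<in>K. \<epsilon> k * \<epsilon> k) - (\<Sum>k\<in>K. \<Sum>l\<in>K. \<epsilon> k * \<epsilon> l)"
      using finK by (simp add: sum_subtractf)
    also have "(\<Sum>k\<in>K. \<epsilon> k * \<epsilon> k) = (\<Sum>k\<in>K. 1)"
      by (intro sum.cong refl) (auto simp: \<epsilon>_def)
    also have "(\<Sum>k\<in>K. \<Sum>l\<in>K. \<epsilon> k * \<epsilon> l) = E\<^sup>2"
      by (simp add: E_def power2_eq_square sum_product)
    finally show ?thesis using K(3) by simp
  qed
  have bc: "B b (\<tau> x y c) = 3 - 3 / 2 * E"
  proof -
    have "B b (\<tau> x y c) = (\<Sum>k\<in>K. 1 / 2 - 3 / 2 * \<epsilon> k)"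
      unfolding b_def B_sum_left B_scl_left
      using K c by (intro sum.cong refl) (auto simp: B_sym[of "u y _"] B_tau_u[OF xy] subset_iff \<epsilon>_def)
    then show ?thesis using K(3) by (simp add: E_def sum_subtractf sum_distrib_left)
  qed
  show False
    using lorentz_cs[of a b "\<tau> x y c"]
    by (simp add: aa ab ac bb bc cc power2_eq_square algebra_simps)
qed

text \<open>By \<open>not_exactly_one\<close> a common neighbour missing \<open>q\<close> also
  misses \<open>q'\<close>, and by \<open>neither_unique\<close> only one misses both. The bound 14
  leaves 12 vertices outside the edge, hence a coclique of six away from it.\<close>

lemma missing_edge_le_1:
  assumes xy: "x \<in> V" "y \<in> V" "x \<noteq> y" "y \<notin> N x"
    and q: "q \<in> N y - N x" "q' \<in> N y - N x" "q' \<in> N q"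
    and sparse: "\<And>r. r \<in> N y - N x \<Longrightarrow> card ((N y - N x) \<inter> N r) \<le> 1"
    and large: "card (N y - N x) \<ge> 14"
  shows "card ((N x \<inter> N y) - N q) \<le> 1"
proof -
  let ?Q = "N y - N x"
  have qq: "q \<noteq> q'" "q \<in> N q'" using q nb_irr nb_sym by blast+
  have only: "r = q'" if "r \<in> ?Q \<inter> N q" for r
    using sparse[OF q(1)] that q card_le_Suc0_iff_eq[of "?Q \<inter> N q"] by auto
  have only': "r = q" if "r \<in> ?Q \<inter> N q'" for r
    using sparse[OF q(2)] that q qq card_le_Suc0_iff_eq[of "?Q \<inter> N q'"] by auto
  have "\<And>v. v \<in> ?Q - {q, q'} \<Longrightarrow> card ((?Q - {q, q'}) \<inter> N v) \<le> 1"
  proof -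
    fix v assume v: "v \<in> ?Q - {q, q'}"
    have "card ((?Q - {q, q'}) \<inter> N v) \<le> card (?Q \<inter> N v)" by (intro card_mono) auto
    then show "card ((?Q - {q, q'}) \<inter> N v) \<le> 1" using sparse[of v] v by auto
  qed
  then obtain K0 where K0: "K0 \<subseteq> ?Q - {q, q'}" "coclique K0" "card (?Q - {q, q'}) \<le> 2 * card K0"
    using coclique_half[of "?Q - {q, q'}"] by auto
  have "card (?Q - {q, q'}) = card ?Q - 2" using q qq by (simp add: card_Diff_subset)
  then have "card K0 \<ge> 6" using K0(3) large by simp
  then obtain K where K: "K \<subseteq> K0" "card K = 6"
    using obtain_subset_with_card_n by metis
  have K': "K \<subseteq> ?Q" "coclique K" "K \<inter> N q = {}" "K \<inter> N q' = {}"
    using K K0 coclique_subset only only' by blast+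
  have neither: "q' \<notin> N c" if "c \<in> (N x \<inter> N y) - N q" for c
  proof
    assume "q' \<in> N c"
    then show False
      using not_exactly_one[OF xy q(2) q(1) qq(2), of c K] that K' K nb_iff by blast
  qed
  have "c = c'" if "c \<in> (N x \<inter> N y) - N q" "c' \<in> (N x \<inter> N y) - N q" for c c'
    using neither_unique[OF xy q, of c c'] that neither nb_iff by blast
  then show ?thesis by (simp add: card_le_Suc0_iff_eq)
qed

text \<open>Test vectors: the sum over the whole star, the sum over the \<open>b\<close> spokes
  adjacent to \<open>c\<close>, and the path through \<open>c\<close>. For \<open>k > b\<close>
  Cauchy--Schwarz amounts to \<open>b (k - 3 - b) <= 1\<close>.\<close>

lemma star_defect:
  assumes xy: "x \<in> V" "y \<in> V" "x \<noteq> y" "y \<notin> N x"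
    and K: "K \<subseteq> N y - N x" "coclique K" "card K \<ge> 6"
    and c: "c \<in> N x \<inter> N y" "K \<inter> N c \<noteq> {}"
  shows "card (K - N c) \<le> 3"
proof -
  define k b where "k = real (card K)" "b = real (card (K \<inter> N c))"
  have finK: "finite K" using K(3) by (metis card.infinite not_numeral_le_zero)
  have KN: "K \<subseteq> N y" using K by auto
  define a where "a = fsum (u y) K"
  define z where "z = fsum (u y) (K \<inter> N c)"
  have aa: "B a a = k - k * k"
    using B_fsum_u[OF KN K(2), of K K] by (simp add: a_def k_b_def)
  have ab: "B a z = b - k * b"
    using B_fsum_u[OF KN K(2), of K "K \<inter> N c"] by (simp add: a_def z_def k_b_def)
  have bb: "B z z = b - b * b"
    using B_fsum_u[OF KN K(2), of "K \<inter> N c" "K \<inter> N c"] by (simp add: z_def k_b_def)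
  have ac: "B a (\<tau> x y c) = - k - b"
    using B_tau_fsum_u[OF xy c(1) K(1)] by (simp add: a_def k_b_def B_sym[of _ "\<tau> x y c"])
  have bc: "B z (\<tau> x y c) = - 2 * b"
    using B_tau_fsum_u[OF xy c(1), of "K \<inter> N c"] K(1)
    by (subst B_sym) (auto simp: z_def k_b_def Int_assoc)
  have cc: "B (\<tau> x y c) (\<tau> x y c) = -1" using c by (simp add: B_tau[OF xy])
  have k6: "k \<ge> 6" using K(3) by (simp add: k_b_def)
  have b1: "b \<ge> 1" using c(2) finK by (simp add: k_b_def card_gt_0_iff Suc_le_eq)
  have split: "k = b + real (card (K - N c))"
    using card_split[OF finK, of "N c"] by (simp add: k_b_def)
  show ?thesis
  proof (rule ccontr)
    assume "\<not> ?thesis"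
    then have d: "k - b \<ge> 4" using split by simp
    have "B a a < 0" using k6 by (simp add: aa)
    from lorentz_cs[OF this, of z "\<tau> x y c"]
    have "(b * (k - 1) * (k - b))\<^sup>2 \<le> (b * (k - 1) * (k - b)) * ((k + b)\<^sup>2 - k * (k - 1))"
      by (simp add: aa ab ac bb bc cc power2_eq_square algebra_simps)
    moreover have "0 < b * (k - 1) * (k - b)" using b1 k6 d by simp
    ultimately have "b * (k - 1) * (k - b) \<le> (k + b)\<^sup>2 - k * (k - 1)"
      unfolding power2_eq_square[of "b * (k - 1) * (k - b)"] by (rule mult_left_le_imp_le)
    then have "k * (b * (k - 3 - b)) \<le> k * 1"
      by (simp add: power2_eq_square algebra_simps)
    then have "b * (k - 3 - b) \<le> 1" using k6 by simp
    \<comment> \<open>This expands to \<open>b (k - 3 - b) >= k - 4\<close>, and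
      \<open>k - 4 >= 2\<close>.\<close>
    moreover have "(b - 1) * (k - 4 - b) \<ge> 0" using b1 d by simp
    ultimately show False using k6 by (simp add: algebra_simps)
  qed
qed

text \<open>Orthogonally to the sum of the star, such a path has square \<open>1 / (k - 1)\<close>,
  whereas two distinct ones have a product of absolute value at least
  \<open>(k - 2) / (k - 1)\<close>.\<close>

lemma star_empty_unique:
  assumes xy: "x \<in> V" "y \<in> V" "x \<noteq> y" "y \<notin> N x"
    and K: "K \<subseteq> N y - N x" "coclique K" "card K \<ge> 6"
    and c: "c \<in> N x \<inter> N y" "K \<inter> N c = {}" "c' \<in> N x \<inter> N y" "K \<inter> N c' = {}"
  shows "c = c'"
proof (rule ccontr)
  assume ne: "c \<noteq> c'"
  define k where "k = real (card K)"
  have KN: "K \<subseteq> N y" using K by auto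
  define a where "a = fsum (u y) K"
  define w where "w = B (\<tau> x y c) (\<tau> x y c')"
  have aa: "B a a = k - k * k"
    using B_fsum_u[OF KN K(2), of K K] by (simp add: a_def k_def)
  have ac: "B a (\<tau> x y c) = - k" "B a (\<tau> x y c') = - k"
    using B_tau_fsum_u[OF xy c(1) K(1)] B_tau_fsum_u[OF xy c(3) K(1)] c
    by (simp_all add: a_def k_def B_sym[of _ "\<tau> x y _"])
  have bb: "B (\<tau> x y c) (\<tau> x y c) = -1" "B (\<tau> x y c') (\<tau> x y c') = -1"
    using c by (simp_all add: B_tau[OF xy])
  have w: "w \<le> -2" using c ne by (simp add: B_tau[OF xy] w_def)
  have k6: "k \<ge> 6" using K(3) by (simp add: k_def)
  have "B a a < 0" using k6 by (simp add: aa)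
  from lorentz_cs[OF this, of "\<tau> x y c" "\<tau> x y c'"]
  have "(k * ((k - 1) * (- w) - k))\<^sup>2 \<le> k\<^sup>2"
    by (simp add: aa ac bb w_def[symmetric] power2_eq_square algebra_simps)
  then have "\<bar>k * ((k - 1) * (- w) - k)\<bar> \<le> \<bar>k\<bar>" by (simp add: abs_le_square_iff)
  then have "(k - 1) * (- w) - k \<le> 1" using k6 by (simp add: abs_mult)
  moreover have "(k - 1) * 2 \<le> (k - 1) * (- w)" using k6 w by (intro mult_left_mono) auto
  ultimately show False using k6 by simp
qed

text \<open>Double counting of non-edges between the star and the common neighbours: each common
  neighbour misses at most three spokes, apart from at most one that misses them all.\<close>

lemma missing_sum:
  assumes xy: "x \<in> V" "y \<in> V" "x \<noteq> y" "y \<notin> N x"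
    and K: "K \<subseteq> N y - N x" "coclique K" "card K \<ge> 6"
  shows "(\<Sum>q\<in>K. card ((N x \<inter> N y) - N q)) \<le> 3 * card (N x \<inter> N y) + card K"
proof -
  let ?C = "N x \<inter> N y"
  have finK: "finite K" using K(3) by (metis card.infinite not_numeral_le_zero)
  have "(\<Sum>q\<in>K. card (?C - N q)) = (\<Sum>q\<in>K. \<Sum>c\<in>?C. if c \<in> N q then 0 else 1)"
    by (simp add: card_Diff_sum)
  also have "\<dots> = (\<Sum>c\<in>?C. \<Sum>q\<in>K. if q \<in> N c then 0 else 1)"
    by (subst sum.swap) (intro sum.cong refl, use nb_sym in auto)
  also have "\<dots> = (\<Sum>c\<in>?C. card (K - N c))"
    using finK by (simp add: card_Diff_sum)
  also have "\<dots> \<le> (\<Sum>c\<in>?C. 3 + (if K \<inter> N c = {} then card K else 0))"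
  proof (rule sum_mono)
    fix c assume c: "c \<in> ?C"
    have "card (K - N c) \<le> card K" using finK by (intro card_mono) auto
    then show "card (K - N c) \<le> 3 + (if K \<inter> N c = {} then card K else 0)"
      using star_defect[OF xy K c] by auto
  qed
  also have "\<dots> = 3 * card ?C + card {c \<in> ?C. K \<inter> N c = {}} * card K"
    by (simp add: sum.distrib sum.inter_filter[symmetric])
  also have "card {c \<in> ?C. K \<inter> N c = {}} \<le> 1"
    using star_empty_unique[OF xy K] by (auto simp: card_le_Suc0_iff_eq)
  finally show ?thesis by simp
qed

text \<open>Cauchy--Schwarz for the sum over all six spokes, the sum over \<open>A\<close> and
  \<open>e w\<close> would read \<open>45^2 <= 45 * 39\<close>.\<close>

lemma no_half_star:
  assumes y: "y \<in> V" and w: "w \<in> V" "w \<noteq> y" "w \<notin> N y"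
    and K: "A \<union> Z \<subseteq> N y" "coclique (A \<union> Z)" "card A = 3" "card Z = 3"
    and "A \<subseteq> N w" "Z \<inter> N w = {}"
  shows False
proof -
  have AZ: "A \<inter> Z = {}" using assms by auto
  have fin: "finite A" "finite Z" using K by (auto intro: finite_subset[OF _ finN])
  have B1: "B (e w) (fsum (u y) S) = - real (card (S \<inter> N w))" if "S \<subseteq> A \<union> Z" for S
  proof -
    have finS: "finite S" using that fin finite_subset by blast
    have "B (e w) (fsum (u y) S) = (\<Sum>q\<in>S. - (if q \<in> N w then 1 else 0))"
      unfolding B_sum_right
    proof (intro sum.cong refl)
      fix q assume "q \<in> S"
      then have "q \<in> N y" using that K by auto
      then show "B (e w) (u y q) = - (if q \<in> N w then 1 else 0)"
        using w y nbV[of q y] nb_iff[of y w] by (auto simp: u_def B_lin B_e)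
    qed
    then show ?thesis using finS by (simp add: sum_negf flip: sum.inter_restrict)
  qed
  have Int: "(A \<union> Z) \<inter> A = A" "(A \<union> Z) \<inter> N w = A" "A \<inter> N w = A" using assms by auto
  have card6: "card (A \<union> Z) = 6" using K AZ fin by (simp add: card_Un_disjoint)
  have "B (fsum (u y) (A \<union> Z)) (fsum (u y) (A \<union> Z)) = -30"
    "B (fsum (u y) (A \<union> Z)) (fsum (u y) A) = -15"
    "B (fsum (u y) A) (fsum (u y) A) = -6"
    using B_fsum_u[OF K(1,2), of "A \<union> Z" "A \<union> Z"] B_fsum_u[OF K(1,2), of "A \<union> Z" A]
      B_fsum_u[OF K(1,2), of A A] card6 K Int by simp_all
  moreover have "B (fsum (u y) (A \<union> Z)) (e w) = -3" "B (fsum (u y) A) (e w) = -3"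
    using B1[of "A \<union> Z"] B1[of A] K Int by (simp_all add: B_sym[of _ "e w"])
  moreover have "B (e w) (e w) = 1" using w by (simp add: B_e)
  ultimately show False
    using lorentz_cs[of "fsum (u y) (A \<union> Z)" "fsum (u y) A" "e w"] by simp
qed

end

section \<open>Non-adjacent vertices of different levels\<close>

locale large_t = three_ev +
  assumes t_int: "t \<in> \<int>" and t_ge: "t \<ge> 30"

sublocale large_t \<subseteq> three_ev_pos
  by unfold_locales (use t_ge in simp)

context large_t
begin

lemma nonadj_sym: "y \<notin> N x \<Longrightarrow> x \<notin> N y"
  using nb_sym by blast

lemma card_diff':
  assumes "x \<in> V" "y \<in> V" "x \<noteq> y" "y \<notin> N x"
  shows "real (card (N y - N x)) = t + \<alpha> y * (\<alpha> y - \<alpha> x)"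
  using card_diff[OF assms(2,1) assms(3)[symmetric] nonadj_sym[OF assms(4)]] by (simp add: algebra_simps)

text \<open>The square counts the symmetric difference of the two neighbourhoods, less
  \<open>2 t\<close>. Levels may be irrational, yet unequal ones of non-adjacent vertices thus
  differ by at least 1.\<close>

lemma level_diff_square_int:
  assumes "x \<in> V" "y \<in> V" "x \<noteq> y" "y \<notin> N x"
  shows "(\<alpha> y - \<alpha> x)\<^sup>2 \<in> \<int>"
proof -
  have "(\<alpha> y - \<alpha> x)\<^sup>2 = real (card (N x - N y)) + real (card (N y - N x)) - 2 * t"
    unfolding card_diff[OF assms] card_diff'[OF assms] by (simp add: power2_eq_square algebra_simps)
  then show ?thesis using t_int by simp
qed

lemma level_diff_ge_1:
  assumes "x \<in> V" "y \<in> V" "x \<noteq> y" "y \<notin> N x" "\<alpha> x < \<alpha> y"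
  shows "\<alpha> y - \<alpha> x \<ge> 1"
proof -
  obtain i where i: "(\<alpha> y - \<alpha> x)\<^sup>2 = of_int i"
    using level_diff_square_int[OF assms(1-4)] by (auto elim: Ints_cases)
  have "(\<alpha> y - \<alpha> x)\<^sup>2 > 0" using assms(5) by simp
  then have "i \<ge> 1" using i by simp
  then have "(\<alpha> y - \<alpha> x)\<^sup>2 \<ge> 1\<^sup>2" using i by simp
  then show ?thesis using assms(5) power2_le_imp_le[of 1 "\<alpha> y - \<alpha> x"] by simp
qed

lemma ex_other:
  assumes "card S \<ge> 2" obtains b where "b \<in> S" "b \<noteq> a"
proof -
  have "\<not> S \<subseteq> {a}" using assms card_mono[of "{a}" S] by auto
  then show ?thesis using that by blast
qed

text \<open>By \<open>matching\<close>, a single missing edge from \<open>q\<close> to P would leave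
  \<open>q\<close> without neighbours in Q.\<close>

lemma full_of_edge:
  assumes "x \<in> V" "y \<in> V" "x \<noteq> y" "y \<notin> N x" "card (N x - N y) \<ge> 2"
    and "q \<in> N y - N x" "q' \<in> N y - N x" "q' \<in> N q"
  shows "N x - N y \<subseteq> N q"
proof
  fix p assume p: "p \<in> N x - N y"
  show "p \<in> N q"
  proof (rule ccontr)
    assume *: "p \<notin> N q"
    obtain p' where "p' \<in> N x - N y" "p' \<noteq> p" using ex_other[OF assms(5)] .
    moreover have "q' \<noteq> q" using assms(8) nb_irr by blast
    ultimately show False
      using matching(4)[OF assms(1-4) p assms(6) _ _ _ assms(7)] * assms(8) nb_sym by blast
  qed
qed

lemma defect_le_1:
  assumes "x \<in> V" "y \<in> V" "x \<noteq> y" "y \<notin> N x" "card (N x - N y) \<ge> 2" "card (N y - N x) \<ge> 2"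
    and "q \<in> N y - N x"
  shows "card ((N x - N y) - N q) \<le> 1"
proof -
  have "p = p'" if p: "p \<in> (N x - N y) - N q" "p' \<in> (N x - N y) - N q" for p p'
  proof (rule ccontr)
    assume ne: "p \<noteq> p'"
    obtain q' where "q' \<in> N y - N x" "q' \<noteq> q" using ex_other[OF assms(6)] .
    then show False
      using matching(1)[OF assms(1-4) _ assms(7), of p p' q'] p ne nb_sym by blast
  qed
  then show ?thesis by (simp add: card_le_Suc0_iff_eq)
qed

lemma card_Q_gt:
  assumes "x \<in> V" "y \<in> V" "x \<noteq> y" "y \<notin> N x" "\<alpha> x \<le> \<alpha> y"
  shows "real (card (N y - N x)) \<ge> t"
  unfolding card_diff'[OF assms(1-4)] using assms(5) pos[OF assms(2)] by simp

lemma sum_defects_swap: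
  assumes "finite P" "finite Q"
  shows "(\<Sum>q\<in>Q. card (P - N q)) = (\<Sum>p\<in>P. card (Q - N p))"
proof -
  have "(\<Sum>q\<in>Q. card (P - N q)) = (\<Sum>q\<in>Q. \<Sum>p\<in>P. if p \<in> N q then 0 else 1)"
    using assms by (simp add: card_Diff_sum)
  also have "\<dots> = (\<Sum>p\<in>P. \<Sum>q\<in>Q. if q \<in> N p then 0 else 1)"
    by (subst sum.swap) (intro sum.cong refl, use nb_sym in auto)
  also have "\<dots> = (\<Sum>p\<in>P. card (Q - N p))"
    using assms by (simp add: card_Diff_sum)
  finally show ?thesis .
qed

text \<open>An edge in a sparse Q would force its ends to the level of \<open>x\<close>, so that
  they miss \<open>t\<close> common neighbours where \<open>missing_edge_le_1\<close> allows one.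
  Without edges Q is a star, and \<open>missing_sum\<close> contradicts the sum of
  \<open>missing_formula\<close>.\<close>

lemma not_sparse:
  assumes xy: "x \<in> V" "y \<in> V" "x \<noteq> y" "y \<notin> N x" "\<alpha> x < \<alpha> y" and P: "card (N x - N y) \<ge> 2"
  shows "\<exists>q. q \<in> N y - N x \<and> card ((N y - N x) \<inter> N q) \<ge> 2"
proof (rule ccontr)
  assume *: "\<not> ?thesis"
  have sparse: "card ((N y - N x) \<inter> N q) \<le> 1" if "q \<in> N y - N x" for q
  proof -
    have "\<not> 2 \<le> card ((N y - N x) \<inter> N q)" using * that by blast
    then show ?thesis by simp
  qed
  let ?P = "N x - N y" and ?Q = "N y - N x" and ?D = "\<alpha> y - \<alpha> x"
  note xy4 = xy(1-4)
  have D1: "?D \<ge> 1" by (rule level_diff_ge_1[OF xy])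
  have ax: "\<alpha> x > 0" "\<alpha> y > 0" using pos xy by auto
  have cQ: "real (card ?Q) \<ge> 30" using card_Q_gt[OF xy4] xy(5) t_ge by simp
  then have cQ': "card ?Q \<ge> 30" by simp
  show False
  proof (cases "\<exists>q\<in>?Q. \<exists>q'\<in>?Q. q' \<in> N q")
    case True
    then obtain q q' where q: "q \<in> ?Q" "q' \<in> ?Q" "q' \<in> N q" by blast
    have "card (?Q \<inter> N q) \<noteq> 0" using q by auto
    then have d: "card (?Q \<inter> N q) = 1" using sparse[OF q(1)] by linarith
    have "?P - N q = {}" using full_of_edge[OF xy4 P q] by blast
    then have "(\<alpha> q - \<alpha> x) * ?D = 0" using level_formula[OF xy4 q(1)] d by simp
    then have "\<alpha> q = \<alpha> x" using D1 by simp
    then have "real (card ((N x \<inter> N y) - N q)) = t" using missing_formula[OF xy4 q(1)] d by simp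
    moreover have "card ((N x \<inter> N y) - N q) \<le> 1"
    proof (rule missing_edge_le_1[OF xy4 q])
      show "14 \<le> card ?Q" using cQ' by linarith
    qed (rule sparse)
    then have "real (card ((N x \<inter> N y) - N q)) \<le> 1" by linarith
    ultimately show False using t_ge by linarith
  next
    case False
    have co: "coclique ?Q" unfolding coclique_def using False by meson
    have d0: "?Q \<inter> N q = {}" if "q \<in> ?Q" for q using False that by blast
    have P': "real (card ?P) = t - \<alpha> x * ?D" by (rule card_diff[OF xy4])
    have Q': "real (card ?Q) = t + \<alpha> y * ?D" by (rule card_diff'[OF xy4])
    have "(\<Sum>q\<in>?Q. card (?P - N q)) = (\<Sum>p\<in>?P. card (?Q - N p))"
      by (rule sum_defects_swap) auto
    also have "\<dots> \<le> (\<Sum>p\<in>?P. 1)"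
    proof (rule sum_mono)
      fix p assume p: "p \<in> ?P"
      have "2 \<le> card ?Q" using cQ' by linarith
      from defect_le_1[OF xy(2,1) xy(3)[symmetric] nonadj_sym[OF xy(4)] this P p]
      show "card (?Q - N p) \<le> 1" .
    qed
    also have "\<dots> = card ?P" by simp
    finally have "real (\<Sum>q\<in>?Q. card (?P - N q)) \<le> real (card ?P)"
      by (rule of_nat_mono)
    then have eps: "(\<Sum>q\<in>?Q. real (card (?P - N q))) \<le> real (card ?P)"
      by (simp only: of_nat_sum)
    \<comment> \<open>Non-edges between P and Q form a matching and number at most |P|. Summing
      \<open>level_formula\<close>, the levels in Q therefore fall short of \<alpha> x by at least
      \<open>\<alpha> x + \<alpha> y\<close> in total.\<close>
    have "?D * (\<Sum>q\<in>?Q. \<alpha> x - \<alpha> q) = (\<Sum>q\<in>?Q. 1 - real (card (?P - N q)))"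
      unfolding sum_distrib_left
    proof (rule sum.cong[OF refl])
      fix q assume q: "q \<in> ?Q"
      show "?D * (\<alpha> x - \<alpha> q) = 1 - real (card (?P - N q))"
        using level_formula[OF xy4 q] d0[OF q] by (simp add: algebra_simps)
    qed
    also have "\<dots> \<ge> real (card ?Q) - real (card ?P)" using eps by (simp add: sum_subtractf)
    also have "real (card ?Q) - real (card ?P) = ?D * (\<alpha> x + \<alpha> y)"
      unfolding P' Q' by (simp add: algebra_simps)
    finally have S: "(\<Sum>q\<in>?Q. \<alpha> x - \<alpha> q) \<ge> \<alpha> x + \<alpha> y" using D1 by simp
    have "(\<Sum>q\<in>?Q. real (card ((N x \<inter> N y) - N q))) = (\<Sum>q\<in>?Q. (t - 1) + (\<alpha> x - \<alpha> q) * \<alpha> y)"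
      by (intro sum.cong refl) (simp add: missing_formula[OF xy4] d0)
    also have "\<dots> = (t - 1) * real (card ?Q) + \<alpha> y * (\<Sum>q\<in>?Q. \<alpha> x - \<alpha> q)"
      unfolding sum.distrib by (simp add: sum_distrib_right[symmetric])
    finally have "(t - 1) * real (card ?Q) + \<alpha> y * (\<Sum>q\<in>?Q. \<alpha> x - \<alpha> q)
        = real (\<Sum>q\<in>?Q. card ((N x \<inter> N y) - N q))" by simp
    also have "\<dots> \<le> real (3 * card (N x \<inter> N y) + card ?Q)"
      by (intro of_nat_mono missing_sum[OF xy4 subset_refl co]) (use cQ' in simp)
    also have "\<dots> = 3 * (\<alpha> x * \<alpha> y) + real (card ?Q)"
      using common_nonadj[OF xy4] by simp
    finally have "(t - 2) * real (card ?Q) + \<alpha> y * (\<Sum>q\<in>?Q. \<alpha> x - \<alpha> q) \<le> 3 * (\<alpha> x * \<alpha> y)"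
      by (simp add: algebra_simps)
    moreover have "\<alpha> y * (\<Sum>q\<in>?Q. \<alpha> x - \<alpha> q) \<ge> \<alpha> y * (\<alpha> x + \<alpha> y)"
      using S ax by (intro mult_left_mono) auto
    moreover have "(t - 2) * real (card ?Q) \<ge> \<alpha> x * (\<alpha> x + \<alpha> y)"
    proof (rule mult_mono)
      have "real (card ?P) \<ge> 2" using P by simp
      then have "t - 2 \<ge> \<alpha> x * ?D" using P' by simp
      moreover have "\<alpha> x * 1 \<le> \<alpha> x * ?D" using D1 ax by (intro mult_left_mono) auto
      moreover have "\<alpha> y * 1 \<le> \<alpha> y * ?D" using D1 ax by (intro mult_left_mono) auto
      ultimately show "\<alpha> x \<le> t - 2" "\<alpha> x + \<alpha> y \<le> real (card ?Q)" unfolding Q' by simp_all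
    qed (use ax t_ge in auto)
    \<comment> \<open>The left side is \<open>(\<alpha> x + \<alpha> y)^2\<close>, which is at least
      \<open>4 \<alpha> x \<alpha> y\<close>.\<close>
    ultimately have "\<alpha> x * (\<alpha> x + \<alpha> y) + \<alpha> y * (\<alpha> x + \<alpha> y) \<le> 3 * (\<alpha> x * \<alpha> y)" by linarith
    moreover have "0 \<le> (\<alpha> x - \<alpha> y)\<^sup>2" by simp
    ultimately have "\<alpha> x * \<alpha> y \<le> 0" by (simp add: power2_eq_square algebra_simps)
    then show False using ax by (simp add: mult_le_0_iff)
  qed
qed

text \<open>An edge in P is joined to all of Q, where \<open>not_sparse\<close> supplies a vertex
  with two neighbours; \<open>edge_degree\<close> excludes this configuration.\<close>

lemma P_coclique:
  assumes xy: "x \<in> V" "y \<in> V" "x \<noteq> y" "y \<notin> N x" "\<alpha> x < \<alpha> y" and P: "card (N x - N y) \<ge> 2"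
  shows "coclique (N x - N y)"
  unfolding coclique_def
proof (intro ballI notI)
  fix p p' assume p: "p \<in> N x - N y" "p' \<in> N x - N y" "p' \<in> N p"
  from not_sparse[OF xy P] obtain q where q: "q \<in> N y - N x" "card ((N y - N x) \<inter> N q) \<ge> 2"
    by (elim exE conjE)
  obtain q1 where q1: "q1 \<in> (N y - N x) \<inter> N q" "q1 \<noteq> q" using ex_other[OF q(2)] .
  obtain q2 where q2: "q2 \<in> (N y - N x) \<inter> N q" "q2 \<noteq> q1" using ex_other[OF q(2)] .
  have "card ((N y - N x) \<inter> N q) \<le> card (N y - N x)" by (intro card_mono) auto
  then have cQ: "card (N y - N x) \<ge> 2" using q(2) by linarith
  note full = full_of_edge[OF xy(2,1) xy(3)[symmetric] nonadj_sym[OF xy(4)] cQ]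
  have 1: "N y - N x \<subseteq> N p" by (rule full[OF p])
  have 2: "N y - N x \<subseteq> N p'" by (rule full[OF p(2,1) nb_sym[OF p(3)]])
  have q1Q: "q1 \<in> N y - N x" and q1q: "q1 \<in> N q" using q1(1) by simp_all
  have q2Q: "q2 \<in> N y - N x" and q2q: "q2 \<in> N q" using q2(1) by simp_all
  have full': "r \<in> N p \<and> r \<in> N p'" if "r \<in> {q, q1, q2}" for r
  proof -
    have "r \<in> N y - N x" using that q(1) q1Q q2Q by (elim insertE) simp_all
    then show ?thesis using subsetD[OF 1] subsetD[OF 2] by simp
  qed
  show False
    by (rule edge_degree[OF xy(1-4) p q(1) q1Q q2Q q2(2)[symmetric] q1q q2q full'])
qed

text \<open>Vertices on edges of Q are joined to all of P, so \<open>coclique_degree\<close> applies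
  to the whole of P. The bound is 8 for \<open>n = 2\<close>, which \<open>not_sparse\<close>
  supplies, and 4 for \<open>n = 6\<close>.\<close>

lemma card_P_degree:
  assumes xy: "x \<in> V" "y \<in> V" "x \<noteq> y" "y \<notin> N x" "\<alpha> x < \<alpha> y" and P: "card (N x - N y) \<ge> 2"
    and q: "q \<in> N y - N x" "n \<le> card ((N y - N x) \<inter> N q)" "n \<ge> 1"
  shows "card (N x - N y) * (n - 1) \<le> 4 * n"
proof -
  obtain R where R: "R \<subseteq> (N y - N x) \<inter> N q" "card R = n"
    using obtain_subset_with_card_n[OF q(2)] by metis
  then have "R \<noteq> {}" using q(3) by auto
  then obtain r0 where r0: "r0 \<in> R" by blast
  have full: "r \<in> N p" if p: "p \<in> N x - N y" and r: "r \<in> insert q R" for p r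
  proof -
    have rQ: "r \<in> N y - N x" using r R q(1) by auto
    obtain r' where r': "r' \<in> N y - N x" "r' \<in> N r"
    proof (cases "r = q")
      case True
      then show ?thesis using that[of r0] r0 R by auto
    next
      case False
      then have "r \<in> N q" using r R by auto
      then show ?thesis using that[of q] q(1) nb_sym by simp
    qed
    have "p \<in> N r" using full_of_edge[OF xy(1-4) P rQ r'] p by (rule subsetD)
    then show ?thesis by (rule nb_sym)
  qed
  have "card R \<ge> 1" using q(3) R(2) by simp
  have co: "p' \<notin> N p" if "p \<in> N x - N y" "p' \<in> N x - N y" for p p'
    using P_coclique[OF xy P] that unfolding coclique_def by blast
  from coclique_degree[OF xy(1-4) subset_refl P co q(1) R(1) \<open>card R \<ge> 1\<close> full]
  show ?thesis using R(2) by simp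
qed

lemma card_P_le_8:
  assumes xy: "x \<in> V" "y \<in> V" "x \<noteq> y" "y \<notin> N x" "\<alpha> x < \<alpha> y"
  shows "card (N x - N y) \<le> 8"
proof (cases "card (N x - N y) \<ge> 2")
  case True
  obtain q where "q \<in> N y - N x" "2 \<le> card ((N y - N x) \<inter> N q)"
    using not_sparse[OF xy True] by blast
  from card_P_degree[OF xy True this] show ?thesis by simp
qed simp

lemma card_P_le_4:
  assumes xy: "x \<in> V" "y \<in> V" "x \<noteq> y" "y \<notin> N x" "\<alpha> x < \<alpha> y"
    and q: "q \<in> N y - N x" "6 \<le> card ((N y - N x) \<inter> N q)"
  shows "card (N x - N y) \<le> 4"
proof (cases "card (N x - N y) \<ge> 2")
  case True
  from card_P_degree[OF xy True q] show ?thesis by simp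
qed simp

lemma same_level_sparse:
  assumes "x \<in> V" "y \<in> V" "x \<noteq> y" "y \<notin> N x" "\<alpha> x = \<alpha> y" "q \<in> N y - N x"
  shows "card ((N y - N x) \<inter> N q) \<le> 1"
  using level_formula[OF assms(1-4,6)] assms(5) by simp

lemma disjoint_nonneighbours:
  assumes "x \<in> V" "y \<in> N x" "\<And>w. w \<in> V \<Longrightarrow> w \<in> N x \<or> w \<in> N y"
  shows "real (card V) = (\<alpha> x)\<^sup>2 + (\<alpha> y)\<^sup>2 - \<alpha> x * \<alpha> y + 3 * t - 1"
proof -
  have "V = N x \<union> N y" using assms NV by blast
  then have "card V + card (N x \<inter> N y) = card (N x) + card (N y)"
    using card_Un_Int[of "N x" "N y"] by simp
  then have "real (card V) + real (card (N x \<inter> N y)) = real (card (N x)) + real (card (N y))"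
    by (metis of_nat_add)
  then show ?thesis
    using deg[OF assms(1)] deg[of y] common_adj[OF assms(2)] nbV[OF assms(2)] by simp
qed

lemma three_levels_bad_pair:
  assumes "x \<in> V" "y \<in> V" "z \<in> V" "\<alpha> x \<noteq> \<alpha> y" "\<alpha> y \<noteq> \<alpha> z" "\<alpha> x \<noteq> \<alpha> z"
  shows "\<exists>a\<in>V. \<exists>b\<in>V. b \<notin> N a \<and> \<alpha> a < \<alpha> b"
proof (rule ccontr)
  assume *: "\<not> ?thesis"
  have eq: "\<alpha> a = \<alpha> b" if "a \<in> V" "b \<in> V" "b \<notin> N a" for a b
  proof -
    have "\<not> \<alpha> a < \<alpha> b" using * that by blast
    moreover have "\<not> \<alpha> b < \<alpha> a" using * that(1,2) nonadj_sym[OF that(3)] by blast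
    ultimately show ?thesis by simp
  qed
  have n: "real (card V) = (\<alpha> a)\<^sup>2 + (\<alpha> b)\<^sup>2 - \<alpha> a * \<alpha> b + 3 * t - 1"
    if ab: "a \<in> V" "b \<in> V" "\<alpha> a \<noteq> \<alpha> b" for a b
  proof (rule disjoint_nonneighbours[OF ab(1)])
    show "b \<in> N a" using eq[OF ab(1,2)] ab(3) by metis
    fix w assume "w \<in> V"
    then show "w \<in> N a \<or> w \<in> N b" using eq[OF ab(1)] eq[OF ab(2)] ab(3) by metis
  qed
  have "(\<alpha> y - \<alpha> z) * (\<alpha> y + \<alpha> z - \<alpha> x) = 0"
    using n[OF assms(1,2,4)] n[OF assms(1,3,6)] by (simp add: power2_eq_square algebra_simps)
  then have 1: "\<alpha> y + \<alpha> z - \<alpha> x = 0" using assms(5) by simp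
  have "(\<alpha> x - \<alpha> z) * (\<alpha> x + \<alpha> z - \<alpha> y) = 0"
    using n[OF assms(1,2,4)] n[OF assms(2,3,5)] by (simp add: power2_eq_square algebra_simps)
  then have 2: "\<alpha> x + \<alpha> z - \<alpha> y = 0" using assms(6) by simp
  have "\<alpha> z = 0" using 1 2 by linarith
  then show False using pos[OF assms(3)] by simp
qed

end

section \<open>Moments of the levels and extremal pairs\<close>

context three_ev
begin

text \<open>The quadratic relation \<open>lap_lap\<close> applied to the constant function 1, whose
  image under \<open>I - A\<close> is one minus the valency.\<close>

lemma sum_square_nb:
  assumes "v \<in> V"
  shows "(\<Sum>w\<in>N v. (\<alpha> w)\<^sup>2) = \<alpha> v * (\<Sum>w\<in>V. \<alpha> w) - (2 * t - 1) * ((\<alpha> v)\<^sup>2 + t) + t"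
proof -
  have 1: "lap (\<lambda>_. 1) w = 1 - t - (\<alpha> w)\<^sup>2" if "w \<in> V" for w
    using deg[OF that] by (simp add: lap_def)
  have "lap (lap (\<lambda>_. 1)) v = (1 - t - (\<alpha> v)\<^sup>2) - (\<Sum>w\<in>N v. 1 - t - (\<alpha> w)\<^sup>2)"
    unfolding lap_def[of "lap _"] using 1 assms nbV by (metis (no_types, lifting) sum.cong)
  also have "\<dots> = (1 - t - (\<alpha> v)\<^sup>2) - ((1 - t) * ((\<alpha> v)\<^sup>2 + t) - (\<Sum>w\<in>N v. (\<alpha> w)\<^sup>2))"
    using deg[OF assms] by (simp add: sum_subtractf mult.commute)
  finally have "(1 + t) * (1 - t - (\<alpha> v)\<^sup>2) + \<alpha> v * (\<Sum>w\<in>V. \<alpha> w)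
      = (1 - t - (\<alpha> v)\<^sup>2) - ((1 - t) * ((\<alpha> v)\<^sup>2 + t) - (\<Sum>w\<in>N v. (\<alpha> w)\<^sup>2))"
    using lap_lap[OF assms, of "\<lambda>_. 1"] 1[OF assms] by (simp add: wt_def)
  then show ?thesis by (simp add: algebra_simps)
qed

definition mom :: "real \<Rightarrow> 'a set \<Rightarrow> real" where
  "mom k S = (\<Sum>v\<in>S. (\<alpha> v - k)\<^sup>2)"

lemma mom_nonneg: "0 \<le> mom k S"
  by (simp add: mom_def sum_nonneg)

text \<open>The global unknowns, \<open>s\<close> and the sum of all levels, occur only multiplied
  by \<open>\<alpha> v\<close>; cross-multiplying for two vertices eliminates both.\<close>

lemma mom_nb:
  assumes "v \<in> V"
  shows "mom k (N v) = \<alpha> v * (\<Sum>w\<in>V. \<alpha> w) - (2 * t - 1) * ((\<alpha> v)\<^sup>2 + t) + t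
    - 2 * k * s * \<alpha> v + k\<^sup>2 * ((\<alpha> v)\<^sup>2 + t)"
proof -
  have "mom k (N v) = (\<Sum>w\<in>N v. (\<alpha> w)\<^sup>2 - 2 * k * \<alpha> w + k\<^sup>2)"
    unfolding mom_def by (intro sum.cong refl) (simp add: power2_eq_square algebra_simps)
  also have "\<dots> = (\<Sum>w\<in>N v. (\<alpha> w)\<^sup>2) - 2 * k * (\<Sum>w\<in>N v. \<alpha> w) + k\<^sup>2 * real (card (N v))"
    by (simp add: sum.distrib sum_subtractf sum_distrib_left[symmetric] mult.commute[of "k\<^sup>2"])
  finally show ?thesis
    unfolding sum_square_nb[OF assms] eig[OF assms] deg[OF assms] by (simp add: algebra_simps)
qed

lemma sum_diff_nb:
  fixes f :: "'a \<Rightarrow> real"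
  shows "(\<Sum>v\<in>N y - N x. f v) - (\<Sum>v\<in>N x - N y. f v) = (\<Sum>v\<in>N y. f v) - (\<Sum>v\<in>N x. f v)"
proof -
  have "(\<Sum>v\<in>N y. f v) = (\<Sum>v\<in>N y \<inter> N x. f v) + (\<Sum>v\<in>N y - N x. f v)"
    by (rule sum.Int_Diff) simp
  moreover have "(\<Sum>v\<in>N x. f v) = (\<Sum>v\<in>N x \<inter> N y. f v) + (\<Sum>v\<in>N x - N y. f v)"
    by (rule sum.Int_Diff) simp
  ultimately show ?thesis by (simp add: Int_commute)
qed

lemma sum_level_diff:
  assumes "x \<in> V" "y \<in> V"
  shows "(\<Sum>v\<in>N y - N x. \<alpha> v) - (\<Sum>v\<in>N x - N y. \<alpha> v) = s * (\<alpha> y - \<alpha> x)"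
  unfolding sum_diff_nb eig[OF assms(1)] eig[OF assms(2)] by (simp add: algebra_simps)

text \<open>The centre \<open>k\<close> is free; the midpoint of the two levels and values near their sum are useful.\<close>

lemma moment_identity:
  assumes "x \<in> V" "y \<in> V" "x \<noteq> y" "y \<notin> N x"
  shows "(\<alpha> y - \<alpha> x) * mom k (N x) = \<alpha> x * (mom k (N y - N x) - mom k (N x - N y))
    + (\<alpha> y - \<alpha> x) * (((\<alpha> x)\<^sup>2 - real (card (N x - N y))) * (2 * t - 1 - k\<^sup>2) + t)"
proof -
  have "mom k (N y - N x) - mom k (N x - N y) = mom k (N y) - mom k (N x)"
    unfolding mom_def by (rule sum_diff_nb)
  then show ?thesis
    unfolding card_diff[OF assms] mom_nb[OF assms(1)] mom_nb[OF assms(2)]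
    by (simp only:) (simp add: power2_eq_square algebra_simps)
qed

end

text \<open>
  The upper level is maximal among all non-neighbours of \<^emph>\<open>all\<close> vertices of the lower level, so
  that the pair controls other vertices of level \<open>\<alpha> x\<close> as well.
\<close>

locale extremal_pair = large_t +
  fixes x y :: 'a
  assumes xV: "x \<in> V" and yV: "y \<in> V" and xy_nonadj: "y \<notin> N x" and xy_less: "\<alpha> x < \<alpha> y"
    and x_min: "a \<in> V \<Longrightarrow> b \<in> V \<Longrightarrow> b \<notin> N a \<Longrightarrow> \<alpha> a < \<alpha> b \<Longrightarrow> \<alpha> x \<le> \<alpha> a"
    and y_max: "a \<in> V \<Longrightarrow> b \<in> V \<Longrightarrow> b \<notin> N a \<Longrightarrow> \<alpha> a = \<alpha> x \<Longrightarrow>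
      \<alpha> x < \<alpha> b \<Longrightarrow> \<alpha> b \<le> \<alpha> y"
begin

lemma xy_ne: "x \<noteq> y" using xy_less by auto

lemmas xy4 = xV yV xy_ne xy_nonadj

lemma level_ge:
  assumes "a \<in> V" "\<alpha> a = \<alpha> x" "b \<in> V" "b \<notin> N a" shows "\<alpha> x \<le> \<alpha> b"
  using x_min[OF assms(3,1) nonadj_sym[OF assms(4)]] assms(2) by (cases "\<alpha> b < \<alpha> x") auto

lemma level_le:
  assumes "a \<in> V" "\<alpha> a = \<alpha> x" "b \<in> V" "b \<notin> N a" shows "\<alpha> b \<le> \<alpha> y"
  using y_max[OF assms(1,3,4,2)] xy_less by (cases "\<alpha> x < \<alpha> b") auto

lemma card_above:
  assumes "a \<in> V" "\<alpha> a = \<alpha> x" "b \<in> V" "b \<notin> N a" "\<alpha> x < \<alpha> b"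
  shows "\<alpha> x * (\<alpha> b - \<alpha> x) = t - real (card (N a - N b))" "card (N a - N b) \<le> 8"
proof -
  have ne: "a \<noteq> b" using assms(2,5) by auto
  show "\<alpha> x * (\<alpha> b - \<alpha> x) = t - real (card (N a - N b))"
    using card_diff[OF assms(1,3) ne assms(4)] assms(2) by simp
  show "card (N a - N b) \<le> 8"
    using card_P_le_8[OF assms(1,3) ne assms(4)] assms(2,5) by simp
qed

lemma Q_memD:
  assumes "q \<in> N b - N a" "b \<in> V" "b \<notin> N a"
  shows "q \<in> V" "q \<notin> N a" "q \<noteq> a" "q \<in> N b"
  using assms nbV[of q b] nb_iff[of b a] by auto

section \<open>Bounds for the lower level of an extremal pair\<close>

lemma M_int: "(\<alpha> x)\<^sup>2 \<in> \<int>"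
proof -
  have "(\<alpha> x)\<^sup>2 = real (card (N x)) - t" using deg[OF xV] by simp
  then show ?thesis using t_int by simp
qed

text \<open>With the midpoint as centre \<open>k\<close>, all levels in Q lie within half the gap of
  \<open>k\<close>. If \<open>M >= 3 t\<close>, then \<open>2 t - 1 - k^2\<close> is below
  \<open>- t\<close>, and its multiple by \<open>M - j\<close> makes the right side of
  \<open>moment_identity\<close> negative.\<close>

lemma large_min_level: "(\<alpha> x)\<^sup>2 < 3 * t"
proof (rule ccontr)
  assume M: "\<not> ?thesis"
  define M D j k n where "M = (\<alpha> x)\<^sup>2" and "D = \<alpha> y - \<alpha> x" and "j = real (card (N x - N y))"
    and "k = (\<alpha> x + \<alpha> y) / 2" and "n = real (card (N y - N x))"
  have ax: "\<alpha> x > 0" by (rule pos[OF xV])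
  have D0: "D > 0" using xy_less by (simp add: D_def)
  have M3: "M \<ge> 3 * t" using M by (simp add: M_def)
  have muD: "\<alpha> x * D = t - j" and j8: "0 \<le> j" "j \<le> 8"
    using card_above[OF xV refl yV xy_nonadj xy_less] by (simp_all add: D_def j_def)
  have n: "n = 2 * t - j + D\<^sup>2"
    using card_diff'[OF xy4] muD by (simp add: n_def D_def power2_eq_square algebra_simps)
  have "mom k (N y - N x) \<le> (\<Sum>q\<in>N y - N x. D\<^sup>2 / 4)"
    unfolding mom_def
  proof (rule sum_mono)
    fix q assume "q \<in> N y - N x"
    note q = Q_memD[OF this yV xy_nonadj]
    have "\<alpha> x \<le> \<alpha> q" "\<alpha> q \<le> \<alpha> y" using level_ge[OF xV refl q(1,2)] level_le[OF xV refl q(1,2)] .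
    then have "0 \<le> (\<alpha> q - \<alpha> x) * (\<alpha> y - \<alpha> q)" by simp
    then show "(\<alpha> q - k)\<^sup>2 \<le> D\<^sup>2 / 4"
      by (simp add: k_def D_def power2_eq_square field_simps)
  qed
  then have m: "mom k (N y - N x) - mom k (N x - N y) \<le> n * (D\<^sup>2 / 4)"
    using mom_nonneg[of k "N x - N y"] by (simp add: n_def)
  have "0 \<le> D * mom k (N x)" using D0 mom_nonneg by simp
  also have "\<dots> \<le> \<alpha> x * (n * (D\<^sup>2 / 4)) + D * ((M - j) * (2 * t - 1 - k\<^sup>2) + t)"
    unfolding moment_identity[OF xy4, of k, folded D_def M_def j_def]
    using ax m by simp
  also have "\<dots> = D * (n * (\<alpha> x * D) / 4 + (M - j) * (2 * t - 1 - k\<^sup>2) + t)"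
    by (simp add: power2_eq_square algebra_simps)
  finally have "0 \<le> n * (t - j) / 4 + (M - j) * (2 * t - 1 - k\<^sup>2) + t"
    unfolding muD using D0 by (simp add: zero_le_mult_iff)
  moreover have "(M - j) * (2 * t - 1 - k\<^sup>2) = - ((M - j) * (k\<^sup>2 + 1 - 2 * t))"
    by (simp add: algebra_simps)
  ultimately have main: "(M - j) * (k\<^sup>2 + 1 - 2 * t) \<le> n * (t - j) / 4 + t" by linarith
  have "M * D\<^sup>2 = (t - j)\<^sup>2" by (simp add: M_def flip: muD power_mult_distrib)
  also have "\<dots> \<le> t\<^sup>2" using j8 t_ge by (intro power_mono) auto
  finally have "M * D\<^sup>2 \<le> t * t" by (simp add: power2_eq_square)
  moreover have "3 * t * D\<^sup>2 \<le> M * D\<^sup>2" using M3 by (intro mult_right_mono) auto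
  ultimately have "t * (3 * D\<^sup>2) \<le> t * t" by (simp add: algebra_simps)
  then have D2: "3 * D\<^sup>2 \<le> t" using t_ge by simp
  have "n * (t - j) \<le> (2 * t + t / 3) * t"
    using n j8 t_ge D2 by (intro mult_mono) auto
  moreover have "(3 * t - 8) * t \<le> (M - j) * (k\<^sup>2 + 1 - 2 * t)"
  proof (rule mult_mono)
    have "\<alpha> x \<le> k" using xy_less by (simp add: k_def)
    then have "M \<le> k\<^sup>2" unfolding M_def using ax by (intro power_mono) auto
    then show "t \<le> k\<^sup>2 + 1 - 2 * t" using M3 by simp
  qed (use M3 j8 t_ge in auto)
  moreover have "n * (t - j) / 4 + t \<le> (2 * t + t / 3) * t / 4 + t"
    using calculation(1) by simp
  ultimately have "(3 * t - 8) * t \<le> (2 * t + t / 3) * t / 4 + t" using main by (meson order_trans)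
  then have "t * (3 * t - 8) \<le> t * (7 / 12 * t + 1)" by (simp add: algebra_simps)
  then have "3 * t - 8 \<le> 7 / 12 * t + 1" using t_ge by simp
  then show False using t_ge by simp
qed

text \<open>Such vertices induce degrees at most 1, so half of them form a coclique
  \<open>K\<close>, and each misses at least \<open>t - 1\<close> common neighbours.
  \<open>missing_sum\<close> then gives \<open>(t - 2) |K| <= 12 t\<close>, hence |K| is at most
  12.\<close>

lemma low_few:
  assumes b: "b \<in> V" "b \<notin> N x" "\<alpha> x < \<alpha> b"
  shows "card {q \<in> N b - N x. \<alpha> q = \<alpha> x} \<le> 24"
proof (rule ccontr)
  assume big: "\<not> ?thesis"
  let ?Z = "{q \<in> N b - N x. \<alpha> q = \<alpha> x}"
  have xb: "x \<noteq> b" using b(3) by auto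
  have degZ: "card ((N b - N x) \<inter> N z) \<le> 1" if "z \<in> ?Z" for z
    using level_formula[OF xV b(1) xb b(2), of z] that by simp
  have "card (?Z \<inter> N v) \<le> 1" if "v \<in> ?Z" for v
  proof -
    have "card (?Z \<inter> N v) \<le> card ((N b - N x) \<inter> N v)" by (intro card_mono) auto
    then show ?thesis using degZ[OF that] by linarith
  qed
  then obtain K where K: "K \<subseteq> ?Z" "coclique K" "card ?Z \<le> 2 * card K"
    using coclique_half[of ?Z] by auto
  have cK: "card K \<ge> 13" using big K(3) by linarith
  have KQ: "K \<subseteq> N b - N x" using K(1) by auto
  have "(t - 1) * real (card K) = (\<Sum>z\<in>K. t - 1)" by simp
  also have "\<dots> \<le> (\<Sum>z\<in>K. real (card ((N x \<inter> N b) - N z)))"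
  proof (rule sum_mono)
    fix z assume "z \<in> K"
    then show "t - 1 \<le> real (card ((N x \<inter> N b) - N z))"
      using missing_formula[OF xV b(1) xb b(2), of z] K(1) by auto
  qed
  also have "\<dots> = real (\<Sum>z\<in>K. card ((N x \<inter> N b) - N z))" by simp
  also have "\<dots> \<le> real (3 * card (N x \<inter> N b) + card K)"
    by (intro of_nat_mono missing_sum[OF xV b(1) xb b(2) KQ K(2)]) (use cK in linarith)
  also have "\<dots> = 3 * (\<alpha> x * \<alpha> b) + real (card K)"
    using common_nonadj[OF xV b(1) xb b(2)] by simp
  finally have 1: "(t - 2) * real (card K) \<le> 3 * (\<alpha> x * \<alpha> b)" by (simp add: algebra_simps)
  have "\<alpha> x * \<alpha> b \<le> (\<alpha> x)\<^sup>2 + t"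
    using card_above[OF xV refl b] by (simp add: power2_eq_square algebra_simps)
  then have "\<alpha> x * \<alpha> b \<le> 4 * t" using large_min_level by simp
  moreover have "(t - 2) * 13 \<le> (t - 2) * real (card K)"
    using cK t_ge by (intro mult_left_mono) auto
  ultimately show False using 1 t_ge by simp
qed

lemma ex_above:
  assumes b: "b \<in> V" "b \<notin> N x" "\<alpha> x < \<alpha> b"
  shows "\<exists>q \<in> N b - N x. \<alpha> x < \<alpha> q"
proof (rule ccontr)
  assume *: "\<not> ?thesis"
  have xb: "x \<noteq> b" using b(3) by auto
  have "N b - N x \<subseteq> {q \<in> N b - N x. \<alpha> q = \<alpha> x}"
  proof
    fix q assume q: "q \<in> N b - N x"
    have "\<alpha> x \<le> \<alpha> q" using level_ge[OF xV refl] Q_memD[OF q b(1,2)] by blast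
    moreover have "\<not> \<alpha> x < \<alpha> q" using * q by blast
    ultimately show "q \<in> {q \<in> N b - N x. \<alpha> q = \<alpha> x}" using q by simp
  qed
  then have "card (N b - N x) \<le> card {q \<in> N b - N x. \<alpha> q = \<alpha> x}" by (intro card_mono) auto
  then have "card (N b - N x) \<le> 24" using low_few[OF b] by linarith
  then have "real (card (N b - N x)) \<le> 24" by linarith
  moreover have "real (card (N b - N x)) \<ge> t"
    using card_Q_gt[OF xV b(1) xb b(2)] b(3) by simp
  ultimately show False using t_ge by linarith
qed

text \<open>A vertex \<open>q\<close> of \<open>N b - N x\<close> above the level of
  \<open>x\<close> has \<open>(\<alpha> q - \<alpha> x) (\<alpha> b - \<alpha> x) >= (t - 8)^2 / (3
  t)\<close>, both gaps being about \<open>t / \<alpha> x\<close>. This exceeds 5, so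
  \<open>q\<close> has six neighbours in that set and \<open>card_P_le_4\<close> applies.\<close>

lemma defect_le_4:
  assumes b: "b \<in> V" "b \<notin> N x" "\<alpha> x < \<alpha> b"
  shows "card (N x - N b) \<le> 4"
proof (cases "card (N x - N b) \<ge> 2")
  case True
  have xb: "x \<noteq> b" using b(3) by auto
  obtain q where q: "q \<in> N b - N x" "\<alpha> x < \<alpha> q" using ex_above[OF b] by blast
  note qV = Q_memD[OF q(1) b(1,2)]
  have "real (card (N b - N x)) \<ge> t" using card_Q_gt[OF xV b(1) xb b(2)] b(3) by simp
  then have cQ: "card (N b - N x) \<ge> 2" using t_ge by linarith
  define E where "E = (\<alpha> q - \<alpha> x) * (\<alpha> b - \<alpha> x)"
  have E0: "E > 0" using q b by (simp add: E_def)
  have "(t - 8) * (t - 8) \<le> (\<alpha> x * (\<alpha> q - \<alpha> x)) * (\<alpha> x * (\<alpha> b - \<alpha> x))"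
    using card_above[OF xV refl qV(1,2) q(2)] card_above[OF xV refl b] t_ge by (intro mult_mono) auto
  also have "\<dots> = (\<alpha> x)\<^sup>2 * E" by (simp add: E_def power2_eq_square algebra_simps)
  also have "\<dots> \<le> (3 * t) * E" using large_min_level E0 by (intro mult_right_mono) auto
  finally have 1: "(t - 8) * (t - 8) \<le> 3 * (t * E)" by simp
  have "E > 5"
  proof (rule ccontr)
    assume "\<not> E > 5"
    then have "t * E \<le> t * 5" using t_ge by (intro mult_left_mono) auto
    then have "(t - 8) * (t - 8) \<le> 15 * t" using 1 by linarith
    moreover have "0 \<le> (t - 30) * (t - 1)" using t_ge by simp
    ultimately show False by (simp add: algebra_simps)
  qed
  moreover have "card ((N x - N b) - N q) \<le> 1"
    by (rule defect_le_1[OF xV b(1) xb b(2) True cQ q(1)])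
  ultimately have "real (card ((N b - N x) \<inter> N q)) > 5"
    using level_formula[OF xV b(1) xb b(2) q(1)] by (simp add: E_def)
  then have "6 \<le> card ((N b - N x) \<inter> N q)" by linarith
  then show ?thesis using card_P_le_4[OF xV b(1) xb b(2,3) q(1)] by simp
qed simp

text \<open>Seen from \<open>x\<close>, the defects of \<open>a\<close> and \<open>b\<close> differ
  by at most 4, so \<open>\<alpha> x (\<alpha> b - \<alpha> a) <= 4\<close>; seen from
  \<open>a\<close>, \<open>\<alpha> a (\<alpha> b - \<alpha> a) >= t - 8\<close>. Together they give
  \<open>M (t - 12) <= 4 t\<close> for \<open>M = (\<alpha> x)^2\<close>, and 7 is the least integer
  \<open>M\<close> for which this fails at \<open>t = 30\<close>.\<close>

lemma same_level_above:
  assumes M: "7 \<le> (\<alpha> x)\<^sup>2"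
    and a: "a \<in> V" "a \<notin> N x" "\<alpha> x < \<alpha> a" and b: "b \<in> V" "b \<notin> N x" "\<alpha> x < \<alpha> b"
    and ab: "b \<notin> N a"
  shows "\<not> \<alpha> a < \<alpha> b"
proof
  assume less: "\<alpha> a < \<alpha> b"
  then have ne: "a \<noteq> b" by auto
  have "\<alpha> x * (\<alpha> b - \<alpha> a) = real (card (N x - N a)) - real (card (N x - N b))"
    using card_above(1)[OF xV refl a] card_above(1)[OF xV refl b] by (simp add: algebra_simps)
  then have 1: "\<alpha> x * (\<alpha> b - \<alpha> a) \<le> 4" using defect_le_4[OF a] by simp
  have 2: "\<alpha> a * (\<alpha> b - \<alpha> a) \<ge> t - 8"
    using card_diff[OF a(1) b(1) ne ab] card_P_le_8[OF a(1) b(1) ne ab less] by simp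
  have 3: "\<alpha> x * \<alpha> a \<le> (\<alpha> x)\<^sup>2 + t"
    using card_above(1)[OF xV refl a] by (simp add: power2_eq_square algebra_simps)
  have "(\<alpha> x)\<^sup>2 * (t - 8) \<le> (\<alpha> x)\<^sup>2 * (\<alpha> a * (\<alpha> b - \<alpha> a))"
    using 2 by (intro mult_left_mono) auto
  also have "\<dots> = (\<alpha> x * \<alpha> a) * (\<alpha> x * (\<alpha> b - \<alpha> a))" by (simp add: power2_eq_square algebra_simps)
  also have "\<dots> \<le> ((\<alpha> x)\<^sup>2 + t) * 4"
    using 1 3 less pos[OF xV] pos[OF a(1)] t_ge by (intro mult_mono) auto
  finally have "(\<alpha> x)\<^sup>2 * (t - 12) \<le> 4 * t" by (simp add: algebra_simps)
  moreover have "7 * (t - 12) \<le> (\<alpha> x)\<^sup>2 * (t - 12)" using M t_ge by (intro mult_right_mono) auto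
  ultimately show False using t_ge by simp
qed

text \<open>Two non-adjacent vertices of Q above \<open>x\<close> share a level \<open>l\<close>.
  All but four of the \<open>t\<close> vertices in \<open>N b - N a\<close> have level at most
  \<open>l\<close> and so miss \<open>t - 1\<close> common neighbours of \<open>a\<close> and
  \<open>b\<close>. As a star they force \<open>(t - 2) (t - 4) <= 3 l^2\<close>, too large for
  \<open>\<alpha> x * l <= M + t\<close>.\<close>

lemma mid_min_level: "(\<alpha> x)\<^sup>2 < 7"
proof (rule ccontr)
  assume "\<not> ?thesis"
  then have M7: "7 \<le> (\<alpha> x)\<^sup>2" by simp
  let ?Q = "N y - N x" and ?Z = "{q \<in> N y - N x. \<alpha> q = \<alpha> x}" and ?D = "\<alpha> y - \<alpha> x"
  obtain a where a: "a \<in> ?Q" "\<alpha> x < \<alpha> a" using ex_above[OF yV xy_nonadj xy_less] by blast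
  note aV = Q_memD[OF a(1) yV xy_nonadj]
  have la: "\<alpha> a \<le> \<alpha> y" by (rule level_le[OF xV refl aV(1,2)])
  have nQ: "real (card ?Q) = 2 * t - real (card (N x - N y)) + ?D\<^sup>2"
    using card_diff'[OF xy4] card_above(1)[OF xV refl yV xy_nonadj xy_less]
    by (simp add: power2_eq_square algebra_simps)
  have "real (card (?Q \<inter> N a)) \<le> 1 + (\<alpha> a - \<alpha> x) * ?D"
    using level_formula[OF xy4 a(1)] by simp
  also have "\<dots> \<le> 1 + ?D * ?D" using la xy_less by (intro add_left_mono mult_right_mono) auto
  finally have da: "real (card (?Q \<inter> N a)) \<le> 1 + ?D\<^sup>2" by (simp add: power2_eq_square)
  \<comment> \<open>Here \<open>a\<close> has at most \<open>1 + ?D^2\<close> neighbours in Q and at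
    most 24 vertices of Q are low, while Q has at least \<open>2 t - 8 + ?D^2\<close>
    elements.\<close>
  have "\<exists>b \<in> ?Q. b \<noteq> a \<and> b \<notin> N a \<and> \<alpha> b \<noteq> \<alpha> x"
  proof (rule ccontr)
    assume "\<not> ?thesis"
    then have "?Q \<subseteq> insert a ((?Q \<inter> N a) \<union> ?Z)" by blast
    then have "card ?Q \<le> card (insert a ((?Q \<inter> N a) \<union> ?Z))" by (intro card_mono) auto
    also have "\<dots> \<le> 1 + card ((?Q \<inter> N a) \<union> ?Z)" by (simp add: card_insert_if)
    also have "\<dots> \<le> 1 + (card (?Q \<inter> N a) + card ?Z)" using card_Un_le by (intro add_left_mono)
    finally have "real (card ?Q) \<le> 1 + (real (card (?Q \<inter> N a)) + 24)"
      using low_few[OF yV xy_nonadj xy_less] by linarith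
    then have "2 * t - real (card (N x - N y)) \<le> 26" using nQ da by linarith
    moreover have "real (card (N x - N y)) \<le> 8"
      using card_above(2)[OF xV refl yV xy_nonadj xy_less] by simp
    ultimately show False using t_ge by linarith
  qed
  then obtain b where b: "b \<in> ?Q" "b \<noteq> a" "b \<notin> N a" "\<alpha> b \<noteq> \<alpha> x" by blast
  note bV = Q_memD[OF b(1) yV xy_nonadj]
  have lb: "\<alpha> x < \<alpha> b" using level_ge[OF xV refl bV(1,2)] b(4) by simp
  have ab: "\<alpha> a = \<alpha> b"
    using same_level_above[OF M7 aV(1,2) a(2) bV(1,2) lb b(3)]
      same_level_above[OF M7 bV(1,2) lb aV(1,2) a(2) nonadj_sym[OF b(3)]] by simp
  note ab4 = aV(1) bV(1) b(2)[symmetric] b(3)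
  let ?R = "N b - N a" and ?l = "\<alpha> a"
  have cR: "real (card ?R) = t" using card_diff'[OF ab4] ab by simp
  then have cR': "14 \<le> card ?R" using t_ge by linarith
  have sparse: "card (?R \<inter> N q) \<le> 1" if "q \<in> ?R" for q by (rule same_level_sparse[OF ab4 ab that])
  define K where "K = {q \<in> ?R. \<alpha> q \<le> ?l}"
  \<comment> \<open>A vertex above \<open>l\<close> outside \<open>N x\<close> would be a
    non-neighbour of \<open>a\<close> of larger level, contrary to
    \<open>same_level_above\<close>.\<close>
  have "?R - K \<subseteq> N x - N a"
  proof
    fix q assume q: "q \<in> ?R - K"
    then have q': "q \<in> ?R" "?l < \<alpha> q" by (auto simp: K_def)
    note qV = Q_memD[OF q'(1) bV(1) b(3)]
    have "q \<in> N x"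
    proof (rule ccontr)
      assume "q \<notin> N x"
      then show False
        using same_level_above[OF M7 aV(1,2) a(2) qV(1) _ _ qV(2)] q'(2) a(2) by simp
    qed
    then show "q \<in> N x - N a" using qV(2) by simp
  qed
  then have "card (?R - K) \<le> card (N x - N a)" by (intro card_mono) auto
  also have "\<dots> \<le> 4" by (rule defect_le_4[OF aV(1,2) a(2)])
  finally have "card (?R - K) \<le> 4" .
  moreover have "real (card ?R) = real (card (?R \<inter> K)) + real (card (?R - K))"
    by (rule card_split) simp
  moreover have "?R \<inter> K = K" by (auto simp: K_def)
  ultimately have cK: "real (card K) \<ge> t - 4" using cR by simp
  have miss: "real (card ((N a \<inter> N b) - N q)) \<ge> t - 1" if "q \<in> K" for q
  proof -
    have "0 \<le> (\<alpha> a - \<alpha> q) * \<alpha> b" using that pos[OF bV(1)] by (simp add: K_def)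
    then show ?thesis using missing_formula[OF ab4, of q] that by (simp add: K_def)
  qed
  have "coclique K"
    unfolding coclique_def
  proof (intro ballI notI)
    fix q q' assume q: "q \<in> K" "q' \<in> K" "q' \<in> N q"
    have qR: "q \<in> ?R" "q' \<in> ?R" using q(1,2) by (simp_all add: K_def)
    have "card ((N a \<inter> N b) - N q) \<le> 1"
      by (rule missing_edge_le_1[OF ab4 qR q(3) sparse cR'])
    then have "real (card ((N a \<inter> N b) - N q)) \<le> 1" by linarith
    then show False using miss[OF q(1)] t_ge by linarith
  qed
  moreover have KR: "K \<subseteq> ?R" by (auto simp: K_def)
  moreover have "6 \<le> card K" using cK t_ge by linarith
  ultimately have ms: "(\<Sum>q\<in>K. card ((N a \<inter> N b) - N q)) \<le> 3 * card (N a \<inter> N b) + card K"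
    using missing_sum[OF ab4] by blast
  have "(t - 1) * real (card K) = (\<Sum>q\<in>K. t - 1)" by simp
  also have "\<dots> \<le> (\<Sum>q\<in>K. real (card ((N a \<inter> N b) - N q)))" using miss by (rule sum_mono)
  also have "\<dots> = real (\<Sum>q\<in>K. card ((N a \<inter> N b) - N q))" by simp
  also have "\<dots> \<le> real (3 * card (N a \<inter> N b) + card K)" using ms by (rule of_nat_mono)
  also have "\<dots> = 3 * ?l\<^sup>2 + real (card K)"
    using common_nonadj[OF ab4] ab by (simp add: power2_eq_square)
  finally have "(t - 2) * real (card K) \<le> 3 * ?l\<^sup>2" by (simp add: algebra_simps)
  moreover have "(t - 2) * (t - 4) \<le> (t - 2) * real (card K)" using cK t_ge by (intro mult_left_mono) auto
  ultimately have l2: "(t - 2) * (t - 4) \<le> 3 * ?l\<^sup>2" by linarith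
  define M where "M = (\<alpha> x)\<^sup>2"
  have "\<alpha> x * ?l \<le> M + t"
    using card_above(1)[OF xV refl aV(1,2) a(2)] by (simp add: M_def power2_eq_square algebra_simps)
  then have "(\<alpha> x * ?l)\<^sup>2 \<le> (M + t)\<^sup>2" using pos[OF xV] pos[OF aV(1)] by (intro power_mono) auto
  then have "M * (3 * ?l\<^sup>2) \<le> 3 * (M + t)\<^sup>2" by (simp add: M_def power_mult_distrib)
  moreover have "M * ((t - 2) * (t - 4)) \<le> M * (3 * ?l\<^sup>2)"
    using l2 by (intro mult_left_mono) (auto simp: M_def)
  ultimately have 1: "M * ((t - 2) * (t - 4)) \<le> 3 * (M + t)\<^sup>2" by linarith
  have M: "7 \<le> M" "M \<le> 3 * t" using M7 large_min_level by (simp_all add: M_def)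
  \<comment> \<open>The chord of \<open>M^2\<close> over the interval from 7 to \<open>3 t\<close>
    makes the inequality linear in \<open>M\<close>.\<close>
  have "0 \<le> (M - 7) * (3 * t - M)" using M by simp
  then have 2: "M\<^sup>2 \<le> (3 * t + 7) * M - 21 * t" by (simp add: power2_eq_square algebra_simps)
  have "0 \<le> (M - 7) * (t\<^sup>2 - 21 * t - 13)"
  proof -
    have "0 \<le> (t - 30) * (t + 9)" using t_ge by simp
    then have "0 \<le> t\<^sup>2 - 21 * t - 13" by (simp add: power2_eq_square algebra_simps)
    then show ?thesis using M by simp
  qed
  moreover have "M * (t * t) - 6 * (M * t) + 8 * M \<le> 3 * M\<^sup>2 + 6 * (M * t) + 3 * (t * t)"
    using 1 by (simp add: power2_eq_square algebra_simps)
  ultimately have "7 * (t * t) - 147 * t - 91 \<le> 3 * (t * t) - 63 * t"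
    using 2 by (simp add: power2_eq_square algebra_simps)
  moreover have "30 * t \<le> t * t" using t_ge by (intro mult_right_mono) auto
  ultimately show False using t_ge by linarith
qed

section \<open>Extremal pairs with a small lower level\<close>

lemma low_nonadj:
  assumes "\<alpha> a = \<alpha> x" "\<alpha> b = \<alpha> x" shows "b \<notin> N a"
proof
  assume "b \<in> N a"
  then have "(\<alpha> x)\<^sup>2 + 1 - t \<ge> 0"
    using common_adj[of b a] assms by (simp add: power2_eq_square)
  then show False using mid_min_level t_ge by simp
qed

text \<open>A low neighbour of \<open>b\<close> shares at most \<open>(\<alpha> x)^2 + 1\<close>
  neighbours with \<open>b\<close>. Three of them leave enough common neighbours of \<open>a\<close>
  and \<open>b\<close> for a coclique \<open>A\<close> of size three away from them, and then
  \<open>a\<close> sees exactly half of the star \<open>A \<union> Z\<close>.\<close>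

lemma low_le_2:
  assumes a: "a \<in> V" "\<alpha> a = \<alpha> x" and b: "b \<in> V" "b \<notin> N a" "\<alpha> x < \<alpha> b"
  shows "card {z \<in> N b. \<alpha> z = \<alpha> x} \<le> 2"
proof (rule ccontr)
  assume "\<not> ?thesis"
  then have "3 \<le> card {z \<in> N b. \<alpha> z = \<alpha> x}" by simp
  then obtain Z where Z: "Z \<subseteq> {z \<in> N b. \<alpha> z = \<alpha> x}" "card Z = 3"
    using obtain_subset_with_card_n by metis
  have ab: "a \<noteq> b" using a b by auto
  have finZ: "finite Z" using Z(2) by (metis card.infinite zero_neq_numeral)
  let ?C = "N a \<inter> N b"
  define S where "S = ?C - (\<Union>z\<in>Z. N z)"
  have jb: "\<alpha> x * \<alpha> b = (\<alpha> x)\<^sup>2 + t - real (card (N a - N b))" "real (card (N a - N b)) \<le> 8"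
    using card_above[OF a b] by (simp_all add: power2_eq_square algebra_simps)
  have cz: "real (card (?C \<inter> N z)) \<le> \<alpha> x * \<alpha> b + 1 - t" if "z \<in> Z" for z
  proof -
    have "card (?C \<inter> N z) \<le> card (N b \<inter> N z)" by (intro card_mono) auto
    then show ?thesis using common_adj[of z b] Z(1) that by (auto simp: mult.commute)
  qed
  have "card (?C \<inter> (\<Union>z\<in>Z. N z)) \<le> (\<Sum>z\<in>Z. card (?C \<inter> N z))"
    unfolding Int_UN_distrib by (rule card_UN_le[OF finZ])
  then have "real (card (?C \<inter> (\<Union>z\<in>Z. N z))) \<le> (\<Sum>z\<in>Z. real (card (?C \<inter> N z)))"
    by (metis of_nat_le_iff of_nat_sum)
  also have "\<dots> \<le> (\<Sum>z\<in>Z. \<alpha> x * \<alpha> b + 1 - t)" by (rule sum_mono) (rule cz)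
  also have "\<dots> = 3 * (\<alpha> x * \<alpha> b + 1 - t)" using Z(2) by simp
  finally have 1: "real (card (?C \<inter> (\<Union>z\<in>Z. N z))) \<le> 3 * (\<alpha> x * \<alpha> b + 1 - t)" .
  have "real (card ?C) = real (card (?C \<inter> (\<Union>z\<in>Z. N z))) + real (card S)"
    unfolding S_def by (rule card_split) simp
  moreover have "real (card ?C) = \<alpha> x * \<alpha> b" using common_nonadj[OF a(1) b(1) ab b(2)] a(2) by simp
  ultimately have "real (card S) \<ge> t - 2 * (\<alpha> x)\<^sup>2 - 3"
    using 1 jb t_ge by simp
  then have cS: "card S \<ge> 5" using mid_min_level t_ge by linarith
  have "Z \<noteq> {}" using Z(2) by auto
  then obtain z1 where z1: "z1 \<in> Z" by blast
  then have z1': "\<alpha> z1 = \<alpha> x" "z1 \<in> N b" using Z(1) by auto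
  have z1V: "z1 \<in> V" using nbV[OF z1'(2)] by simp
  have z1a: "z1 \<noteq> a" using z1'(2) b(2) nb_sym by blast
  have na: "a \<notin> N z1" by (rule low_nonadj[OF z1'(1) a(2)])
  have "card (S \<inter> N v) \<le> 1" if "v \<in> S" for v
  proof -
    have sub: "S \<subseteq> N a - N z1" using z1 by (auto simp: S_def)
    then have "card (S \<inter> N v) \<le> card ((N a - N z1) \<inter> N v)" by (intro card_mono) auto
    also have "\<dots> \<le> 1"
      using same_level_sparse[OF z1V a(1) z1a na _ subsetD[OF sub that]] z1'(1) a(2) by simp
    finally show ?thesis .
  qed
  moreover have "finite S" by (simp add: S_def)
  ultimately obtain K where K: "K \<subseteq> S" "coclique K" "card S \<le> 2 * card K"
    using coclique_half[of S] by auto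
  have "3 \<le> card K" using K(3) cS by linarith
  then obtain A where A: "A \<subseteq> K" "card A = 3"
    using obtain_subset_with_card_n by metis
  have AS: "A \<subseteq> S" using A K by blast
  have ZN: "z \<in> N b" "\<alpha> z = \<alpha> x" if "z \<in> Z" for z using Z(1) that by auto
  have AZ: "A \<union> Z \<subseteq> N b" using AS ZN(1) by (auto simp: S_def)
  have co: "coclique (A \<union> Z)"
    unfolding coclique_def
  proof (intro ballI)
    fix v w assume "v \<in> A \<union> Z" "w \<in> A \<union> Z"
    then consider "v \<in> A" "w \<in> A" | "v \<in> A" "w \<in> Z" | "v \<in> Z" "w \<in> A" | "v \<in> Z" "w \<in> Z" by blast
    then show "w \<notin> N v"
    proof cases
      case 1 then show ?thesis using coclique_subset[OF K(2) A(1)] by (simp add: coclique_def)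
    next
      case 2
      then have "v \<notin> N w" using AS by (auto simp: S_def)
      then show ?thesis by (rule nonadj_sym)
    next
      case 3 then show ?thesis using AS by (auto simp: S_def)
    next
      case 4 then show ?thesis using low_nonadj ZN(2) by simp
    qed
  qed
  have "A \<subseteq> N a" using AS by (auto simp: S_def)
  moreover have "Z \<inter> N a = {}" using low_nonadj[OF a(2)] ZN(2) by blast
  ultimately show False
    using no_half_star[OF b(1) a(1) ab nonadj_sym[OF b(2)] AZ co A(2) Z(2)] by simp
qed

text \<open>As \<open>N a - N b\<close> is a coclique, \<open>level_formula\<close> gives
  \<open>(\<alpha> p - \<alpha> b) * ?D = 1 - d\<close> with \<open>d\<close> in {0, 1} the number
  of missing edges at \<open>p\<close>. For \<open>d = 0\<close> the first factor is at least 1, so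
  \<open>?D\<close> is at most 1, against \<open>\<alpha> x * ?D >= t - 8\<close>. For
  \<open>d = 1\<close> the missing edge gives \<open>z\<close> by \<open>matching\<close>.\<close>

lemma matched_low:
  assumes a: "a \<in> V" "\<alpha> a = \<alpha> x" and b: "b \<in> V" "b \<notin> N a" "\<alpha> x < \<alpha> b"
    and P: "2 \<le> card (N a - N b)" and p: "p \<in> N a - N b"
  shows "\<alpha> p = \<alpha> b" "\<exists>z \<in> N b - N a. z \<notin> N p \<and> \<alpha> z = \<alpha> x"
proof -
  have ab: "a \<noteq> b" using a b by auto
  note ab4 = a(1) b(1) ab b(2)
  note ba4 = b(1) a(1) ab[symmetric] nonadj_sym[OF b(2)]
  have less: "\<alpha> a < \<alpha> b" using a b by simp
  let ?D = "\<alpha> b - \<alpha> x"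
  have "real (card (N b - N a)) \<ge> t" using card_Q_gt[OF ab4] less by simp
  then have Q: "2 \<le> card (N b - N a)" using t_ge by linarith
  have "(N a - N b) \<inter> N p = {}"
    using P_coclique[OF ab4 less P] p unfolding coclique_def by blast
  then have lev: "(\<alpha> p - \<alpha> b) * ?D = 1 - real (card ((N b - N a) - N p))"
    using level_formula[OF ba4 p] a(2) by (simp add: algebra_simps)
  have le1: "card ((N b - N a) - N p) \<le> 1"
    by (rule defect_le_1[OF ba4 Q P p])
  have ne0: "card ((N b - N a) - N p) \<noteq> 0"
  proof
    assume "card ((N b - N a) - N p) = 0"
    then have eq: "(\<alpha> p - \<alpha> b) * ?D = 1" using lev by simp
    have D0: "?D > 0" using b by simp
    have "\<alpha> b < \<alpha> p"
    proof (rule ccontr)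
      assume "\<not> ?thesis"
      then have "(\<alpha> p - \<alpha> b) * ?D \<le> 0" using D0 by (intro mult_nonpos_nonneg) auto
      then show False using eq by linarith
    qed
    have pN: "p \<in> N a" "p \<notin> N b" using p by simp_all
    then have pb: "p \<in> V" "p \<noteq> b" using nbV[OF pN(1)] b(2) by auto
    have "1 \<le> \<alpha> p - \<alpha> b"
      by (rule level_diff_ge_1[OF b(1) pb(1) pb(2)[symmetric] pN(2) \<open>\<alpha> b < \<alpha> p\<close>])
    then have "?D \<le> (\<alpha> p - \<alpha> b) * ?D" using D0 by simp
    then have "?D \<le> 1" using eq by simp
    then have "?D\<^sup>2 \<le> 1" using D0 by (intro power_le_one) auto
    then have "(\<alpha> x)\<^sup>2 * ?D\<^sup>2 \<le> 7 * 1" by (intro mult_mono less_imp_le[OF mid_min_level]) auto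
    moreover have "t - 8 \<le> \<alpha> x * ?D" using card_above[OF a b] by simp
    then have "22\<^sup>2 \<le> (\<alpha> x * ?D)\<^sup>2" using t_ge by (intro power_mono) auto
    ultimately show False by (simp add: power_mult_distrib)
  qed
  then have c1: "card ((N b - N a) - N p) = 1" using le1 by linarith
  then have "(\<alpha> p - \<alpha> b) * ?D = 0" using lev by simp
  then show apb: "\<alpha> p = \<alpha> b" using b by simp
  have "(N b - N a) - N p \<noteq> {}"
  proof
    assume "(N b - N a) - N p = {}"
    then show False using ne0 by simp
  qed
  then obtain z where z: "z \<in> N b - N a" "z \<notin> N p" by blast
  obtain p' where p': "p' \<in> N a - N b" "p' \<noteq> p" using ex_other[OF P] .
  obtain z' where z': "z' \<in> N b - N a" "z' \<noteq> z" using ex_other[OF Q] .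
  have "\<alpha> z = \<alpha> x" using matching(5)[OF ab4 p z p' z'] apb a(2) by simp
  then show "\<exists>z \<in> N b - N a. z \<notin> N p \<and> \<alpha> z = \<alpha> x" using z by blast
qed

text \<open>The low partner of \<open>p\<close> from \<open>matched_low\<close> is adjacent to all
  other vertices of \<open>N a - N b\<close>, so distinct \<open>p\<close> have distinct
  partners.\<close>

lemma defect_le_low:
  assumes a: "a \<in> V" "\<alpha> a = \<alpha> x" and b: "b \<in> V" "b \<notin> N a" "\<alpha> x < \<alpha> b"
    and P: "2 \<le> card (N a - N b)"
  shows "card (N a - N b) \<le> card {z \<in> N b. \<alpha> z = \<alpha> x}"
proof -
  have ab: "a \<noteq> b" using a b by auto
  note ab4 = a(1) b(1) ab b(2)
  have less: "\<alpha> a < \<alpha> b" using a b by simp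
  have "real (card (N b - N a)) \<ge> t" using card_Q_gt[OF ab4] less by simp
  then have Q: "2 \<le> card (N b - N a)" using t_ge by linarith
  define f where "f p = (SOME z. z \<in> N b - N a \<and> z \<notin> N p \<and> \<alpha> z = \<alpha> x)" for p
  have f: "f p \<in> N b - N a \<and> f p \<notin> N p \<and> \<alpha> (f p) = \<alpha> x" if "p \<in> N a - N b" for p
    unfolding f_def by (rule someI_ex) (use matched_low(2)[OF a b P that] in blast)
  have "inj_on f (N a - N b)"
  proof (rule inj_onI, rule ccontr)
    fix p p' assume p: "p \<in> N a - N b" "p' \<in> N a - N b" "f p = f p'" "p \<noteq> p'"
    obtain z' where z': "z' \<in> N b - N a" "z' \<noteq> f p" using ex_other[OF Q] .
    have fp: "f p \<in> N b - N a" "f p \<notin> N p" using f[OF p(1)] by simp_all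
    have "f p \<in> N p'" using matching(1)[OF ab4 p(1) fp p(2) p(4)[symmetric] z'] .
    then show False using f[OF p(2)] p(3) by simp
  qed
  moreover have "f ` (N a - N b) \<subseteq> {z \<in> N b. \<alpha> z = \<alpha> x}" using f by blast
  ultimately show ?thesis by (intro card_inj_on_le[of f]) auto
qed

lemma defect_le_2:
  assumes a: "a \<in> V" "\<alpha> a = \<alpha> x" and b: "b \<in> V" "b \<notin> N a" "\<alpha> x < \<alpha> b"
  shows "card (N a - N b) \<le> 2"
  using defect_le_low[OF a b] low_le_2[OF a b] by linarith

text \<open>The defect shrinks as the upper level grows, so maximality of \<alpha> y bounds it below
  by the defect of \<open>x\<close> and \<open>y\<close>. With the upper bound 2 only a few levels
  remain outside \<open>N a\<close>.\<close>

lemma Q_level: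
  assumes a: "a \<in> V" "\<alpha> a = \<alpha> x" and b: "b \<in> V" "b \<notin> N a" "\<alpha> b \<noteq> \<alpha> x"
  shows "\<alpha> x < \<alpha> b" "\<alpha> x * (\<alpha> b - \<alpha> x) = t - real (card (N a - N b))"
    "card (N x - N y) \<le> card (N a - N b)" "card (N a - N b) \<le> 2"
proof -
  show less: "\<alpha> x < \<alpha> b" using level_ge[OF a b(1,2)] b(3) by simp
  show 1: "\<alpha> x * (\<alpha> b - \<alpha> x) = t - real (card (N a - N b))"
    by (rule card_above(1)[OF a b(1,2) less])
  have "\<alpha> x * (\<alpha> b - \<alpha> x) \<le> \<alpha> x * (\<alpha> y - \<alpha> x)"
    using level_le[OF a b(1,2)] pos[OF xV] by (intro mult_left_mono) auto
  then show "card (N x - N y) \<le> card (N a - N b)"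
    using 1 card_above(1)[OF xV refl yV xy_nonadj xy_less] by simp
  show "card (N a - N b) \<le> 2" by (rule defect_le_2[OF a b(1,2) less])
qed

text \<open>For each pair \<open>m\<close>, \<open>j\<close> this is a cubic inequality in \<tau>
  with leading coefficient \<open>m - j > 0\<close>; facts 1 and 2 reduce it to linear arithmetic in
  the monomials. The 28 is \<open>30 - 2\<close>, as \<tau> is \<open>t - j\<close> in the
  application.\<close>

lemma small_cases:
  fixes \<tau> :: real and m j :: nat
  assumes m: "1 \<le> m" "m \<le> 6" and j: "j \<le> 2" "j < m" and \<tau>: "28 \<le> \<tau>"
    and le: "\<tau> * ((real m - real j) * ((2 * real m + \<tau>)\<^sup>2 - 2 * (\<tau> + real j) * real m + real m))
      \<le> 2 * real m * (real m + \<tau>)\<^sup>2 + (\<tau> * (2 * real m + \<tau>) + real j * real m) * (real m + 2 - real j)\<^sup>2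
        + real m * (\<tau> + real j) * \<tau>"
  shows False
proof -
  have 1: "28 * \<tau> \<le> \<tau> * \<tau>" using \<tau> by (intro mult_right_mono) auto
  then have 2: "28 * (\<tau> * \<tau>) \<le> \<tau> * (\<tau> * \<tau>)" using \<tau> by (intro mult_right_mono) auto
  have "m \<in> {1, 2, 3, 4, 5, 6}" "j \<in> {0, 1, 2}" using m j by auto
  then show False
    using le j 1 2 \<tau> by (elim insertE emptyE) (simp_all add: power2_eq_square algebra_simps)
qed

lemma M_nat: obtains m :: nat where "(\<alpha> x)\<^sup>2 = real m" "1 \<le> m" "m \<le> 6"
proof -
  obtain i where i: "(\<alpha> x)\<^sup>2 = of_int i" using M_int by (auto elim: Ints_cases)
  have "0 < (\<alpha> x)\<^sup>2" using pos[OF xV] by simp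
  then have "0 < i" "i < 7" using i mid_min_level by simp_all
  then show ?thesis using that[of "nat i"] i by simp
qed

text \<open>About \<open>k = \<alpha> x + \<alpha> y\<close> the moment of Q is small: apart from at
  most two low vertices, \<open>\<alpha> x * (k - \<alpha> q)\<close> lies between 0 and
  \<open>m + 2 - j\<close>. Unless \<open>m <= j\<close>, the term \<open>- (m - j) k^2\<close> then
  dominates \<open>moment_identity\<close>.\<close>

lemma M_le_defect: "(\<alpha> x)\<^sup>2 \<le> real (card (N x - N y))"
proof (rule ccontr)
  obtain m where m: "(\<alpha> x)\<^sup>2 = real m" "1 \<le> m" "m \<le> 6" using M_nat .
  define j where "j = card (N x - N y)"
  assume "\<not> ?thesis"
  then have jm: "j < m" using m by (simp add: j_def)
  have j2: "j \<le> 2" unfolding j_def by (rule defect_le_2[OF xV refl yV xy_nonadj xy_less])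
  have ax: "\<alpha> x > 0" by (rule pos[OF xV])
  define \<tau> k n where "\<tau> = t - real j" and "k = \<alpha> x + \<alpha> y" and "n = real (card (N y - N x))"
  have muD: "\<alpha> x * (\<alpha> y - \<alpha> x) = \<tau>"
    using card_above(1)[OF xV refl yV xy_nonadj xy_less] by (simp add: \<tau>_def j_def)
  have muL: "\<alpha> x * \<alpha> y = real m + \<tau>"
    using muD m(1) by (simp add: power2_eq_square algebra_simps)
  have muk: "\<alpha> x * k = 2 * real m + \<tau>"
    using muL m(1) by (simp add: k_def power2_eq_square algebra_simps)
  have n: "real m * n = \<tau> * (2 * real m + \<tau>) + real j * real m"
  proof -
    have n': "n = t + \<alpha> y * (\<alpha> y - \<alpha> x)" unfolding n_def by (rule card_diff'[OF xy4])
    have "real m * n = real m * t + (\<alpha> x * \<alpha> y) * (\<alpha> x * (\<alpha> y - \<alpha> x))"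
      unfolding n' m(1)[symmetric] by (simp add: power2_eq_square algebra_simps)
    then show ?thesis unfolding muL muD by (simp add: \<tau>_def algebra_simps)
  qed
  let ?Q = "N y - N x" and ?c = "(real m + 2 - real j)\<^sup>2"
  let ?Z = "{q \<in> ?Q. \<alpha> q = \<alpha> x}"
  have cZ: "card ?Z \<le> 2"
  proof -
    have "card ?Z \<le> card {z \<in> N y. \<alpha> z = \<alpha> x}" by (intro card_mono) auto
    then show ?thesis using low_le_2[OF xV refl yV xy_nonadj xy_less] by linarith
  qed
  have "real m * mom k ?Q = (\<Sum>q\<in>?Q. (\<alpha> x * (\<alpha> q - k))\<^sup>2)"
    by (simp add: mom_def sum_distrib_left power_mult_distrib m(1))
  also have "\<dots> \<le> (\<Sum>q\<in>?Q. (if \<alpha> q = \<alpha> x then (real m + \<tau>)\<^sup>2 else 0) + ?c)"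
  proof (rule sum_mono)
    fix q assume q: "q \<in> ?Q"
    note qV = Q_memD[OF q yV xy_nonadj]
    show "(\<alpha> x * (\<alpha> q - k))\<^sup>2 \<le> (if \<alpha> q = \<alpha> x then (real m + \<tau>)\<^sup>2 else 0) + ?c"
    proof (cases "\<alpha> q = \<alpha> x")
      case True
      then have "\<alpha> x * (\<alpha> q - k) = - (real m + \<tau>)"
        using muL by (simp add: k_def algebra_simps)
      then have "(\<alpha> x * (\<alpha> q - k))\<^sup>2 = (real m + \<tau>)\<^sup>2" by (simp only: power2_minus)
      then show ?thesis using True by simp
    next
      case False
      note lev = Q_level[OF xV refl qV(1,2) False]
      have "\<alpha> x * (k - \<alpha> q) = real m + (real (card (N x - N q)) - real j)"
        using lev(2) muk m(1) by (simp add: \<tau>_def power2_eq_square algebra_simps)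
      then have "0 \<le> \<alpha> x * (k - \<alpha> q)" "\<alpha> x * (k - \<alpha> q) \<le> real m + 2 - real j"
        using lev(3,4) by (simp_all add: j_def)
      then have "(\<alpha> x * (k - \<alpha> q))\<^sup>2 \<le> ?c" by (intro power_mono) auto
      moreover have "(\<alpha> x * (k - \<alpha> q))\<^sup>2 = (\<alpha> x * (\<alpha> q - k))\<^sup>2"
        by (simp add: power_mult_distrib power2_commute)
      ultimately show ?thesis using False by simp
    qed
  qed
  also have "\<dots> = real (card ?Z) * (real m + \<tau>)\<^sup>2 + n * ?c"
    by (simp add: sum.distrib n_def sum.inter_filter[symmetric])
  also have "\<dots> \<le> 2 * (real m + \<tau>)\<^sup>2 + n * ?c"
    using cZ by (intro add_right_mono mult_right_mono) auto
  finally have mQ: "real m * mom k ?Q \<le> 2 * (real m + \<tau>)\<^sup>2 + n * ?c" .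
  have D0: "\<alpha> y - \<alpha> x > 0" using xy_less by simp
  have "0 \<le> (\<alpha> y - \<alpha> x) * mom k (N x)" using D0 mom_nonneg by simp
  also have "\<dots> \<le> \<alpha> x * mom k ?Q + (\<alpha> y - \<alpha> x) * ((real m - real j) * (2 * t - 1 - k\<^sup>2) + t)"
    unfolding moment_identity[OF xy4, of k] m(1) j_def
    using ax mom_nonneg[of k "N x - N y"] by (simp add: algebra_simps)
  \<comment> \<open>The factor \<open>m * \<alpha> x\<close> combines the levels into
    \<open>(\<alpha> x)^2\<close>, \<open>\<alpha> x * k\<close> and
    \<open>\<alpha> x * (\<alpha> y - \<alpha> x)\<close>, all polynomial in \<open>m\<close>,
    \<open>j\<close> and \<open>t\<close>.\<close>
  finally have "0 \<le> (real m * \<alpha> x) * (\<alpha> x * mom k ?Q + (\<alpha> y - \<alpha> x) * ((real m - real j) * (2 * t - 1 - k\<^sup>2) + t))"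
    using ax by (intro mult_nonneg_nonneg) auto
  also have "\<dots> = (\<alpha> x)\<^sup>2 * (real m * mom k ?Q)
      + (\<alpha> x * (\<alpha> y - \<alpha> x)) * ((real m - real j) * (real m * (2 * t - 1) - real m * k\<^sup>2) + real m * t)"
    by (simp add: power2_eq_square algebra_simps)
  also have "real m * k\<^sup>2 = (\<alpha> x * k)\<^sup>2" by (simp add: power_mult_distrib m(1))
  also have "\<dots> = (2 * real m + \<tau>)\<^sup>2" unfolding muk ..
  also have "(\<alpha> x)\<^sup>2 * (real m * mom k ?Q) \<le> real m * (2 * (real m + \<tau>)\<^sup>2 + n * ?c)"
    unfolding m(1) by (intro mult_left_mono mQ) simp
  also have "real m * (2 * (real m + \<tau>)\<^sup>2 + n * ?c) = 2 * real m * (real m + \<tau>)\<^sup>2 + (real m * n) * ?c"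
    by (simp add: algebra_simps)
  finally have main: "0 \<le> 2 * real m * (real m + \<tau>)\<^sup>2 + (\<tau> * (2 * real m + \<tau>) + real j * real m) * ?c
      + \<tau> * ((real m - real j) * (real m * (2 * t - 1) - (2 * real m + \<tau>)\<^sup>2) + real m * t)"
    unfolding n muD by simp
  have t\<tau>: "t = \<tau> + real j" by (simp add: \<tau>_def)
  show False
  proof (rule small_cases[OF m(2,3) j2 jm])
    show "28 \<le> \<tau>" using t_ge j2 by (simp add: \<tau>_def)
    have eq: "\<tau> * ((real m - real j) * (real m * (2 * t - 1) - (2 * real m + \<tau>)\<^sup>2) + real m * t)
      = real m * (\<tau> + real j) * \<tau>
        - \<tau> * ((real m - real j) * ((2 * real m + \<tau>)\<^sup>2 - 2 * (\<tau> + real j) * real m + real m))"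
      unfolding t\<tau> by (simp add: algebra_simps)
    show "\<tau> * ((real m - real j) * ((2 * real m + \<tau>)\<^sup>2 - 2 * (\<tau> + real j) * real m + real m))
      \<le> 2 * real m * (real m + \<tau>)\<^sup>2 + (\<tau> * (2 * real m + \<tau>) + real j * real m) * (real m + 2 - real j)\<^sup>2
        + real m * (\<tau> + real j) * \<tau>"
      using main unfolding eq by linarith
  qed
qed

text \<open>For defect 2, every level outside the neighbourhood of a low vertex is \<alpha> x or
  \<alpha> y. This bounds \<open>s\<close> twice: above by \<open>sum_level_diff\<close>, below by
  the eigenvector equation at \<open>x\<close> split along a low non-neighbour
  \<open>z\<close>.\<close>

lemma defect_ne_2: "card (N x - N y) \<noteq> 2"
proof
  assume j2: "card (N x - N y) = 2"
  obtain m where m: "(\<alpha> x)\<^sup>2 = real m" "1 \<le> m" "m \<le> 6" using M_nat .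
  have m2: "m \<in> {1, 2}" using M_le_defect m(1,2) j2 by auto
  have ax: "\<alpha> x > 0" by (rule pos[OF xV])
  let ?D = "\<alpha> y - \<alpha> x" and ?Q = "N y - N x" and ?P = "N x - N y"
  have D0: "?D > 0" using xy_less by simp
  have muD: "\<alpha> x * ?D = t - 2"
    using card_above(1)[OF xV refl yV xy_nonadj xy_less] j2 by simp
  have muL: "\<alpha> x * \<alpha> y = real m + t - 2"
    using muD m(1) by (simp add: power2_eq_square algebra_simps)
  have lev: "\<alpha> b = \<alpha> y" if ab: "a \<in> V" "\<alpha> a = \<alpha> x" "b \<in> V" "b \<notin> N a" "\<alpha> b \<noteq> \<alpha> x" for a b
  proof -
    have "card (N a - N b) = 2" using Q_level(3,4)[OF ab] j2 by simp
    then have "\<alpha> x * (\<alpha> b - \<alpha> x) = \<alpha> x * ?D" using Q_level(2)[OF ab] muD by simp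
    then show ?thesis using ax by simp
  qed
  have P2: "2 \<le> card ?P" using j2 by simp
  obtain p1 where p1: "p1 \<in> ?P" "p1 \<noteq> x" using ex_other[OF P2] .
  note p1 = p1(1)
  obtain p2 where p2: "p2 \<in> ?P" "p2 \<noteq> p1" using ex_other[OF P2] .
  have Plev: "\<alpha> p = \<alpha> y" if "p \<in> ?P" for p
    by (rule matched_low(1)[OF xV refl yV xy_nonadj xy_less P2 that])
  obtain z where z: "z \<in> ?Q" "z \<notin> N p1" "\<alpha> z = \<alpha> x"
    using matched_low(2)[OF xV refl yV xy_nonadj xy_less P2 p1] by blast
  note zV = Q_memD[OF z(1) yV xy_nonadj]
  have "real (card ?Q) \<ge> t" using card_Q_gt[OF xy4] xy_less by simp
  then have "2 \<le> card ?Q" using t_ge by linarith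
  then obtain z' where z': "z' \<in> ?Q" "z' \<noteq> z" by (rule ex_other)
  have zp2: "z \<in> N p2" by (rule matching(1)[OF xy4 p1 z(1,2) p2 z'])
  have "(\<Sum>q\<in>?Q. \<alpha> q) \<le> (\<Sum>q\<in>?Q. \<alpha> y - (if q = z then ?D else 0))"
  proof (rule sum_mono)
    fix q assume q: "q \<in> ?Q"
    have "\<alpha> q \<le> \<alpha> y" using level_le[OF xV refl] Q_memD[OF q yV xy_nonadj] by blast
    then show "\<alpha> q \<le> \<alpha> y - (if q = z then ?D else 0)" using z(3) by simp
  qed
  also have "\<dots> = \<alpha> y * real (card ?Q) - ?D"
    using z(1) by (simp add: sum_subtractf mult.commute)
  also have "real (card ?Q) = t + \<alpha> y * ?D" by (rule card_diff'[OF xy4])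
  finally have Q: "(\<Sum>q\<in>?Q. \<alpha> q) \<le> \<alpha> y * (t + \<alpha> y * ?D) - ?D" .
  have "(\<Sum>p\<in>?P. \<alpha> p) = (\<Sum>p\<in>?P. \<alpha> y)" by (rule sum.cong) (auto simp: Plev)
  then have P: "(\<Sum>p\<in>?P. \<alpha> p) = 2 * \<alpha> y" using j2 by simp
  have "s * ?D \<le> \<alpha> y * (t + \<alpha> y * ?D) - ?D - 2 * \<alpha> y"
    using sum_level_diff[OF xV yV] Q P by simp
  also have "\<dots> = \<alpha> y * (\<alpha> x * ?D) + \<alpha> y * \<alpha> y * ?D - ?D" unfolding muD by (simp add: algebra_simps)
  also have "\<dots> = (\<alpha> y * (\<alpha> x + \<alpha> y) - 1) * ?D" by (simp add: algebra_simps)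
  finally have "s \<le> \<alpha> y * (\<alpha> x + \<alpha> y) - 1" using D0 by simp
  then have "(\<alpha> x)\<^sup>2 * s \<le> (\<alpha> x)\<^sup>2 * (\<alpha> y * (\<alpha> x + \<alpha> y) - 1)" by (intro mult_left_mono) auto
  also have "\<dots> = (\<alpha> x * \<alpha> y) * ((\<alpha> x)\<^sup>2 + \<alpha> x * \<alpha> y) - (\<alpha> x)\<^sup>2"
    by (simp add: power2_eq_square algebra_simps)
  finally have upper: "real m * s \<le> (real m + t - 2) * (real m + (real m + t - 2)) - real m"
    unfolding m(1) muL .
  have xz: "x \<noteq> z" "z \<notin> N x" using zV by auto
  let ?C = "N x \<inter> N z"
  have cC: "real (card ?C) = real m"
    using common_nonadj[OF xV zV(1) xz] z(3) m(1) by (simp add: power2_eq_square)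
  \<comment> \<open>The exact level of \<open>p2\<close> matters: with \<open>adj_ge\<close> alone
    the two bounds would coincide for \<open>m = 2\<close>.\<close>
  have p2C: "p2 \<in> ?C" using p2 zp2 nb_sym by blast
  have "(\<Sum>c\<in>N x - N z. \<alpha> x * \<alpha> c) = (\<Sum>c\<in>N x - N z. \<alpha> x * \<alpha> y)"
  proof (rule sum.cong[OF refl])
    fix c assume c: "c \<in> N x - N z"
    have "\<alpha> c \<noteq> \<alpha> x" using low_nonadj[of x c] c by auto
    then have "\<alpha> c = \<alpha> y" using lev[OF zV(1) z(3), of c] c nbV[of c x] by auto
    then show "\<alpha> x * \<alpha> c = \<alpha> x * \<alpha> y" by simp
  qed
  also have "\<dots> = t * (real m + t - 2)"
    using card_diff[OF xV zV(1) xz] z(3) muL by simp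
  finally have S1: "(\<Sum>c\<in>N x - N z. \<alpha> x * \<alpha> c) = t * (real m + t - 2)" .
  have adj_ge: "t - 1 \<le> \<alpha> x * \<alpha> c" if "c \<in> N x" for c
    using common_adj[OF that] by (smt (verit) of_nat_0_le_iff)
  have "(\<Sum>c\<in>?C. \<alpha> x * \<alpha> c) = \<alpha> x * \<alpha> p2 + (\<Sum>c\<in>?C - {p2}. \<alpha> x * \<alpha> c)"
    using p2C by (subst sum.remove[of _ p2]) auto
  also have "\<alpha> x * \<alpha> p2 = real m + t - 2" using Plev[OF p2(1)] muL by simp
  finally have "(\<Sum>c\<in>?C. \<alpha> x * \<alpha> c) = real m + t - 2 + (\<Sum>c\<in>?C - {p2}. \<alpha> x * \<alpha> c)" .
  moreover have "(\<Sum>c\<in>?C - {p2}. t - 1) \<le> (\<Sum>c\<in>?C - {p2}. \<alpha> x * \<alpha> c)"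
    by (rule sum_mono) (use adj_ge in auto)
  ultimately have "(\<Sum>c\<in>?C. \<alpha> x * \<alpha> c) \<ge> real m + t - 2 + real (card (?C - {p2})) * (t - 1)"
    by simp
  moreover have "card (?C - {p2}) = m - 1" using p2C cC by simp
  ultimately have S2: "(\<Sum>c\<in>?C. \<alpha> x * \<alpha> c) \<ge> real m + t - 2 + (real m - 1) * (t - 1)"
    using m(2) by (simp add: of_nat_diff)
  have "real m * s = \<alpha> x * (\<Sum>c\<in>N x. \<alpha> c)"
    using eig[OF xV] m(1) by (simp add: power2_eq_square)
  also have "\<dots> = (\<Sum>c\<in>N x. \<alpha> x * \<alpha> c)" by (rule sum_distrib_left)
  also have "\<dots> = (\<Sum>c\<in>?C. \<alpha> x * \<alpha> c) + (\<Sum>c\<in>N x - N z. \<alpha> x * \<alpha> c)"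
    by (rule sum.Int_Diff) simp
  finally have "real m * s \<ge> real m + t - 2 + (real m - 1) * (t - 1) + t * (real m + t - 2)"
    using S1 S2 by simp
  then have "real m + t - 2 + (real m - 1) * (t - 1) + t * (real m + t - 2)
      \<le> (real m + t - 2) * (real m + (real m + t - 2)) - real m" using upper by linarith
  then show False using m2 t_ge by (auto simp: algebra_simps)
qed

lemma unit_level: "\<alpha> x = 1" "card (N x - N y) = 1"
proof -
  obtain m where m: "(\<alpha> x)\<^sup>2 = real m" "1 \<le> m" "m \<le> 6" using M_nat .
  have "card (N x - N y) \<le> 1"
    using defect_ne_2 defect_le_2[OF xV refl yV xy_nonadj xy_less] by linarith
  moreover have "m \<le> card (N x - N y)" using M_le_defect m(1) by simp
  ultimately have *: "m = 1" "card (N x - N y) = 1" using m(2) by linarith+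
  then show "card (N x - N y) = 1" by simp
  have "(\<alpha> x)\<^sup>2 = 1" using m(1) * by simp
  then show "\<alpha> x = 1" using pos[OF xV] by (simp add: power2_eq_1_iff)
qed

section \<open>Extremal pairs of levels 1 and t\<close>

lemma top_level: "\<alpha> y = t"
  using card_above(1)[OF xV refl yV xy_nonadj xy_less] unit_level by simp

lemma unit_nonadj_level:
  assumes "a \<in> V" "\<alpha> a = 1" "b \<in> V" "b \<notin> N a" "\<alpha> b \<noteq> 1"
  shows "\<alpha> b = t \<or> \<alpha> b = t - 1 \<and> card (N a - N b) = 2"
proof -
  have a: "\<alpha> a = \<alpha> x" "\<alpha> b \<noteq> \<alpha> x" using assms unit_level(1) by simp_all
  note lev = Q_level[OF assms(1) a(1) assms(3,4) a(2)]
  have "card (N a - N b) = 1 \<or> card (N a - N b) = 2" using lev(3,4) unit_level(2) by linarith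
  then show ?thesis using lev(2) unit_level(1) by auto
qed

lemma nb_level: "c \<in> N x \<Longrightarrow> \<alpha> c = t - 1 + real (card (N x \<inter> N c))"
  using common_adj[of c x] unit_level(1) by simp

lemma defect_level:
  assumes b: "b \<in> V" "b \<notin> N x" "\<alpha> b = t" and p: "p \<in> N x - N b"
  shows "\<alpha> p = t - 1 \<or> \<alpha> p = t"
proof -
  have xb: "b \<noteq> x" using b(3) unit_level(1) t_ge by auto
  have "(\<alpha> p - t) * (1 - t) \<ge> -1"
    using level_formula[OF b(1) xV xb nonadj_sym[OF b(2)] p] b(3) unit_level(1) by simp
  then have 1: "(\<alpha> p - t) * (t - 1) \<le> 1" by (simp add: algebra_simps)
  have lev: "\<alpha> p = t - 1 + real (card (N x \<inter> N p))" using nb_level[of p] p by simp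
  have "card (N x \<inter> N p) < 2"
  proof (rule ccontr)
    assume "\<not> ?thesis"
    then have "1 \<le> \<alpha> p - t" using lev by simp
    then have "1 * (t - 1) \<le> (\<alpha> p - t) * (t - 1)" using t_ge by (intro mult_right_mono) auto
    then have "1 * (t - 1) \<le> 1" using 1 by (rule order_trans)
    then show False using t_ge by simp
  qed
  then have "card (N x \<inter> N p) = 0 \<or> card (N x \<inter> N p) = 1" by linarith
  then show ?thesis using lev by auto
qed

lemma card_unit_Q:
  assumes "b \<in> V" "b \<notin> N x" "\<alpha> b = t"
  shows "real (card (N b - N x)) = t * t"
proof -
  have xb: "x \<noteq> b" using assms(3) unit_level(1) t_ge by auto
  show ?thesis
    using card_diff'[OF xV assms(1) xb assms(2)] assms(3) unit_level(1) by (simp add: algebra_simps)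
qed

lemma card_unit_P:
  assumes "b \<in> V" "b \<notin> N x" "\<alpha> b = t"
  shows "card (N x - N b) = 1"
proof -
  have xb: "x \<noteq> b" using assms(3) unit_level(1) t_ge by auto
  have "real (card (N x - N b)) = 1"
    using card_diff[OF xV assms(1) xb assms(2)] assms(3) unit_level(1) by simp
  then show ?thesis by simp
qed

lemma sum_nb_unit: "(\<Sum>c\<in>N x. \<alpha> c) = s"
  using eig[OF xV] unit_level(1) by simp

lemma s_int: "s \<in> \<int>"
proof -
  have "\<alpha> c \<in> \<int>" if "c \<in> N x" for c using nb_level[OF that] t_int by simp
  then have "(\<Sum>c\<in>N x. \<alpha> c) \<in> \<int>" by (rule Ints_sum)
  then show ?thesis using sum_nb_unit by simp
qed

text \<open>Otherwise every further non-neighbour of \<open>x\<close> has level \<open>t\<close>,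
  because level \<open>t - 1\<close> would supply two neighbours of level 1. First moments then give
  \<open>s = t^2 + t\<close> and level \<open>t\<close> on all of \<open>N x\<close>; all moments
  about \<open>t\<close> in \<open>moment_identity\<close> vanish, which leaves
  \<open>(t - 1) t = 0\<close>.\<close>

lemma ex_unit_nonneighbour: "\<exists>z\<in>V. z \<noteq> x \<and> z \<notin> N x \<and> \<alpha> z = 1"
proof (rule ccontr)
  assume "\<not> ?thesis"
  then have none: "\<alpha> b \<noteq> 1" if "b \<in> V" "b \<noteq> x" "b \<notin> N x" for b using that by blast
  have top: "\<alpha> b = t" if b: "b \<in> V" "b \<noteq> x" "b \<notin> N x" for b
  proof (rule ccontr)
    assume "\<alpha> b \<noteq> t"
    then have c2: "card (N x - N b) = 2"
      using unit_nonadj_level[OF xV unit_level(1) b(1,3) none[OF b]] by blast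
    have "\<alpha> x < \<alpha> b" using Q_level(1)[OF xV refl b(1,3)] none[OF b] unit_level(1) by simp
    then have "2 \<le> card {z \<in> N b. \<alpha> z = \<alpha> x}"
      using defect_le_low[OF xV refl b(1,3)] c2 by simp
    then obtain z where z: "z \<in> {z \<in> N b. \<alpha> z = \<alpha> x}" "z \<noteq> x" by (rule ex_other)
    then have zV: "z \<in> V" "\<alpha> z = \<alpha> x" using nbV[of z b] by auto
    show False
      using none[OF zV(1) z(2) low_nonadj[OF refl zV(2)]] zV(2) unit_level(1) by simp
  qed
  have defect: "\<alpha> p = t \<and> s = t * t + t" if b: "b \<in> V" "b \<noteq> x" "b \<notin> N x" and p: "p \<in> N x - N b" for b p
  proof -
    have bt: "\<alpha> b = t" by (rule top[OF b])
    have "card (N x - N b) = 1" by (rule card_unit_P[OF b(1,3) bt])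
    then obtain p0 where "N x - N b = {p0}" by (rule card_1_singletonE)
    then have P: "N x - N b = {p}" using p by auto
    have "(\<Sum>q\<in>N b - N x. \<alpha> q) = (\<Sum>q\<in>N b - N x. t)"
    proof (rule sum.cong[OF refl])
      fix q assume "q \<in> N b - N x"
      then show "\<alpha> q = t" using top Q_memD[OF _ b(1,3)] by blast
    qed
    also have "\<dots> = t * t * t" using card_unit_Q[OF b(1,3) bt] by simp
    finally have "t * t * t - \<alpha> p = s * (t - 1)"
      using sum_level_diff[OF xV b(1)] P bt unit_level(1) by simp
    then have eq: "(s - t * t - t) * (t - 1) = t - \<alpha> p" by (simp add: algebra_simps)
    show ?thesis
    proof (cases "\<alpha> p = t")
      case True
      then have "s - t * t - t = 0" using eq t_ge by simp
      then show ?thesis using True by simp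
    next
      case False
      \<comment> \<open>Level \<open>t - 1\<close> of \<open>p\<close> would make the integer
        \<open>s - t^2 - t\<close> equal to \<open>1 / (t - 1)\<close>.\<close>
      then have one: "(s - t * t - t) * (t - 1) = 1" using eq defect_level[OF b(1,3) bt p] by simp
      have "s - t * t - t \<in> \<int>" using s_int t_int by simp
      then obtain i where i: "s - t * t - t = of_int i" by (auto elim: Ints_cases)
      have "i > 0"
      proof (rule ccontr)
        assume "\<not> i > 0"
        then have "real_of_int i * (t - 1) \<le> 0" using t_ge by (intro mult_nonpos_nonneg) auto
        then show False using one i by simp
      qed
      then have "1 * (t - 1) \<le> real_of_int i * (t - 1)" using t_ge by (intro mult_right_mono) auto
      then have "t - 1 \<le> 1" using one i by simp
      then show ?thesis using t_ge by linarith
    qed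
  qed
  have yx: "y \<noteq> x" using xy_ne by simp
  obtain p0 where p0: "N x - N y = {p0}" using unit_level(2) by (rule card_1_singletonE)
  then have "p0 \<in> N x - N y" by simp
  then have s_eq: "s = t * t + t" using defect[OF yV yx xy_nonadj] by blast
  define W where "W = V - N x - {x}"
  \<comment> \<open>Such a neighbour of \<open>x\<close> is joined to all of \<open>W\<close>, so
    its valency gives a quadratic equation for its level. The roots add up to 1, so only one is
    admissible.\<close>
  have full: "(\<alpha> c)\<^sup>2 - \<alpha> c = real (card W) + 2 - 2 * t" if c: "c \<in> N x" "\<alpha> c \<noteq> t" for c
  proof -
    have cV: "c \<in> V" using nbV[OF c(1)] by simp
    have "W \<subseteq> N c"
    proof
      fix b assume "b \<in> W"
      then have b: "b \<in> V" "b \<noteq> x" "b \<notin> N x" by (auto simp: W_def)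
      show "b \<in> N c"
      proof (rule ccontr)
        assume "b \<notin> N c"
        then have "c \<in> N x - N b" using c(1) nonadj_sym by simp
        then show False using defect[OF b] c(2) by blast
      qed
    qed
    then have eqN: "N c - N x = insert x W"
      using NV[of c] c(1) nb_sym[of c x] nb_irr[of x] by (auto simp: W_def)
    have "real (card (N c)) = real (card (N c \<inter> N x)) + real (card (N c - N x))"
      by (rule card_split) simp
    moreover have "card (insert x W) = card W + 1"
      by (subst card_insert_disjoint) (auto simp: W_def finV)
    ultimately show ?thesis
      using deg[OF cV] common_adj[OF c(1)] unit_level(1) by (simp add: eqN Int_commute)
  qed
  have same: "\<alpha> c = \<alpha> c'" if c: "c \<in> N x" "\<alpha> c \<noteq> t" "c' \<in> N x" "\<alpha> c' \<noteq> t" for c c'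
  proof -
    have "(\<alpha> c - \<alpha> c') * (\<alpha> c + \<alpha> c' - 1) = 0"
      using full[OF c(1,2)] full[OF c(3,4)] by (simp add: power2_eq_square algebra_simps)
    moreover have "\<alpha> c + \<alpha> c' - 1 \<noteq> 0" using nb_level[OF c(1)] nb_level[OF c(3)] t_ge by simp
    ultimately show ?thesis by simp
  qed
  have all_t: "\<alpha> c0 = t" if c0: "c0 \<in> N x" for c0
  proof (rule ccontr)
    assume ne: "\<alpha> c0 \<noteq> t"
    have "(\<Sum>c\<in>N x. (\<alpha> c - t) * (\<alpha> c0 - t)) = (s - t * (1 + t)) * (\<alpha> c0 - t)"
      using sum_nb_unit deg[OF xV] unit_level(1)
      by (simp add: sum_distrib_right[symmetric] sum_subtractf mult.commute)
    then have "(\<Sum>c\<in>N x. (\<alpha> c - t) * (\<alpha> c0 - t)) = 0" by (simp add: s_eq algebra_simps)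
    moreover have "0 \<le> (\<alpha> c - t) * (\<alpha> c0 - t)" if "c \<in> N x" for c
      using same[OF that _ c0 ne] by (cases "\<alpha> c = t") auto
    ultimately have "(\<alpha> c0 - t) * (\<alpha> c0 - t) = 0"
      using c0 by (auto simp: sum_nonneg_eq_0_iff)
    then show False using ne by simp
  qed
  have "mom t (N x) = 0" "mom t (N x - N y) = 0" using all_t by (simp_all add: mom_def)
  moreover have "mom t (N y - N x) = 0"
    unfolding mom_def
  proof (rule sum.neutral, rule ballI)
    fix q assume "q \<in> N y - N x"
    then have "\<alpha> q = t" using top Q_memD[OF _ yV xy_nonadj] by blast
    then show "(\<alpha> q - t)\<^sup>2 = 0" by simp
  qed
  ultimately have "(t - 1) * t = 0"
    using moment_identity[OF xy4, of t] unit_level top_level by simp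
  then show False using t_ge by simp
qed

text \<open>The second vertex \<open>z\<close> of level 1 has a single common neighbour
  \<open>c\<close> with \<open>x\<close>; the other neighbours of \<open>x\<close> have level
  \<open>t - 1\<close> or \<open>t\<close>. Second moments force \<open>g > 1\<close>, so
  \<open>c\<close> is joined to every vertex of level 1, and first moments then force
  \<open>g (t - 1) <= 1\<close>.\<close>

lemma contradiction: False
proof -
  obtain z where z: "z \<in> V" "z \<noteq> x" "z \<notin> N x" "\<alpha> z = 1" using ex_unit_nonneighbour by blast
  have zx: "\<alpha> z = \<alpha> x" "x \<noteq> z" using z unit_level(1) by auto
  have "real (card (N x \<inter> N z)) = 1"
    using common_nonadj[OF xV z(1) zx(2) z(3)] z(4) unit_level(1) by simp
  then have "card (N x \<inter> N z) = 1" by simp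
  then obtain c where c: "N x \<inter> N z = {c}" by (rule card_1_singletonE)
  then have cN: "c \<in> N x" "c \<in> N z" by auto
  obtain p where p: "N x - N y = {p}" using unit_level(2) by (rule card_1_singletonE)
  \<comment> \<open>About \<open>t + 1\<close> the square \<open>(\<alpha> w - k)^2\<close> agrees
    with \<open>1 + 3 t - 3 \<alpha> w\<close> at both levels \<open>t - 1\<close> and
    \<open>t\<close>, so second moments reduce to sums of levels. At level 1 the excess is
    \<open>(t - 1) (t - 2)\<close>.\<close>
  define k g k0 where "k = t + 1" and "g = \<alpha> c - t" and "k0 = real (card {q \<in> N y - N x. \<alpha> q = 1})"
  let ?R = "N x - N z" and ?Q = "N y - N x"
  have R_lev: "\<alpha> w = t \<or> \<alpha> w = t - 1" if w: "w \<in> ?R" for w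
  proof -
    have "\<alpha> w \<noteq> \<alpha> x" using low_nonadj[of x w] w by auto
    then show ?thesis
      using unit_nonadj_level[OF z(1,4), of w] w nbV[of w x] unit_level(1) by auto
  qed
  have cR: "real (card ?R) = t" using card_diff[OF xV z(1) zx(2) z(3)] zx(1) by simp
  have sR: "s = \<alpha> c + (\<Sum>w\<in>?R. \<alpha> w)"
    unfolding sum_nb_unit[symmetric] by (subst sum.Int_Diff[of _ _ "N z"]) (simp_all add: c)
  have "mom k ?R = (\<Sum>w\<in>?R. (1 + 3 * t) - 3 * \<alpha> w)"
    unfolding mom_def
  proof (rule sum.cong[OF refl])
    fix w assume "w \<in> ?R"
    from R_lev[OF this] show "(\<alpha> w - k)\<^sup>2 = (1 + 3 * t) - 3 * \<alpha> w" by (auto simp: k_def)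
  qed
  also have "\<dots> = t * (1 + 3 * t) - 3 * (s - \<alpha> c)"
    using cR sR by (simp add: sum_subtractf sum_distrib_left[symmetric])
  finally have mR: "mom k ?R = t * (1 + 3 * t) - 3 * (s - \<alpha> c)" .
  have "mom k (N x) = mom k (N x \<inter> N z) + mom k ?R"
    unfolding mom_def by (rule sum.Int_Diff) simp
  also have "mom k (N x \<inter> N z) = (g - 1)\<^sup>2" by (simp add: c mom_def k_def g_def algebra_simps)
  finally have mN: "mom k (N x) = (g - 1)\<^sup>2 + (t * (1 + 3 * t) - 3 * (s - \<alpha> c))" unfolding mR .
  have Q_lev: "\<alpha> q = 1 \<or> \<alpha> q = t \<or> \<alpha> q = t - 1" if "q \<in> ?Q" for q
    using unit_nonadj_level[OF xV unit_level(1)] Q_memD[OF that yV xy_nonadj] by blast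
  have "mom k ?Q = (\<Sum>q\<in>?Q. ((1 + 3 * t) - 3 * \<alpha> q) + (if \<alpha> q = 1 then (t - 1) * (t - 2) else 0))"
    unfolding mom_def
  proof (rule sum.cong[OF refl])
    fix q assume "q \<in> ?Q"
    from Q_lev[OF this] show "(\<alpha> q - k)\<^sup>2 = ((1 + 3 * t) - 3 * \<alpha> q) + (if \<alpha> q = 1 then (t - 1) * (t - 2) else 0)"
      using t_ge by (auto simp: k_def power2_eq_square algebra_simps)
  qed
  also have "\<dots> = t * t * (1 + 3 * t) - 3 * (\<Sum>q\<in>?Q. \<alpha> q) + k0 * ((t - 1) * (t - 2))"
    using card_unit_Q[OF yV xy_nonadj top_level]
    by (simp add: sum.distrib sum_subtractf sum_distrib_left[symmetric] sum.inter_filter[symmetric] k0_def)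
  finally have mQ: "mom k ?Q = t * t * (1 + 3 * t) - 3 * (\<Sum>q\<in>?Q. \<alpha> q) + k0 * ((t - 1) * (t - 2))" .
  have p_lev: "\<alpha> p = t - 1 \<or> \<alpha> p = t" by (rule defect_level[OF yV xy_nonadj top_level]) (simp add: p)
  then have mP: "mom k (N x - N y) = (1 + 3 * t) - 3 * \<alpha> p" by (auto simp: p mom_def k_def)
  have sQ: "(\<Sum>q\<in>?Q. \<alpha> q) = \<alpha> p + s * (t - 1)"
    using sum_level_diff[OF xV yV] p top_level unit_level(1) by simp
  have "(t - 1) * mom k (N x) = mom k ?Q - mom k (N x - N y) + (t - 1) * t"
    using moment_identity[OF xy4, of k] unit_level top_level by simp
  then have "(t - 1) * ((g - 1)\<^sup>2 + (t * (1 + 3 * t) - 3 * (s - \<alpha> c)))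
      = (t - 1) * ((t + 1) * (1 + 3 * t) - 3 * s + k0 * (t - 2) + t)"
    unfolding mN mQ mP sQ by (simp add: algebra_simps)
  then have "(g - 1)\<^sup>2 + (t * (1 + 3 * t) - 3 * (s - \<alpha> c)) = (t + 1) * (1 + 3 * t) - 3 * s + k0 * (t - 2) + t"
    using t_ge by simp
  then have g: "g * g + g = t + k0 * (t - 2)"
    by (simp add: g_def power2_eq_square algebra_simps)
  have "k0 * (t - 2) \<ge> 0" using t_ge by (simp add: k0_def)
  then have g30: "g * g + g \<ge> 30" using g t_ge by simp
  have "g \<ge> -1" using nb_level[OF cN(1)] by (simp add: g_def)
  have g1: "g > 1"
  proof (rule ccontr)
    assume "\<not> g > 1"
    then have "\<bar>g\<bar> \<le> 1" using \<open>g \<ge> -1\<close> by simp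
    then have "\<bar>g\<bar> * \<bar>g\<bar> \<le> 1 * 1" by (intro mult_mono) auto
    then have "g * g \<le> 1" by simp
    then show False using g30 \<open>\<not> g > 1\<close> by simp
  qed
  have c_univ: "c \<in> N w" if w: "w \<in> V" "\<alpha> w = 1" for w
  proof (rule ccontr)
    assume "c \<notin> N w"
    then have "\<alpha> c \<le> \<alpha> y"
      using level_le[OF w(1), of c] w(2) unit_level(1) nbV[OF cN(1)] by simp
    then show False using g1 top_level by (simp add: g_def)
  qed
  \<comment> \<open>Two vertices of level 1 have exactly one common neighbour, and \<open>c\<close>
    already is one.\<close>
  have unit_unique: "card {w \<in> N b. \<alpha> w = \<alpha> x} \<le> 1" if "b \<noteq> c" for b
  proof -
    have "w = w'" if w: "w \<in> {w \<in> N b. \<alpha> w = \<alpha> x}" "w' \<in> {w \<in> N b. \<alpha> w = \<alpha> x}" for w w'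
    proof (rule ccontr)
      assume ne: "w \<noteq> w'"
      have wV: "w \<in> V" "w' \<in> V" "\<alpha> w = 1" "\<alpha> w' = 1" "\<alpha> w = \<alpha> x" "\<alpha> w' = \<alpha> x"
        using w nbV[of w b] nbV[of w' b] unit_level(1) by auto
      have "real (card (N w \<inter> N w')) = 1"
        using common_nonadj[OF wV(1,2) ne low_nonadj[OF wV(5,6)]] wV by simp
      moreover have "{b, c} \<subseteq> N w \<inter> N w'"
        using c_univ[OF wV(1,3)] c_univ[OF wV(2,4)] w nb_sym by auto
      then have "card {b, c} \<le> card (N w \<inter> N w')" by (intro card_mono) auto
      then have "2 \<le> card (N w \<inter> N w')" using \<open>b \<noteq> c\<close> by simp
      ultimately show False by simp
    qed
    then show ?thesis by (simp add: card_le_Suc0_iff_eq)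
  qed
  have top: "\<alpha> b = t" if b: "a \<in> V" "\<alpha> a = 1" "b \<in> V" "b \<notin> N a" "\<alpha> b \<noteq> 1" for a b
  proof (rule ccontr)
    assume "\<alpha> b \<noteq> t"
    then have c2: "card (N a - N b) = 2" using unit_nonadj_level[OF b] by blast
    have a: "\<alpha> a = \<alpha> x" "\<alpha> b \<noteq> \<alpha> x" using b unit_level(1) by simp_all
    have less: "\<alpha> x < \<alpha> b" by (rule Q_level(1)[OF b(1) a(1) b(3,4) a(2)])
    have "2 \<le> card {w \<in> N b. \<alpha> w = \<alpha> x}"
      using defect_le_low[OF b(1) a(1) b(3,4) less] c2 by simp
    moreover have "b \<noteq> c" using c_univ[OF b(1,2)] b(4) by auto
    ultimately show False using unit_unique[of b] by simp
  qed
  have "(\<Sum>w\<in>?R. \<alpha> w) = (\<Sum>w\<in>?R. t)"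
  proof (rule sum.cong[OF refl])
    fix w assume w: "w \<in> ?R"
    have "\<alpha> w \<noteq> 1" using R_lev[OF w] t_ge by auto
    then show "\<alpha> w = t" using top[OF z(1,4), of w] w nbV[of w x] by auto
  qed
  then have s_eq: "s = t * t + t + g" using sR cR by (simp add: g_def)
  have "(\<Sum>q\<in>?Q. \<alpha> q) = (\<Sum>q\<in>?Q. t - (if \<alpha> q = 1 then t - 1 else 0))"
  proof (rule sum.cong[OF refl])
    fix q assume q: "q \<in> ?Q"
    show "\<alpha> q = t - (if \<alpha> q = 1 then t - 1 else 0)"
      using top[OF xV unit_level(1)] Q_memD[OF q yV xy_nonadj] by auto
  qed
  also have "\<dots> = t * t * t - k0 * (t - 1)"
    using card_unit_Q[OF yV xy_nonadj top_level]
    by (simp add: sum_subtractf sum.inter_filter[symmetric] k0_def)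
  finally have "t * t * t - k0 * (t - 1) = \<alpha> p + s * (t - 1)" using sQ by simp
  then have "g * (t - 1) + k0 * (t - 1) = t - \<alpha> p" unfolding s_eq by (simp add: algebra_simps)
  moreover have "k0 * (t - 1) \<ge> 0" using t_ge by (simp add: k0_def)
  moreover have "t - \<alpha> p \<le> 1" using p_lev by auto
  ultimately have "g * (t - 1) \<le> 1" by linarith
  moreover have "1 * (t - 1) \<le> g * (t - 1)" using g1 t_ge by (intro mult_right_mono) auto
  ultimately have "1 * (t - 1) \<le> 1" by (rule order_trans[rotated])
  then show False using t_ge by simp
qed

end

section \<open>Absence of non-adjacent vertices of different levels\<close>

context large_t
begin

lemma no_bad_pair:
  assumes "a \<in> V" "b \<in> V" "b \<notin> N a" "\<alpha> a < \<alpha> b"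
  shows False
proof -
  define S where "S = {(a, b). a \<in> V \<and> b \<in> V \<and> b \<notin> N a \<and> \<alpha> a < \<alpha> b}"
  have "S \<subseteq> V \<times> V" by (auto simp: S_def)
  then have finS: "finite S" using finV finite_subset by blast
  have neS: "S \<noteq> {}" using assms by (auto simp: S_def)
  define m where "m = Min ((\<lambda>(a, b). \<alpha> a) ` S)"
  define S' where "S' = {p \<in> S. \<alpha> (fst p) = m}"
  have "m \<in> (\<lambda>(a, b). \<alpha> a) ` S" unfolding m_def using finS neS by (intro Min_in) auto
  then have neS': "S' \<noteq> {}" by (auto simp: S'_def)
  have finS': "finite S'" using finS by (simp add: S'_def)
  have "Max ((\<lambda>p. \<alpha> (snd p)) ` S') \<in> (\<lambda>p. \<alpha> (snd p)) ` S'"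
    using finS' neS' by (intro Max_in) auto
  then obtain x y where xy: "(x, y) \<in> S'" "\<alpha> y = Max ((\<lambda>p. \<alpha> (snd p)) ` S')" by auto
  have xyS: "x \<in> V" "y \<in> V" "y \<notin> N x" "\<alpha> x < \<alpha> y" "\<alpha> x = m"
    using xy(1) by (auto simp: S'_def S_def)
  have "extremal_pair V N \<alpha> s t x y"
  proof unfold_locales
    fix a b assume ab: "a \<in> V" "b \<in> V" "b \<notin> N a" "\<alpha> a < \<alpha> b"
    then have "(a, b) \<in> S" by (simp add: S_def)
    then have "\<alpha> a \<in> (\<lambda>(a, b). \<alpha> a) ` S" by force
    then show "\<alpha> x \<le> \<alpha> a" using finS xyS(5) by (simp add: m_def)
  next
    fix a b assume ab: "a \<in> V" "b \<in> V" "b \<notin> N a" "\<alpha> a = \<alpha> x" "\<alpha> x < \<alpha> b"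
    then have "(a, b) \<in> S'" using xyS(5) by (simp add: S'_def S_def)
    then have "\<alpha> b \<in> (\<lambda>p. \<alpha> (snd p)) ` S'" by force
    then show "\<alpha> b \<le> \<alpha> y" using finS' xy(2) by simp
  qed (use xyS in auto)
  then show False by (rule extremal_pair.contradiction)
qed

lemma at_most_two_levels:
  assumes "x \<in> V" "y \<in> V" "z \<in> V" "\<alpha> x \<noteq> \<alpha> y" "\<alpha> y \<noteq> \<alpha> z" "\<alpha> x \<noteq> \<alpha> z"
  shows False
  using three_levels_bad_pair[OF assms] no_bad_pair by blast

end

section \<open>Integrality and the Perron vector\<close>

context three_ev
begin

text \<open>Squaring the count at an edge cancels \<open>t^2\<close>, so \<open>t\<close> is
  rational unless its coefficient vanishes at all edges, which would make all valencies 1. At a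
  non-adjacent pair the squared count is a monic integral quadratic in \<open>t\<close>, so the
  rational \<open>t\<close> is an integer.\<close>

lemma t_integer:
  assumes s0: "s > 0" and nonreg: "v0 \<in> V" "w0 \<in> V" "card (N v0) \<noteq> card (N w0)"
  shows "t \<in> \<int>"
proof -
  have nb_ex: "\<exists>w. w \<in> N v" if v: "v \<in> V" for v
  proof (rule ccontr)
    assume "\<not> ?thesis"
    then have "N v = {}" by auto
    then have "s * \<alpha> v = 0" using eig[OF v] by simp
    then show False using s0 pos[OF v] by simp
  qed
  have "\<exists>v w. w \<in> N v \<and> 2 * card (N v \<inter> N w) + card (N v) + card (N w) \<noteq> 2"
  proof (rule ccontr)
    assume *: "\<not> ?thesis"
    have "card (N v) = 1" if v: "v \<in> V" for v
    proof -
      obtain w where w: "w \<in> N v" using nb_ex[OF v] by blast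
      have eq: "2 * card (N v \<inter> N w) + card (N v) + card (N w) = 2" using * w by blast
      have "N v \<noteq> {}" "N w \<noteq> {}" using w nb_sym[OF w] by auto
      then have "card (N v) \<noteq> 0" "card (N w) \<noteq> 0" by simp_all
      then show ?thesis using eq by linarith
    qed
    then show False using nonreg by simp
  qed
  then obtain v w where vw: "w \<in> N v" "2 * card (N v \<inter> N w) + card (N v) + card (N w) \<noteq> 2" by blast
  define l dv dw where "l = real (card (N v \<inter> N w))" "dv = real (card (N v))" "dw = real (card (N w))"
  have vwV: "v \<in> V" "w \<in> V" using nbV[OF vw(1)] by auto
  have "(l + t - 1)\<^sup>2 = (\<alpha> v * \<alpha> w)\<^sup>2" using common_adj[OF vw(1)] by (simp add: l_dv_dw_def)
  also have "\<dots> = (dv - t) * (dw - t)"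
    using deg[OF vwV(1)] deg[OF vwV(2)] by (simp add: l_dv_dw_def power_mult_distrib)
  finally have lin: "t * (2 * l + dv + dw - 2) = dv * dw - (l - 1)\<^sup>2"
    by (simp add: power2_eq_square algebra_simps)
  have "2 * l + dv + dw - 2 \<noteq> 0"
  proof
    assume "2 * l + dv + dw - 2 = 0"
    then have "real (2 * card (N v \<inter> N w) + card (N v) + card (N w)) = real 2" by (simp add: l_dv_dw_def)
    then show False using vw(2) by (simp only: of_nat_eq_iff)
  qed
  then have "t = (dv * dw - (l - 1)\<^sup>2) / (2 * l + dv + dw - 2)" using lin by (simp add: field_simps)
  also have "\<dots> \<in> \<rat>" by (simp add: l_dv_dw_def)
  finally obtain a b where ab: "t = of_int a / of_int b" "b > 0" "coprime a b"
    by (elim Rats_cases') auto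
  have "\<exists>p q. p \<in> V \<and> q \<in> V \<and> p \<noteq> q \<and> q \<notin> N p"
  proof (rule ccontr)
    assume *: "\<not> ?thesis"
    have "N p = V - {p}" if "p \<in> V" for p
      using * that NV[of p] nb_irr[of p] by blast
    then show False using nonreg finV by simp
  qed
  then obtain p q where pq: "p \<in> V" "q \<in> V" "p \<noteq> q" "q \<notin> N p" by blast
  define m dp dq where "m = int (card (N p \<inter> N q))" "dp = int (card (N p))" "dq = int (card (N q))"
  have "(of_int m)\<^sup>2 = (\<alpha> p * \<alpha> q)\<^sup>2" using common_nonadj[OF pq] by (simp add: m_dp_dq_def)
  also have "\<dots> = (of_int dp - t) * (of_int dq - t)"
    using deg[OF pq(1)] deg[OF pq(2)] by (simp add: m_dp_dq_def power_mult_distrib)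
  finally have "t * t = of_int (dp + dq) * t + of_int (m\<^sup>2 - dp * dq)"
    by (simp add: algebra_simps)
  then have "of_int (a * a) = (of_int (b * ((dp + dq) * a + (m\<^sup>2 - dp * dq) * b)) :: real)"
    using ab(1,2) by (simp add: field_simps)
  then have "a * a = b * ((dp + dq) * a + (m\<^sup>2 - dp * dq) * b)" by (simp only: of_int_eq_iff)
  then have "b dvd a * a" by (rule dvdI)
  then have "b dvd a" using ab(3) by (simp add: coprime_commute coprime_dvd_mult_left_iff)
  then have "is_unit b" using ab(3) by (simp add: coprime_absorb_right)
  then have "b = 1" using ab(2) by simp
  then show ?thesis using ab(1) by simp
qed

end

section \<open>Perron vector and rank-one relation from the annihilating cubic\<close>

context nb_graph
begin

definition T :: "real \<Rightarrow> ('a \<Rightarrow> real) \<Rightarrow> 'a \<Rightarrow> real" where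
  "T c f = (\<lambda>v. (\<Sum>w\<in>N v. f w) - c * f v)"

definition ip :: "('a \<Rightarrow> real) \<Rightarrow> ('a \<Rightarrow> real) \<Rightarrow> real" where
  "ip f g = (\<Sum>v\<in>V. f v * g v)"

lemma T_comm: "T a (T b f) = T b (T a f)"
  by (rule ext) (simp add: T_def sum_subtractf sum_distrib_left[symmetric] algebra_simps)

lemma T_scale: "T a (\<lambda>v. c * f v) v = c * T a f v"
  by (simp add: T_def sum_distrib_left[symmetric] algebra_simps)

lemma T_diff: "T a (\<lambda>v. f v - g v) v = T a f v - T a g v"
  by (simp add: T_def sum_subtractf algebra_simps)

lemma ip_T: "ip f (T c g) = ip (T c f) g"
  using sum_nb_swap[of f g]
  by (simp add: ip_def T_def sum_subtractf right_diff_distrib left_diff_distrib mult_ac)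

lemma ip_self_0: "ip f f = 0 \<Longrightarrow> v \<in> V \<Longrightarrow> f v = 0"
  using finV by (simp add: ip_def sum_nonneg_eq_0_iff)

lemma ip_self_nonneg: "0 \<le> ip f f"
  by (simp add: ip_def sum_nonneg)

end

locale three_eigenvalues = nb_graph +
  fixes s t :: real
  assumes connected: "S \<subseteq> V \<Longrightarrow> S \<noteq> {} \<Longrightarrow>
      (\<And>v w. v \<in> S \<Longrightarrow> w \<in> N v \<Longrightarrow> w \<in> S) \<Longrightarrow> S = V"
    and s_gt: "s > 1" and t_gt: "1 > - t"
    and cubic: "v \<in> V \<Longrightarrow> T s (T 1 (T (- t) f)) v = 0"
    and ev: "\<exists>f. (\<forall>v\<in>V. T s f v = 0) \<and> (\<exists>v\<in>V. f v \<noteq> 0)"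
begin

text \<open>The cubic splits \<open>g = (A - s I) f\<close> into orthogonal parts \<open>g1\<close>,
  \<open>g2\<close> in the eigenspaces of 1 and \<open>- t\<close>, whence
  \<open>ip f g = - |g1|^2 / (s - 1) - |g2|^2 / (s + t)\<close>. No diagonalization of
  \<open>A\<close> is involved.\<close>

lemma rayleigh:
  shows "ip f (T s f) \<le> 0" and "ip f (T s f) = 0 \<Longrightarrow> v \<in> V \<Longrightarrow> T s f v = 0"
proof -
  define g where "g = T s f"
  define g1 where "g1 = (\<lambda>v. 1 / (1 + t) * T (- t) g v)"
  define g2 where "g2 = (\<lambda>v. - 1 / (1 + t) * T 1 g v)"
  have g: "g v = g1 v + g2 v" for v
  proof -
    have "T (- t) g v - T 1 g v = (1 + t) * g v" by (simp add: T_def algebra_simps)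
    moreover have "g1 v + g2 v = (T (- t) g v - T 1 g v) / (1 + t)"
      by (simp add: g1_def g2_def diff_divide_distrib)
    ultimately show ?thesis using t_gt by simp
  qed
  have cub: "T 1 (T (- t) g) v = 0" if "v \<in> V" for v
    using cubic[OF that, of f] by (simp add: g_def T_comm[of _ s])
  have e1: "T 1 g1 v = 0" if "v \<in> V" for v
    using cub[OF that] unfolding g1_def T_scale by simp
  have e2: "T (- t) g2 v = 0" if "v \<in> V" for v
    using cub[OF that] unfolding g2_def T_scale by (simp add: T_comm[of "- t"])
  have s1: "T s g1 v = (1 - s) * g1 v" if "v \<in> V" for v
    using e1[OF that] by (simp add: T_def algebra_simps)
  have s2: "T s g2 v = (- t - s) * g2 v" if "v \<in> V" for v
    using e2[OF that] by (simp add: T_def algebra_simps)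
  have "ip g1 (T 1 g2) = 0"
    unfolding ip_T using e1 by (simp add: ip_def)
  moreover have "T 1 g2 v = (- t - 1) * g2 v" if "v \<in> V" for v
    using e2[OF that] by (simp add: T_def algebra_simps)
  then have "ip g1 (T 1 g2) = (- t - 1) * ip g1 g2"
    by (simp add: ip_def sum_distrib_left mult_ac)
  ultimately have orth: "ip g1 g2 = 0" using t_gt by simp
  have f1: "(1 - s) * ip f g1 = ip g1 g1"
  proof -
    have "(1 - s) * ip f g1 = ip f (T s g1)"
      using s1 by (simp add: ip_def sum_distrib_left mult_ac)
    also have "\<dots> = ip g g1" by (simp add: ip_T g_def)
    also have "\<dots> = ip g1 g1 + ip g1 g2"
      by (simp add: ip_def g distrib_right sum.distrib mult.commute[of "g2 _"])
    finally show ?thesis using orth by simp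
  qed
  have f2: "(- t - s) * ip f g2 = ip g2 g2"
  proof -
    have "(- t - s) * ip f g2 = ip f (T s g2)"
      using s2 by (simp add: ip_def sum_distrib_left mult_ac)
    also have "\<dots> = ip g g2" by (simp add: ip_T g_def)
    also have "\<dots> = ip g1 g2 + ip g2 g2"
      by (simp add: ip_def g distrib_right sum.distrib)
    finally show ?thesis using orth by simp
  qed
  have fg: "ip f g = ip f g1 + ip f g2"
    by (simp add: ip_def g distrib_left sum.distrib)
  have ip1: "ip f g1 = - (ip g1 g1 / (s - 1))" and ip2: "ip f g2 = - (ip g2 g2 / (s + t))"
    using f1 f2 s_gt t_gt by (simp_all add: field_simps)
  have nn: "0 \<le> ip g1 g1 / (s - 1)" "0 \<le> ip g2 g2 / (s + t)"
    using ip_self_nonneg s_gt t_gt by simp_all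
  show "ip f (T s f) \<le> 0" using fg ip1 ip2 nn by (simp add: g_def)
  assume "ip f (T s f) = 0" and v: "v \<in> V"
  then have "ip f g = 0" by (simp add: g_def)
  then have "ip g1 g1 / (s - 1) = 0" "ip g2 g2 / (s + t) = 0"
    using fg ip1 ip2 nn by linarith+
  then have "ip g1 g1 = 0" "ip g2 g2 = 0" using s_gt t_gt by simp_all
  then have "g1 v = 0" "g2 v = 0" using ip_self_0 v by blast+
  then show "T s f v = 0" using g[of v] by (simp add: g_def)
qed

text \<open>Passing to absolute values does not decrease the form, so they attain the maximum in
  \<open>rayleigh\<close>.\<close>

lemma abs_eigenvector:
  assumes f: "\<And>v. v \<in> V \<Longrightarrow> T s f v = 0" and v: "v \<in> V"
  shows "T s (\<lambda>w. \<bar>f w\<bar>) v = 0"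
proof -
  let ?h = "\<lambda>w. \<bar>f w\<bar>"
  have "0 = ip f (T s f)" using f by (simp add: ip_def)
  also have "\<dots> \<le> ip ?h (T s ?h)"
    unfolding ip_def
  proof (rule sum_mono)
    fix v
    have "f v * (\<Sum>w\<in>N v. f w) \<le> \<bar>f v\<bar> * \<bar>\<Sum>w\<in>N v. f w\<bar>" by (metis abs_ge_self abs_mult)
    also have "\<dots> \<le> \<bar>f v\<bar> * (\<Sum>w\<in>N v. \<bar>f w\<bar>)" by (intro mult_left_mono sum_abs) simp
    finally show "f v * T s f v \<le> ?h v * T s ?h v" by (simp add: T_def algebra_simps)
  qed
  finally have "ip ?h (T s ?h) = 0" using rayleigh(1)[of ?h] by simp
  then show ?thesis using rayleigh(2) v by blast
qed

text \<open>Since the absolute value of \<open>f\<close> is an eigenvector as well, a zero of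
  \<open>f\<close> spreads to its neighbours. Applied to differences, this makes the eigenspace of
  \<open>s\<close> one-dimensional.\<close>

lemma eigenvector_zero:
  assumes f: "\<And>v. v \<in> V \<Longrightarrow> T s f v = 0" and v0: "v0 \<in> V" "f v0 = 0" and v: "v \<in> V"
  shows "f v = 0"
proof -
  have "{v \<in> V. f v = 0} = V"
  proof (rule connected)
    show "{v \<in> V. f v = 0} \<noteq> {}" using v0 by auto
    fix v w assume vw: "v \<in> {v \<in> V. f v = 0}" "w \<in> N v"
    have "(\<Sum>w\<in>N v. \<bar>f w\<bar>) = 0"
      using abs_eigenvector[OF f, of v] vw by (simp add: T_def)
    then have "f w = 0" using vw(2) by (simp add: sum_nonneg_eq_0_iff)
    then show "w \<in> {v \<in> V. f v = 0}" using nbV[OF vw(2)] by simp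
  qed auto
  then show ?thesis using v by blast
qed

lemma perron: obtains h where "\<And>v. v \<in> V \<Longrightarrow> T s h v = 0" "\<And>v. v \<in> V \<Longrightarrow> h v > 0"
proof -
  obtain f v1 where f: "\<And>v. v \<in> V \<Longrightarrow> T s f v = 0" "v1 \<in> V" "f v1 \<noteq> 0" using ev by blast
  have "f v \<noteq> 0" if "v \<in> V" for v using eigenvector_zero[OF f(1) that _ f(2)] f(3) by blast
  then show ?thesis using that[of "\<lambda>v. \<bar>f v\<bar>"] abs_eigenvector[OF f(1)] by simp
qed

text \<open>By the cubic the columns of \<open>(A - I) (A + t I)\<close> are killed by
  \<open>A - s I\<close>, hence multiples of the Perron vector \<open>h\<close>; by symmetry the
  matrix is \<open>k h h^T\<close>. Pairing with \<open>h\<close> gives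
  \<open>k |h|^2 = (s + t) (s - 1) > 0\<close>, which permits scaling by
  \<open>sqrt k\<close>.\<close>

lemma ex_three_ev: "\<exists>\<alpha>. three_ev V N \<alpha> s t"
proof -
  obtain h where h: "\<And>v. v \<in> V \<Longrightarrow> T s h v = 0" "\<And>v. v \<in> V \<Longrightarrow> h v > 0" using perron by blast
  obtain f v0 where v0: "v0 \<in> V" "f v0 \<noteq> (0::real)" using ev by blast
  define d where "d u = (\<lambda>v. if v = u then 1 else 0 :: real)" for u :: 'a
  define m where "m u = T 1 (T (- t) (d u))" for u
  have m: "m u v = real (card (N v \<inter> N u)) + (if u \<in> N v then t - 1 else 0) - (if u = v then t else 0)"
    if "u \<in> V" "v \<in> V" for u v
  proof -
    have Nd: "(\<Sum>w\<in>N v. d u w) = (if u \<in> N v then 1 else 0)" for v by (simp add: d_def)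
    have "(\<Sum>w\<in>N v. (if u \<in> N w then 1 else 0)) = real (card (N v \<inter> N u))"
    proof -
      have "(\<Sum>w\<in>N v. (if u \<in> N w then 1 else 0 :: real)) = (\<Sum>w\<in>N v. if w \<in> N u then 1 else 0)"
        by (intro sum.cong refl) (use nb_sym in auto)
      also have "\<dots> = real (card (N v \<inter> N u))" by (simp flip: sum.inter_restrict)
      finally show ?thesis .
    qed
    then show ?thesis
      unfolding m_def T_def Nd
      by (auto simp: sum.distrib sum_subtractf sum_distrib_left[symmetric] Nd d_def nb_irr algebra_simps)
  qed
  have m_sym: "m u v = m v u" if "u \<in> V" "v \<in> V" for u v
    using m[OF that] m[OF that(2,1)] nb_iff[of u v] by (simp add: Int_commute)
  have m_ev: "T s (m u) v = 0" if "v \<in> V" for u v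
    unfolding m_def by (rule cubic[OF that])
  have m_eq: "m u v = m u v0 / h v0 * h v" if v: "v \<in> V" for u v
  proof -
    define k where "k = m u v0 / h v0"
    have "m u v - k * h v = 0"
    proof (rule eigenvector_zero[of "\<lambda>v. m u v - k * h v", OF _ v0(1) _ v])
      show "T s (\<lambda>v. m u v - k * h v) w = 0" if "w \<in> V" for w
        using m_ev[OF that] h(1)[OF that] by (simp add: T_diff T_scale)
      show "m u v0 - k * h v0 = 0" using h(2)[OF v0(1)] by (simp add: k_def)
    qed
    then show ?thesis by (simp add: k_def)
  qed
  define k where "k = m v0 v0 / (h v0)\<^sup>2"
  have m_hh: "m u v = k * h u * h v" if uv: "u \<in> V" "v \<in> V" for u v
  proof -
    have "m u v0 = m v0 v0 / h v0 * h u" using m_sym[OF uv(1) v0(1)] m_eq[OF uv(1), of v0] by simp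
    then show ?thesis using m_eq[OF uv(2), of u] by (simp add: k_def power2_eq_square)
  qed
  have "k > 0"
  proof -
    have Th: "T (- t) h v = (s + t) * h v" if "v \<in> V" for v
      using h(1)[OF that] by (simp add: T_def algebra_simps)
    have "ip h (m v0) = ip (T (- t) (T 1 h)) (d v0)"
      by (simp add: m_def ip_T)
    also have "\<dots> = T (- t) (T 1 h) v0"
      using finV v0(1) by (simp add: ip_def d_def if_distrib cong: if_cong)
    also have "\<dots> = T 1 (T (- t) h) v0" by (simp add: T_comm[of 1])
    also have "\<dots> = (s + t) * T 1 h v0"
    proof -
      have "(\<Sum>w\<in>N v0. T (- t) h w) = (\<Sum>w\<in>N v0. (s + t) * h w)"
        using nbV by (intro sum.cong refl Th) blast
      then show ?thesis
        unfolding T_def[of 1] using Th[OF v0(1)] by (simp add: sum_distrib_left right_diff_distrib)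
    qed
    also have "T 1 h v0 = (s - 1) * h v0" using h(1)[OF v0(1)] by (simp add: T_def algebra_simps)
    finally have "ip h (m v0) = (s + t) * ((s - 1) * h v0)" .
    moreover have "ip h (m v0) = k * h v0 * ip h h"
      unfolding ip_def sum_distrib_left using m_hh[OF v0(1)] by (intro sum.cong refl) simp
    ultimately have "k * ip h h = (s + t) * (s - 1)" using h(2)[OF v0(1)] by simp
    moreover have "(s + t) * (s - 1) > 0" using s_gt t_gt by (intro mult_pos_pos) auto
    ultimately have "k * ip h h > 0" by simp
    then show ?thesis using ip_self_nonneg[of h] by (simp add: zero_less_mult_iff)
  qed
  define \<alpha> where "\<alpha> v = sqrt k * h v" for v
  have m\<alpha>: "m u v = \<alpha> u * \<alpha> v" if "u \<in> V" "v \<in> V" for u v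
    using m_hh[OF that] \<open>k > 0\<close> by (simp add: \<alpha>_def)
  have "three_ev V N \<alpha> s t"
  proof unfold_locales
    fix v assume v: "v \<in> V"
    show "0 < \<alpha> v" using \<open>k > 0\<close> h(2)[OF v] by (simp add: \<alpha>_def)
    show "real (card (N v)) = (\<alpha> v)\<^sup>2 + t"
      using m[OF v v] m\<alpha>[OF v v] nb_irr[of v] by (simp add: power2_eq_square)
    have "(\<Sum>w\<in>N v. h w) = s * h v" using h(1)[OF v] by (simp add: T_def)
    then show "(\<Sum>w\<in>N v. \<alpha> w) = s * \<alpha> v" by (simp add: \<alpha>_def sum_distrib_left[symmetric])
  next
    fix v w assume vw: "w \<in> N v"
    then have V: "v \<in> V" "w \<in> V" "v \<noteq> w" "v \<in> N w" using nbV nb_irr nb_sym by auto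
    show "real (card (N v \<inter> N w)) = \<alpha> v * \<alpha> w + 1 - t"
      using m[OF V(2,1)] m\<alpha>[OF V(2,1)] V vw by (simp add: mult.commute)
  next
    fix v w assume V: "v \<in> V" "w \<in> V" "v \<noteq> w" "w \<notin> N v"
    show "real (card (N v \<inter> N w)) = \<alpha> v * \<alpha> w"
      using m[OF V(2,1)] m\<alpha>[OF V(2,1)] V by (simp add: mult.commute)
  qed
  then show ?thesis by blast
qed

end

section \<open>Spectrum and annihilating polynomial\<close>

locale symmetric_real_mat =
  fixes n :: nat and A :: "real mat"
  assumes A: "A \<in> carrier_mat n n"
    and sym: "i < n \<Longrightarrow> j < n \<Longrightarrow> A $$ (i, j) = A $$ (j, i)"
begin

text \<open>The operator \<open>A - r I\<close>, on complex functions because triangularization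
  needs the characteristic polynomial in linear factors.\<close>

definition D :: "real \<Rightarrow> (nat \<Rightarrow> complex) \<Rightarrow> nat \<Rightarrow> complex" where
  "D r f = (\<lambda>i. (\<Sum>j<n. of_real (A $$ (i, j)) * f j) - of_real r * f i)"

lemma D_cong: "(\<And>j. j < n \<Longrightarrow> f j = g j) \<Longrightarrow> i < n \<Longrightarrow> D r f i = D r g i"
  by (simp add: D_def)

lemma D_comm: "D a (D b f) = D b (D a f)"
  by (rule ext) (simp add: D_def sum_subtractf right_diff_distrib sum_distrib_left mult_ac)

lemma D_sum: "D r (\<lambda>i. \<Sum>l\<in>L. c l * F l i) = (\<lambda>i. \<Sum>l\<in>L. c l * D r (F l) i)"
proof (rule ext)
  fix i
  have "(\<Sum>j<n. of_real (A $$ (i, j)) * (\<Sum>l\<in>L. c l * F l j)) = (\<Sum>l\<in>L. c l * (\<Sum>j<n. of_real (A $$ (i, j)) * F l j))"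
    by (simp add: sum_distrib_left sum.swap[of _ L] mult_ac)
  then show "D r (\<lambda>i. \<Sum>l\<in>L. c l * F l i) i = (\<Sum>l\<in>L. c l * D r (F l) i)"
    by (simp add: D_def right_diff_distrib sum_subtractf sum_distrib_left mult_ac)
qed

lemma D_adjoint: "(\<Sum>i<n. cnj (f i) * D r g i) = (\<Sum>i<n. cnj (D r f i) * g i)"
proof -
  have "(\<Sum>i<n. cnj (f i) * (\<Sum>j<n. of_real (A $$ (i, j)) * g j))
      = (\<Sum>i<n. \<Sum>j<n. cnj (f i) * (of_real (A $$ (i, j)) * g j))"
    by (simp add: sum_distrib_left)
  also have "\<dots> = (\<Sum>j<n. \<Sum>i<n. cnj (f i) * (of_real (A $$ (i, j)) * g j))"
    by (rule sum.swap)
  also have "\<dots> = (\<Sum>j<n. cnj (\<Sum>i<n. of_real (A $$ (j, i)) * f i) * g j)"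
  proof (rule sum.cong[OF refl])
    fix j assume "j \<in> {..<n}"
    then have "(\<Sum>i<n. cnj (f i) * (of_real (A $$ (i, j)) * g j)) = (\<Sum>i<n. cnj (of_real (A $$ (j, i)) * f i) * g j)"
      by (intro sum.cong refl) (simp add: sym mult_ac)
    then show "(\<Sum>i<n. cnj (f i) * (of_real (A $$ (i, j)) * g j)) = cnj (\<Sum>i<n. of_real (A $$ (j, i)) * f i) * g j"
      by (simp only: cnj_sum sum_distrib_right)
  qed
  finally show ?thesis
    by (simp add: D_def right_diff_distrib left_diff_distrib sum_subtractf mult_ac)
qed

lemma norm_sum_0:
  assumes "(\<Sum>i<n. cnj (f i) * f i) = 0" "i < n" shows "f i = 0"
proof -
  have "(\<Sum>i<n. cnj (f i) * f i) = of_real (\<Sum>i<n. (cmod (f i))\<^sup>2)"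
    by (simp add: complex_norm_square[symmetric] mult.commute)
  then have "(\<Sum>i<n. (cmod (f i))\<^sup>2) = 0" using assms(1) by (metis of_real_eq_0_iff)
  then show ?thesis using assms(2) by (simp add: sum_nonneg_eq_0_iff)
qed

text \<open>Self-adjointness of \<open>A - r I\<close> moves one factor across the Hermitian
  product, so the square norm of \<open>D r f\<close> vanishes.\<close>

lemma D_D_eq_0:
  assumes "\<And>i. i < n \<Longrightarrow> D r (D r f) i = 0" "i < n" shows "D r f i = 0"
proof (rule norm_sum_0[OF _ assms(2)])
  have "(\<Sum>i<n. cnj (D r f i) * D r f i) = (\<Sum>i<n. cnj (D r (D r f) i) * f i)" by (rule D_adjoint)
  then show "(\<Sum>i<n. cnj (D r f i) * D r f i) = 0" using assms(1) by simp
qed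

abbreviation Ac :: "complex mat" where "Ac \<equiv> map_mat complex_of_real A"

lemma Ac: "Ac \<in> carrier_mat n n" using A by simp

text \<open>Symmetry makes \<mu> real; the real or the imaginary part of the eigenvector is then a
  nonzero real eigenvector.\<close>

lemma complex_eigenvalue:
  assumes "eigenvalue Ac \<mu>" shows "\<exists>r \<in> spectrum A. \<mu> = of_real r"
proof -
  obtain v where v: "v \<in> carrier_vec n" "v \<noteq> 0\<^sub>v n" "Ac *\<^sub>v v = \<mu> \<cdot>\<^sub>v v"
    using assms Ac by (auto simp: eigenvalue_def eigenvector_def)
  define w where "w i = v $ i" for i
  have w: "(\<Sum>j<n. of_real (A $$ (i, j)) * w j) = \<mu> * w i" if "i < n" for i
  proof -
    have "(Ac *\<^sub>v v) $ i = (\<Sum>j<n. of_real (A $$ (i, j)) * w j)"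
      using that A v(1) by (simp add: scalar_prod_def w_def atLeast0LessThan)
    then show ?thesis using v(1,3) that by (simp add: w_def)
  qed
  have "\<exists>i0<n. w i0 \<noteq> 0"
  proof (rule ccontr)
    assume "\<not> ?thesis"
    then have "v = 0\<^sub>v n" using v(1) by (intro eq_vecI) (auto simp: w_def)
    then show False using v(2) by simp
  qed
  then obtain i0 where i0: "i0 < n" "w i0 \<noteq> 0" by blast
  define S where "S = (\<Sum>i<n. cnj (w i) * w i)"
  have "S \<noteq> 0" using norm_sum_0[of w i0] i0 by (auto simp: S_def)
  have Dw: "D 0 w i = \<mu> * w i" if "i < n" for i using w[OF that] by (simp add: D_def)
  have "\<mu> * S = (\<Sum>i<n. cnj (w i) * D 0 w i)"
    unfolding S_def sum_distrib_left by (intro sum.cong refl) (simp add: Dw)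
  also have "\<dots> = (\<Sum>i<n. cnj (D 0 w i) * w i)" by (rule D_adjoint)
  also have "\<dots> = cnj \<mu> * S"
    unfolding S_def sum_distrib_left by (intro sum.cong refl) (simp add: Dw)
  finally have "\<mu> = cnj \<mu>" using \<open>S \<noteq> 0\<close> by simp
  then have "\<mu> \<in> \<real>" by (simp add: Reals_cnj_iff)
  then obtain r where r: "\<mu> = of_real r" by (auto elim: Reals_cases)
  have ev: "r \<in> spectrum A" if x: "\<And>i. i < n \<Longrightarrow> (\<Sum>j<n. A $$ (i, j) * x j) = r * x i" "x i0 \<noteq> 0" for x :: "nat \<Rightarrow> real"
  proof -
    have "A *\<^sub>v vec n x = r \<cdot>\<^sub>v vec n x"
      using A by (intro eq_vecI) (auto simp: scalar_prod_def atLeast0LessThan x(1))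
    moreover have "vec n x \<noteq> 0\<^sub>v n"
      using i0(1) x(2) by (metis index_vec index_zero_vec(1))
    ultimately have "eigenvector A (vec n x) r" using A by (simp add: eigenvector_def)
    then show ?thesis by (auto simp: spectrum_def eigenvalue_def)
  qed
  have Re: "(\<Sum>j<n. A $$ (i, j) * Re (w j)) = r * Re (w i)" if "i < n" for i
    using arg_cong[OF w[OF that], of Re] by (simp add: r)
  have Im: "(\<Sum>j<n. A $$ (i, j) * Im (w j)) = r * Im (w i)" if "i < n" for i
    using arg_cong[OF w[OF that], of Im] by (simp add: r)
  have "Re (w i0) \<noteq> 0 \<or> Im (w i0) \<noteq> 0" using i0(2) by (simp add: complex_eq_iff)
  then have "r \<in> spectrum A" using ev[of "\<lambda>j. Re (w j)"] ev[of "\<lambda>j. Im (w j)"] Re Im by blast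
  then show ?thesis using r by blast
qed

text \<open>Upper triangularization gives a flag of invariant subspaces; symmetry excludes Jordan blocks.\<close>

lemma annihilated_complex:
  assumes spec: "spectrum A \<subseteq> {a, b, c}" and i: "i < n"
  shows "D a (D b (D c f)) i = 0"
proof -
  obtain as where as: "char_poly Ac = (\<Prod>e\<leftarrow>as. [:- e, 1:])"
    using char_poly_factorized[OF Ac] by blast
  obtain U P Q where sch: "schur_decomposition Ac as = (U, P, Q)"
    by (cases "schur_decomposition Ac as") auto
  have wit: "similar_mat_wit Ac U P Q" "upper_triangular U" "diag_mat U = as"
    using schur_decomposition[OF Ac as sch] by auto
  note sim = similar_mat_witD2[OF Ac wit(1)]
  define p where "p k i = P $$ (i, k)" for k i
  have AP: "Ac * P = P * U"
  proof -
    have "Ac * P = P * U * Q * P" using sim(3) by simp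
    also have "\<dots> = P * U * (Q * P)" using sim(5-7) by (intro assoc_mult_mat[of _ n n _ n _ n]) auto
    also have "\<dots> = P * U" using sim(2,5,6) by simp
    finally show ?thesis .
  qed
  have diag: "\<exists>r \<in> {a, b, c}. U $$ (k, k) = of_real r" if "k < n" for k
  proof -
    have "U $$ (k, k) \<in> set as" using that sim(5) wit(3) by (auto simp: diag_mat_def)
    then have "poly (char_poly Ac) (U $$ (k, k)) = 0"
      unfolding as by (simp add: poly_prod_list prod_list_zero_iff image_iff)
    then have "eigenvalue Ac (U $$ (k, k))" using eigenvalue_root_char_poly[OF Ac] by simp
    then show ?thesis using complex_eigenvalue spec by blast
  qed
  have col: "(\<Sum>j<n. of_real (A $$ (i, j)) * p k j) = (\<Sum>l<k. U $$ (l, k) * p l i) + U $$ (k, k) * p k i"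
    if "i < n" "k < n" for i k
  proof -
    have "(Ac * P) $$ (i, k) = (\<Sum>j<n. of_real (A $$ (i, j)) * p k j)"
      using that A sim(6) by (simp add: scalar_prod_def p_def atLeast0LessThan)
    moreover have "(P * U) $$ (i, k) = (\<Sum>l<n. p l i * U $$ (l, k))"
      using that sim(5,6) by (simp add: scalar_prod_def p_def atLeast0LessThan)
    moreover have "(\<Sum>l<n. p l i * U $$ (l, k)) = (\<Sum>l<Suc k. p l i * U $$ (l, k))"
      using that wit(2) sim(5) by (intro sum.mono_neutral_right) (auto simp: upper_triangular_def)
    ultimately show ?thesis using AP by (simp add: mult.commute)
  qed
  have R_cong: "D a (D b (D c f)) i = D a (D b (D c g)) i" if "\<And>j. j < n \<Longrightarrow> f j = g j" "i < n" for f g i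
    using that by (intro D_cong) auto
  \<comment> \<open>With \<open>r\<close> the diagonal entry, \<open>A - r I\<close> maps column
    \<open>k\<close> of \<open>P\<close> into the span of the earlier columns, which the cubic
    kills. So the cubic times \<open>A - r I\<close> kills the column, and \<open>D_D_eq_0\<close>
    removes the repeated factor.\<close>
  have kill: "\<forall>i<n. D a (D b (D c (p k))) i = 0" if "k < n" for k
    using that
  proof (induction k rule: less_induct)
    case (less k)
    obtain r where r: "r \<in> {a, b, c}" "U $$ (k, k) = of_real r" using diag[OF less.prems] by blast
    have "D r (p k) i = (\<Sum>l<k. U $$ (l, k) * p l i)" if "i < n" for i
      using col[OF that less.prems] r(2) by (simp add: D_def)
    then have R: "D a (D b (D c (D r (p k)))) i = 0" if "i < n" for i
      using R_cong[of "D r (p k)" "\<lambda>i. \<Sum>l<k. U $$ (l, k) * p l i" i] that less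
      by (simp add: D_sum)
    have "\<exists>r' r''. \<forall>f. D a (D b (D c f)) = D r (D r' (D r'' f))"
    proof -
      consider "r = a" | "r = b" | "r = c" using r(1) by blast
      then show ?thesis
      proof cases
        case 1 then show ?thesis by blast
      next
        case 2 then show ?thesis using D_comm[of a b] by metis
      next
        case 3
        have "D a (D b (D c f)) = D c (D a (D b f))" for f
          by (simp only: D_comm[of b c] D_comm[of a c])
        then show ?thesis using 3 by blast
      qed
    qed
    then obtain r' r'' where r': "\<And>f. D a (D b (D c f)) = D r (D r' (D r'' f))" by blast
    have comm: "D r' (D r'' (D r g)) = D r (D r' (D r'' g))" for g
      by (simp only: D_comm[of r'' r] D_comm[of r' r])
    have "D r (D r (D r' (D r'' (p k)))) i = 0" if "i < n" for i
      using R[OF that] unfolding r' comm .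
    then have "D r (D r' (D r'' (p k))) i = 0" if "i < n" for i
      using D_D_eq_0[of r "D r' (D r'' (p k))" i] that by blast
    then show ?case unfolding r' by blast
  qed
  define q where "q k = (\<Sum>j<n. Q $$ (k, j) * f j)" for k
  have "f j = (\<Sum>k<n. q k * p k j)" if j: "j < n" for j
  proof -
    have PQ: "(\<Sum>k<n. P $$ (j, k) * Q $$ (k, l)) = (if j = l then 1 else 0)" if "l < n" for l
    proof -
      have "(P * Q) $$ (j, l) = (\<Sum>k<n. P $$ (j, k) * Q $$ (k, l))"
        using that j sim(6,7) by (simp add: scalar_prod_def atLeast0LessThan)
      then show ?thesis using sim(1) that j by simp
    qed
    have "(\<Sum>k<n. q k * p k j) = (\<Sum>k<n. \<Sum>l<n. P $$ (j, k) * Q $$ (k, l) * f l)"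
      by (simp add: q_def p_def sum_distrib_left mult_ac)
    also have "\<dots> = (\<Sum>l<n. (\<Sum>k<n. P $$ (j, k) * Q $$ (k, l)) * f l)"
      by (subst sum.swap) (simp add: sum_distrib_right)
    also have "\<dots> = (\<Sum>l<n. (if j = l then 1 else 0) * f l)"
      by (intro sum.cong refl) (simp add: PQ)
    also have "\<dots> = f j" using j by (simp add: if_distrib[of "\<lambda>x. x * _"] cong: if_cong)
    finally show ?thesis by simp
  qed
  then have "D a (D b (D c f)) i = D a (D b (D c (\<lambda>i. \<Sum>k<n. q k * p k i))) i"
    by (rule R_cong) (use i in auto)
  also have "\<dots> = 0" using kill i by (simp add: D_sum)
  finally show ?thesis .
qed

definition Dr :: "real \<Rightarrow> (nat \<Rightarrow> real) \<Rightarrow> nat \<Rightarrow> real" where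
  "Dr r f = (\<lambda>i. (\<Sum>j<n. A $$ (i, j) * f j) - r * f i)"

lemma annihilated:
  assumes "spectrum A \<subseteq> {a, b, c}" "i < n"
  shows "Dr a (Dr b (Dr c f)) i = 0"
proof -
  have "D r (\<lambda>i. of_real (g i)) = (\<lambda>i. of_real (Dr r g i))" for r g
    by (rule ext) (simp add: D_def Dr_def)
  then have "D a (D b (D c (\<lambda>i. of_real (f i)))) i = of_real (Dr a (Dr b (Dr c f)) i)" by simp
  then show ?thesis using annihilated_complex[OF assms] by (metis of_real_eq_0_iff)
qed

end

section \<open>Graphs with three eigenvalues\<close>

lemma nb_graph_verts:
  assumes "graph G" shows "nb_graph (verts G) (\<lambda>v. {w. v \<rightarrow>\<^bsub>G\<^esub> w})"
proof -
  interpret graph G by fact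
  show ?thesis
  proof unfold_locales
    fix v w assume "w \<in> {w. v \<rightarrow>\<^bsub>G\<^esub> w}"
    then show "v \<in> verts G \<and> w \<in> verts G" "v \<in> {v. w \<rightarrow>\<^bsub>G\<^esub> v}"
      using adj_in_verts sym_arcs by (auto simp: symmetric_def sym_def)
  next
    fix v show "v \<notin> {w. v \<rightarrow>\<^bsub>G\<^esub> w}" using adj_not_same by auto
  qed simp
qed

lemma card_nb_eq_out_degree:
  assumes "graph G" shows "card {w. v \<rightarrow>\<^bsub>G\<^esub> w} = out_degree G v"
proof -
  interpret graph G by fact
  have "inj_on (head G) (out_arcs G v)"
    using no_multi_arcs by (auto simp: inj_on_def arc_to_ends_def)
  moreover have "head G ` out_arcs G v = {w. v \<rightarrow>\<^bsub>G\<^esub> w}"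
    by (auto simp: arcs_ends_conv image_iff)
  ultimately show ?thesis unfolding out_degree_def by (metis card_image)
qed

lemma three_eigenvalues_verts:
  fixes s t :: real
  assumes G: "graph G" and vs: "distinct vs" "set vs = verts G" and conn: "connected G"
    and spec: "spectrum (adjacency_matrix G vs) = {s, 1, - t}" and st: "s > 1" "1 > - t"
  shows "three_eigenvalues (verts G) (\<lambda>v. {w. v \<rightarrow>\<^bsub>G\<^esub> w}) s t"
proof -
  interpret graph G by fact
  interpret nb: nb_graph "verts G" "\<lambda>v. {w. v \<rightarrow>\<^bsub>G\<^esub> w}" by (rule nb_graph_verts[OF G])
  define n where "n = length vs"
  define A where "A = adjacency_matrix G vs"
  have A_entry: "A $$ (i, j) = (if vs ! i \<rightarrow>\<^bsub>G\<^esub> vs ! j then 1 else 0)" if "i < n" "j < n" for i j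
    using that by (simp add: A_def adjacency_matrix_def n_def)
  interpret M: symmetric_real_mat n A
  proof
    show "A \<in> carrier_mat n n" by (simp add: A_def adjacency_matrix_def n_def)
    show "A $$ (i, j) = A $$ (j, i)" if "i < n" "j < n" for i j
      using that nb.nb_sym by (auto simp: A_entry)
  qed
  have bij: "bij_betw (nth vs) {..<n} (verts G)"
    using vs by (simp add: n_def bij_betw_nth)
  have T_eq: "nb.T c f (vs ! i) = M.Dr c (\<lambda>j. f (vs ! j)) i" if "i < n" for c f i
  proof -
    have v: "vs ! i \<in> verts G" using that vs(2) nth_mem n_def by metis
    have "(\<Sum>w\<in>{w. vs ! i \<rightarrow>\<^bsub>G\<^esub> w}. f w) = (\<Sum>w\<in>verts G. if w \<in> {w. vs ! i \<rightarrow>\<^bsub>G\<^esub> w} then f w else 0)"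
      by (rule nb.sum_N_eq[OF v])
    also have "\<dots> = (\<Sum>j<n. if vs ! j \<in> {w. vs ! i \<rightarrow>\<^bsub>G\<^esub> w} then f (vs ! j) else 0)"
      by (rule sum.reindex_bij_betw[OF bij, symmetric])
    also have "\<dots> = (\<Sum>j<n. A $$ (i, j) * f (vs ! j))"
      using that by (intro sum.cong refl) (simp add: A_entry)
    finally show ?thesis by (simp add: nb.T_def M.Dr_def)
  qed
  have Dr_cong: "M.Dr c f i = M.Dr c g i" if "\<And>j. j < n \<Longrightarrow> f j = g j" "i < n" for c f g i
    using that by (simp add: M.Dr_def)
  have index: "\<exists>i<n. vs ! i = v" if "v \<in> verts G" for v
    using that vs(2) by (auto simp: in_set_conv_nth n_def)
  show ?thesis
  proof unfold_locales
    fix S assume S: "S \<subseteq> verts G" "S \<noteq> {}" and closed: "\<And>v w. v \<in> S \<Longrightarrow> w \<in> {w. v \<rightarrow>\<^bsub>G\<^esub> w} \<Longrightarrow> w \<in> S"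
    obtain a where a: "a \<in> S" using S(2) by blast
    have "b \<in> S" if b: "b \<in> verts G" for b
    proof -
      \<comment> \<open>\<open>connected\<close> refers to the symmetrized digraph, which has the
        same reachability because the arcs are already symmetric.\<close>
      have "a \<rightarrow>\<^sup>*\<^bsub>with_proj (mk_symmetric G)\<^esub> b"
        using conn a b S(1) by (auto simp: connected_def strongly_connected_def)
      then have "a \<rightarrow>\<^sup>*\<^bsub>G\<^esub> b"
        by (simp only: reachable_mk_symmetric_eq[OF sym_arcs])
      then show ?thesis
      proof (induction rule: reachable_induct)
        case base show ?case by (rule a)
      next
        case (step v w)
        then show ?case using closed[OF step(3)] by simp
      qed
    qed
    then show "S = verts G" using S(1) by blast
  next
    fix f :: "'a \<Rightarrow> real" and v assume "v \<in> verts G"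
    then obtain i where i: "i < n" "vs ! i = v" using index by blast
    let ?F = "\<lambda>j. f (vs ! j)"
    have 1: "nb.T (- t) f (vs ! j) = M.Dr (- t) ?F j" if "j < n" for j
      using that by (rule T_eq)
    have 2: "nb.T 1 (nb.T (- t) f) (vs ! j) = M.Dr 1 (M.Dr (- t) ?F) j" if "j < n" for j
      unfolding T_eq[OF that] using 1 that by (rule Dr_cong)
    have "nb.T s (nb.T 1 (nb.T (- t) f)) (vs ! i) = M.Dr s (M.Dr 1 (M.Dr (- t) ?F)) i"
      unfolding T_eq[OF i(1)] using 2 i(1) by (rule Dr_cong)
    also have "\<dots> = 0" by (rule M.annihilated) (use spec i in \<open>simp_all add: A_def\<close>)
    finally show "nb.T s (nb.T 1 (nb.T (- t) f)) v = 0" using i(2) by simp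
  next
    have "s \<in> spectrum A" using spec by (simp add: A_def)
    then obtain x where x: "x \<in> carrier_vec n" "x \<noteq> 0\<^sub>v n" "A *\<^sub>v x = s \<cdot>\<^sub>v x"
      using M.A by (auto simp: spectrum_def eigenvalue_def eigenvector_def)
    define f where "f w = x $ (THE i. i < n \<and> vs ! i = w)" for w
    have f: "f (vs ! i) = x $ i" if "i < n" for i
    proof -
      have "(THE k. k < n \<and> vs ! k = vs ! i) = i"
        using that vs(1) by (auto simp: n_def nth_eq_iff_index_eq)
      then show ?thesis by (simp add: f_def)
    qed
    have "nb.T s f v = 0" if "v \<in> verts G" for v
    proof -
      obtain i where i: "i < n" "vs ! i = v" using index[OF \<open>v \<in> verts G\<close>] by blast
      have "(A *\<^sub>v x) $ i = (\<Sum>j<n. A $$ (i, j) * f (vs ! j))"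
        using M.A x(1) i(1) by (simp add: scalar_prod_def atLeast0LessThan f)
      then have "(\<Sum>j<n. A $$ (i, j) * f (vs ! j)) = s * x $ i" using x(1,3) i(1) by simp
      then show ?thesis using T_eq[OF i(1), of s f] i f[OF i(1)] by (simp add: M.Dr_def)
    qed
    moreover have "\<exists>v\<in>verts G. f v \<noteq> 0"
    proof (rule ccontr)
      assume *: "\<not> ?thesis"
      have "x $ i = 0" if "i < n" for i
        using * f[OF that] that vs(2) nth_mem n_def by metis
      then have "x = 0\<^sub>v n" using x(1) by (intro eq_vecI) auto
      then show False using x(2) by simp
    qed
    ultimately show "\<exists>f. (\<forall>v\<in>verts G. nb.T s f v = 0) \<and> (\<exists>v\<in>verts G. f v \<noteq> 0)" by blast
  qed (use st in auto)
qed

theorem theorem4p14: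
  fixes s t :: real
    and \<Gamma> :: "('a, 'b) pre_digraph"
    and vs :: "'a list"
  assumes "graph \<Gamma>"
    and "distinct vs" and "set vs = verts \<Gamma>"
    and "connected \<Gamma>"
    and "\<not> regular \<Gamma>"
    and "spectrum (adjacency_matrix \<Gamma> vs) = {s, 1, - t}"
    and "s > 1" and "1 > - t"
    and "\<not> cone \<Gamma>"
    and "\<not> biregular \<Gamma>"
  shows "t \<le> 29"
proof (rule ccontr)
  assume t29: "\<not> t \<le> 29"
  let ?N = "\<lambda>v. {w. v \<rightarrow>\<^bsub>\<Gamma>\<^esub> w}"
  interpret three_eigenvalues "verts \<Gamma>" ?N s t
    using assms by (intro three_eigenvalues_verts)
  obtain \<alpha> where "three_ev (verts \<Gamma>) ?N \<alpha> s t" using ex_three_ev by blast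
  then interpret three_ev "verts \<Gamma>" ?N \<alpha> s t .
  have out: "out_degree \<Gamma> v = card (?N v)" for v
    by (simp add: card_nb_eq_out_degree[OF assms(1)])
  obtain v0 where v0: "v0 \<in> verts \<Gamma>" using ev by blast
  obtain w0 where w0: "w0 \<in> verts \<Gamma>" "out_degree \<Gamma> w0 \<noteq> out_degree \<Gamma> v0"
    using assms(5) by (auto simp: regular_def)
  have "valencies \<Gamma> \<noteq> {out_degree \<Gamma> v0, out_degree \<Gamma> w0}"
    using assms(10) w0(2) by (auto simp: biregular_def)
  then obtain u0 where u0: "u0 \<in> verts \<Gamma>" "out_degree \<Gamma> u0 \<noteq> out_degree \<Gamma> v0" "out_degree \<Gamma> u0 \<noteq> out_degree \<Gamma> w0"
    using v0 w0(1) by (auto simp: valencies_def)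
  have "t \<in> \<int>"
    using t_integer[OF _ v0 w0(1)] assms(7) w0(2) by (simp add: out)
  \<comment> \<open>Integrality raises \<open>t > 29\<close> to the bound 30 required by
    \<open>large_t\<close>.\<close>
  moreover from this have "t \<ge> 30"
    using t29 by (auto elim!: Ints_cases)
  ultimately interpret large_t "verts \<Gamma>" ?N \<alpha> s t by unfold_locales
  have level: "\<alpha> v \<noteq> \<alpha> w" if "v \<in> verts \<Gamma>" "w \<in> verts \<Gamma>" "out_degree \<Gamma> v \<noteq> out_degree \<Gamma> w" for v w
    using deg[OF that(1)] deg[OF that(2)] that(3) by (auto simp: out)
  show False
    using at_most_two_levels[OF v0 w0(1) u0(1)] level v0 w0 u0 by metis
qed

end
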